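(* Let $a>1$, $b>0$, and let $\psi\in L^2(\mathbb{R})$ be such that $\{D_{a^j}T_{kb}\psi\}_{j,k\in\mathbb{Z}}$ is a frame for $L^2(\mathbb{R})$ with lower frame bound $A>0$. Assume that for some constants $C>0$ and $\sigma>0$, $$|\widehat{\psi}(\gamma)|\le \frac{C}{1+|\gamma|^{1+\sigma}},\qquad \gamma\in\mathbb{R}.$$ For $K\in\mathbb{N}$ let $$\varepsilon_K:=\left(\frac{K+1/b}{K^{3+2\sigma}}\right)^{1/2}2C\left[\left(1+\frac{1}{2\sigma}\right)\frac{a^{1+\sigma}}{a^{1+\sigma}-1}\right]^{1/2}.$$ Given any $\epsilon>0$, choose $K\in\mathbb{N}$ such that $\varepsilon_K<\sqrt{2bA}$ and $$\frac{\varepsilon_K}{\sqrt{2bA}-\varepsilon_K}\le\epsilon.$$ Let $N$ be the unique odd integer such that $N-2\le 2bK<N$, let $\psi_K\in L^2(\mathbb{R})$ be defined by $\widehat{\psi_K}:=\widehat{\psi}\,\chi_{[-K,K]}$, and define $\widetilde{\psi_K}$ by $$\widehat{\widetilde{\psi_K}}(\gamma)=\frac{b\,\widehat{\psi_K}(\gamma)}{N\sum_{k\in\mathbb{Z}}|\widehat{\psi_K}(a^k\gamma)|^2}.$$ Denote the synthesis operator of $\{D_{a^j}T_{kb/N}\psi\}_{j,k\in\mathbb{Z}}$ by $U_N$ and the synthesis operator of $\{D_{a^j}T_{kb/N}\widetilde{\psi_K}\}_{j,k\in\mathbb{Z}}$ by $W_N$. Then $$\|I-U_NW_N^*\|\le\epsilon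 .$$
   Context: For $a>0$ and $b\in\mathbb{R}$, the scaling and translation operators on $L^2(\mathbb{R})$ are $D_af(x)=a^{1/2}f(ax)$ and $T_bf(x)=f(x-b)$. The Fourier transform is normalized by $\widehat{f}(\gamma)=\int_{\mathbb{R}}f(x)e^{-2\pi i x\gamma}\,dx$ for $f\in L^1(\mathbb{R})\cap L^2(\mathbb{R})$, extended unitarily to $L^2(\mathbb{R})$. $\chi_E$ is the indicator function of $E$. A sequence $\{f_k\}_{k\in I}$ in a Hilbert space $\mathcal{H}$, with $I$ countable, is a frame if there are constants $A,B>0$ (lower and upper frame bounds) with $A\|f\|^2\le\sum_{k\in I}|\langle f,f_k\rangle|^2\le B\|f\|^2$ for all $f\in\mathcal{H}$; it is a Bessel sequence if the upper inequality holds. The synthesis operator of a Bessel sequence $\{f_k\}_{k\in I}$ is the bounded operator $\ell^2(I)\to\mathcal{H}$, $\{c_k\}\mapsto\sum_{k\in I}c_kf_k$; its adjoint is $f\mapsto\{\langle f,f_k\rangle\}_{k\in I}$. $I$ in the conclusion is the identity operator on $L^2(\mathbb{R})$ and the norm is the operator norm. Identities between Fourier transforms are understood almost everywhere, and the quotient defining $\widehat{\widetilde{\psi_K}}$ is taken as $0$ where $\widehat{\psi_K}$ vanishes. *)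

theory Defs
  imports "HOL-Analysis.Analysis"
begin

section \<open>The space of square-integrable functions\<close>

text \<open>
  Elements of the Hilbert space are represented by Borel measurable functions; two of them
  are the same element iff they agree almost everywhere. All notions below depend only on the
  almost-everywhere class of their arguments, and where a representative has to be picked
  (limits, Fourier transforms) it is picked by Hilbert choice.
\<close>

definition L2 :: "(real \<Rightarrow> complex) set" where
  "L2 = {f \<in> borel_measurable lborel. integrable lborel (\<lambda>x. (cmod (f x))\<^sup>2)}"

definition L2_inner :: "(real \<Rightarrow> complex) \<Rightarrow> (real \<Rightarrow> complex) \<Rightarrow> complex" where
  "L2_inner f g = (LINT x|lborel. f x * cnj (g x))"

definition L2_norm :: "(real \<Rightarrow> complex) \<Rightarrow> real" where
  "L2_norm f = sqrt (LINT x|lborel. (cmod (f x))\<^sup>2)"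

text \<open>
  Convergence in \<open>L2\<close>. The membership conditions matter: the Bochner integral of a
  non-integrable function is 0, so \<open>L2_norm\<close> is meaningless outside \<open>L2\<close>.
\<close>

definition L2_tendsto :: "('i \<Rightarrow> real \<Rightarrow> complex) \<Rightarrow> (real \<Rightarrow> complex) \<Rightarrow> 'i filter \<Rightarrow> bool" where
  "L2_tendsto h g \<F> \<longleftrightarrow>
     (\<forall>i. h i \<in> L2) \<and> g \<in> L2 \<and> ((\<lambda>i. L2_norm (\<lambda>x. h i x - g x)) \<longlongrightarrow> 0) \<F>"

text \<open>The operator norm, with value \<open>\<infinity>\<close> for unbounded operators.\<close>

definition L2_opnorm :: "((real \<Rightarrow> complex) \<Rightarrow> real \<Rightarrow> complex) \<Rightarrow> ereal" where
  "L2_opnorm T = (SUP f\<in>{f \<in> L2. L2_norm f \<le> 1}. ereal (L2_norm (T f)))"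


section \<open>Fourier transform\<close>

definition fourier_L1 :: "(real \<Rightarrow> complex) \<Rightarrow> real \<Rightarrow> complex" where
  "fourier_L1 f \<gamma> = (LINT x|lborel. f x * exp (- 2 * pi * \<i> * x * \<gamma>))"

text \<open>The continuous extension to \<open>L2\<close> of the transform on the dense subspace of integrable
  members of \<open>L2\<close>; the value is determined up to null sets.\<close>

definition fourier_L2 :: "(real \<Rightarrow> complex) \<Rightarrow> real \<Rightarrow> complex" where
  "fourier_L2 f = (SOME g. \<exists>h. (\<forall>n::nat. integrable lborel (h n)) \<and>
     L2_tendsto h f sequentially \<and> L2_tendsto (\<lambda>n. fourier_L1 (h n)) g sequentially)"


section \<open>Frames and their operators\<close>

definition Bessel_seq :: "('i::countable \<Rightarrow> real \<Rightarrow> complex) \<Rightarrow> bool" where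
  "Bessel_seq F \<longleftrightarrow> (\<forall>i. F i \<in> L2) \<and>
     (\<exists>B>0. \<forall>f\<in>L2. (\<lambda>i. (cmod (L2_inner f (F i)))\<^sup>2) summable_on UNIV \<and>
        (\<Sum>\<^sub>\<infinity>i. (cmod (L2_inner f (F i)))\<^sup>2) \<le> B * (L2_norm f)\<^sup>2)"

definition frame_with_bounds ::
    "('i::countable \<Rightarrow> real \<Rightarrow> complex) \<Rightarrow> real \<Rightarrow> real \<Rightarrow> bool" where
  "frame_with_bounds F A B \<longleftrightarrow> A > 0 \<and> B > 0 \<and> (\<forall>i. F i \<in> L2) \<and>
     (\<forall>f\<in>L2. (\<lambda>i. (cmod (L2_inner f (F i)))\<^sup>2) summable_on UNIV \<and>
        A * (L2_norm f)\<^sup>2 \<le> (\<Sum>\<^sub>\<infinity>i. (cmod (L2_inner f (F i)))\<^sup>2) \<and>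
        (\<Sum>\<^sub>\<infinity>i. (cmod (L2_inner f (F i)))\<^sup>2) \<le> B * (L2_norm f)\<^sup>2)"

definition ell2 :: "('i \<Rightarrow> complex) set" where
  "ell2 = {c. (\<lambda>k. (cmod (c k))\<^sup>2) summable_on UNIV}"

definition ell2_inner :: "('i \<Rightarrow> complex) \<Rightarrow> ('i \<Rightarrow> complex) \<Rightarrow> complex" where
  "ell2_inner c d = (\<Sum>\<^sub>\<infinity>k. c k * cnj (d k))"

text \<open>The sum \<open>\<Sum>k. c k F k\<close>, converging unconditionally in \<open>L2\<close>. It is meant for Bessel
  sequences \<open>F\<close> and \<open>c \<in> ell2\<close>, where the limit exists.\<close>

definition synthesis :: "('i::countable \<Rightarrow> real \<Rightarrow> complex) \<Rightarrow> ('i \<Rightarrow> complex) \<Rightarrow> real \<Rightarrow> complex" where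
  "synthesis F c =
     (SOME s. L2_tendsto (\<lambda>S x. \<Sum>k\<in>S. c k * F k x) s (finite_subsets_at_top UNIV))"

text \<open>The Hilbert space adjoint of an operator from \<open>ell2\<close> to \<open>L2\<close>.\<close>

definition L2_adjoint ::
    "(('i \<Rightarrow> complex) \<Rightarrow> real \<Rightarrow> complex) \<Rightarrow> (real \<Rightarrow> complex) \<Rightarrow> 'i \<Rightarrow> complex" where
  "L2_adjoint T = (SOME S. \<forall>f\<in>L2. S f \<in> ell2 \<and>
     (\<forall>c\<in>ell2. L2_inner (T c) f = ell2_inner c (S f)))"


section \<open>Wavelet systems\<close>

definition dilation :: "real \<Rightarrow> (real \<Rightarrow> complex) \<Rightarrow> real \<Rightarrow> complex" where
  "dilation a f = (\<lambda>x. of_real (sqrt a) * f (a * x))"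

definition translation :: "real \<Rightarrow> (real \<Rightarrow> complex) \<Rightarrow> real \<Rightarrow> complex" where
  "translation b f = (\<lambda>x. f (x - b))"

definition wavelet_system ::
    "real \<Rightarrow> real \<Rightarrow> (real \<Rightarrow> complex) \<Rightarrow> int \<times> int \<Rightarrow> real \<Rightarrow> complex" where
  "wavelet_system a b \<psi> = (\<lambda>(j, k). dilation (a powi j) (translation (of_int k * b) \<psi>))"

definition eps_K :: "real \<Rightarrow> real \<Rightarrow> real \<Rightarrow> real \<Rightarrow> nat \<Rightarrow> real" where
  "eps_K a b C \<sigma> K = sqrt ((real K + 1 / b) / real K powr (3 + 2 * \<sigma>)) * (2 * C) *
     sqrt ((1 + 1 / (2 * \<sigma>)) * (a powr (1 + \<sigma>) / (a powr (1 + \<sigma>) - 1)))"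

text \<open>\<open>\<psi>K\<close> is the band-limited truncation of \<open>\<psi>\<close> to the frequencies in \<open>[-K, K]\<close>.\<close>

definition is_truncation :: "nat \<Rightarrow> (real \<Rightarrow> complex) \<Rightarrow> (real \<Rightarrow> complex) \<Rightarrow> bool" where
  "is_truncation K \<psi> \<psi>K \<longleftrightarrow> \<psi>K \<in> L2 \<and>
     (AE \<gamma> in lborel. fourier_L2 \<psi>K \<gamma> = fourier_L2 \<psi> \<gamma> * indicator {- real K..real K} \<gamma>)"

text \<open>The convention that the quotient is 0 where \<open>fourier_L2 \<psi>K\<close> vanishes is automatic,
  since \<open>0 / y = 0\<close> for every \<open>y\<close>, including \<open>y = 0\<close>.\<close>

definition is_tilde :: "real \<Rightarrow> real \<Rightarrow> int \<Rightarrow> (real \<Rightarrow> complex) \<Rightarrow> (real \<Rightarrow> complex) \<Rightarrow> bool" where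
  "is_tilde a b N \<psi>K \<psi>t \<longleftrightarrow> \<psi>t \<in> L2 \<and>
     (AE \<gamma> in lborel. fourier_L2 \<psi>t \<gamma> =
        of_real b * fourier_L2 \<psi>K \<gamma> /
        of_real (of_int N * (\<Sum>\<^sub>\<infinity>k::int. (cmod (fourier_L2 \<psi>K (a powi k * \<gamma>)))\<^sup>2)))"

end

theory Submission
  imports Defs
begin

text \<open>
  On the Fourier side the coefficients of \<open>f\<close> with respect to a wavelet system of generator \<open>\<phi>\<close>
  and translation step \<open>b\<close> are, at scale \<open>j\<close>, the Fourier coefficients for the period \<open>a\<^sup>j / b\<close> of the
  transform of \<open>f\<close> times the conjugate of the dilated transform of \<open>\<phi>\<close> (\<open>wavelet_inner\<close>). The proof
  splits the transform of \<open>\<psi>\<close> at the frequency \<open>K\<close> and treats the two parts by different means.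

  For a generator whose transform is supported in an interval shorter than \<open>1 / b\<close>, Parseval's
  identity is exact at every scale. The system is then governed by the Calderon sum
  \<open>\<Sum>j. |\<F> \<phi> (a\<^sup>j \<gamma>)|\<^sup>2\<close>: a bound for this sum is, up to the factor \<open>1 / b\<close>, a Bessel bound
  (\<open>bessel_bandlimited\<close>), and dividing by the sum produces an exact dual (\<open>reconstruction\<close>). Since
  \<open>N > 2 b K\<close>, this applies to \<open>\<psi>K\<close> with the step \<open>b / N\<close>, and the exact dual is the given \<open>\<psi>t\<close>. For
  the tail \<open>\<psi> - \<psi>K\<close> the decay of the transform makes both the sum over a lattice of frequencies and the
  sum over the scales converge, and the Bessel bound is a product of two such sums (\<open>bessel_tail\<close>).

  If \<open>V\<close> is a dual of \<open>F\<close> and \<open>F + H\<close> is used for the synthesis instead of \<open>F\<close>, the error has norm at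
  most the square root of the product of the Bessel bounds of \<open>V\<close> and \<open>H\<close> (\<open>approximate_dual_bound\<close>).
  Here the bound of the dual is \<open>b / (N S)\<close>, with \<open>S\<close> a lower bound for the Calderon sum of \<open>\<psi>K\<close>.
  The frame hypothesis enters only through the Calderon sum of \<open>\<psi>\<close>: testing the frame
  inequalities on functions whose transform is the indicator of a small set shows that this sum is at most \<open>b B\<close>
  (\<open>calderon_upper\<close>) and at least \<open>b A\<close> (\<open>calderon_lower\<close>), and removing the tail costs at most
  \<open>\<epsilon>\<^sub>K\<^sup>2 / 2\<close>. The same quantity \<open>\<epsilon>\<^sub>K\<^sup>2 / 2\<close> bounds \<open>b / N\<close> times the Bessel bound of the tail
  (\<open>tail_constants_le\<close>), so the error is at most the square root of
  \<open>(\<epsilon>\<^sub>K\<^sup>2 / 2) / (b A - \<epsilon>\<^sub>K\<^sup>2 / 2)\<close>, which is at most \<open>\<epsilon>\<^sub>K / (sqrt (2 b A) - \<epsilon>\<^sub>K)\<close> (\<open>perturbation_ratio\<close>).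

  The harmonic analysis rests on the completeness of the exponentials on an interval
  (\<open>cut_fmode_total\<close>), which follows from the Stone-Weierstrass theorem. It gives Parseval's identity,
  and averaging Parseval's identity over modulations gives Plancherel's theorem on the line
  (\<open>plancherel_compact\<close>). That every square-integrable function is a transform (\<open>fourier_L2_surj\<close>)
  then follows from the multiplication formula.
\<close>

section \<open>The Hilbert space of square-integrable functions\<close>

lemma L2_measurable [measurable_dest]: "f \<in> L2 \<Longrightarrow> f \<in> borel_measurable borel"
  by (simp add: L2_def)

lemma L2_integrable: "f \<in> L2 \<Longrightarrow> integrable lborel (\<lambda>x. (cmod (f x))\<^sup>2)"
  by (simp add: L2_def)

lemma L2I: "f \<in> borel_measurable borel \<Longrightarrow> integrable lborel (\<lambda>x. (cmod (f x))\<^sup>2) \<Longrightarrow> f \<in> L2"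
  by (simp add: L2_def)

lemma L2_norm_nonneg [simp]: "0 \<le> L2_norm f"
  by (simp add: L2_norm_def)

lemma L2_norm_sq: "(L2_norm f)\<^sup>2 = (LINT x|lborel. (cmod (f x))\<^sup>2)"
  by (simp add: L2_norm_def)

lemma L2_bound:
  assumes "g \<in> L2" and [measurable]: "f \<in> borel_measurable borel"
    and "AE x in lborel. cmod (f x) \<le> M * cmod (g x)"
  shows "f \<in> L2"
proof (rule L2I)
  show "integrable lborel (\<lambda>x. (cmod (f x))\<^sup>2)"
  proof (rule Bochner_Integration.integrable_bound)
    show "integrable lborel (\<lambda>x. M\<^sup>2 * (cmod (g x))\<^sup>2)"
      using L2_integrable[OF assms(1)] by simp
    show "AE x in lborel. norm ((cmod (f x))\<^sup>2) \<le> norm (M\<^sup>2 * (cmod (g x))\<^sup>2)"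
      using assms(3)
    proof (rule AE_mp, intro AE_I2 impI)
      fix x assume "cmod (f x) \<le> M * cmod (g x)"
      then have "(cmod (f x))\<^sup>2 \<le> (M * cmod (g x))\<^sup>2"
        by (intro power_mono) auto
      then show "norm ((cmod (f x))\<^sup>2) \<le> norm (M\<^sup>2 * (cmod (g x))\<^sup>2)"
        by (simp add: power_mult_distrib)
    qed
  qed simp
qed simp

lemma L2_zero [simp]: "(\<lambda>x. 0) \<in> L2"
  by (rule L2I) auto

lemma L2_cmult: "f \<in> L2 \<Longrightarrow> (\<lambda>x. c * f x) \<in> L2"
  by (rule L2_bound[where g = f and M = "cmod c"]) (auto simp: norm_mult)

lemma cnj_measurable [measurable (raw)]:
  "f \<in> borel_measurable M \<Longrightarrow> (\<lambda>x. cnj (f x)) \<in> borel_measurable M"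
  by (rule borel_measurable_continuous_onI[THEN measurable_compose[rotated]])
     (auto intro: continuous_intros)

lemma L2_cnj: "f \<in> L2 \<Longrightarrow> (\<lambda>x. cnj (f x)) \<in> L2"
  by (rule L2_bound[where g = f and M = 1]) (auto simp: cnj_measurable)

lemma L2_add:
  assumes "f \<in> L2" "g \<in> L2"
  shows "(\<lambda>x. f x + g x) \<in> L2"
proof (rule L2I)
  note [measurable] = assms[THEN L2_measurable]
  show "(\<lambda>x. f x + g x) \<in> borel_measurable borel" by measurable
  show "integrable lborel (\<lambda>x. (cmod (f x + g x))\<^sup>2)"
  proof (rule Bochner_Integration.integrable_bound)
    show "integrable lborel (\<lambda>x. 2 * (cmod (f x))\<^sup>2 + 2 * (cmod (g x))\<^sup>2)"
      using assms[THEN L2_integrable] by simp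
    have "(cmod (f x + g x))\<^sup>2 \<le> 2 * (cmod (f x))\<^sup>2 + 2 * (cmod (g x))\<^sup>2" for x
    proof -
      have "(cmod (f x + g x))\<^sup>2 \<le> (cmod (f x) + cmod (g x))\<^sup>2"
        by (intro power_mono norm_triangle_ineq) auto
      also have "\<dots> \<le> 2 * (cmod (f x))\<^sup>2 + 2 * (cmod (g x))\<^sup>2"
        using zero_le_power2[of "cmod (f x) - cmod (g x)"]
        by (simp add: power2_eq_square algebra_simps)
      finally show ?thesis .
    qed
    then show "AE x in lborel. norm ((cmod (f x + g x))\<^sup>2) \<le>
        norm (2 * (cmod (f x))\<^sup>2 + 2 * (cmod (g x))\<^sup>2)"
      by (intro AE_I2) simp
  qed measurable
qed

lemma L2_diff: "f \<in> L2 \<Longrightarrow> g \<in> L2 \<Longrightarrow> (\<lambda>x. f x - g x) \<in> L2"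
  using L2_add[of f "\<lambda>x. - 1 * g x"] L2_cmult[of g "-1"] by simp

lemma L2_sum: "(\<And>i. i \<in> S \<Longrightarrow> F i \<in> L2) \<Longrightarrow> (\<lambda>x. \<Sum>i\<in>S. F i x) \<in> L2"
  by (induction S rule: infinite_finite_induct) (auto intro!: L2_add)

lemma L2_mult_indicator: "f \<in> L2 \<Longrightarrow> S \<in> sets borel \<Longrightarrow> (\<lambda>x. f x * indicator S x) \<in> L2"
  by (rule L2_bound[where g = f and M = 1]) (auto simp: norm_mult indicator_def)

lemma L2_mult_bounded:
  assumes "f \<in> L2" and [measurable]: "m \<in> borel_measurable borel"
    and "AE x in lborel. cmod (m x) \<le> M"
  shows "(\<lambda>x. f x * m x) \<in> L2"
proof (rule L2_bound[OF assms(1), where M = M])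
  show "(\<lambda>x. f x * m x) \<in> borel_measurable borel"
    using assms(1) by measurable
  show "AE x in lborel. cmod (f x * m x) \<le> M * cmod (f x)"
    using assms(3)
    by (rule AE_mp) (intro AE_I2 impI, simp add: norm_mult mult.commute[of M] mult_left_mono)
qed

lemma integrable_cmod_mult:
  assumes "f \<in> L2" "g \<in> L2"
  shows "integrable lborel (\<lambda>x. cmod (f x) * cmod (g x))"
proof (rule Bochner_Integration.integrable_bound)
  note [measurable] = assms[THEN L2_measurable]
  show "integrable lborel (\<lambda>x. (cmod (f x))\<^sup>2 + (cmod (g x))\<^sup>2)"
    using assms[THEN L2_integrable] by simp
  show "(\<lambda>x. cmod (f x) * cmod (g x)) \<in> borel_measurable lborel" by measurable
  have "cmod (f x) * cmod (g x) \<le> (cmod (f x))\<^sup>2 + (cmod (g x))\<^sup>2" for x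
    using zero_le_power2[of "cmod (f x) - cmod (g x)"]
      zero_le_power2[of "cmod (f x)"] zero_le_power2[of "cmod (g x)"]
    unfolding power2_diff by linarith
  then show "AE x in lborel. norm (cmod (f x) * cmod (g x)) \<le> norm ((cmod (f x))\<^sup>2 + (cmod (g x))\<^sup>2)"
    by (intro AE_I2) simp
qed

lemma integrable_mult_L2:
  assumes "f \<in> L2" "g \<in> L2"
  shows "integrable lborel (\<lambda>x. f x * g x)"
  using assms[THEN L2_measurable]
  by (intro Bochner_Integration.integrable_bound[OF integrable_cmod_mult[OF assms]])
     (auto simp: norm_mult)

lemma integrable_mult_cnj_L2:
  "f \<in> L2 \<Longrightarrow> g \<in> L2 \<Longrightarrow> integrable lborel (\<lambda>x. f x * cnj (g x))"
  using integrable_mult_L2[OF _ L2_cnj] .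

lemma L2_norm_eq_0_AE:
  assumes "f \<in> L2" "L2_norm f = 0"
  shows "AE x in lborel. f x = 0"
proof -
  have "(LINT x|lborel. (cmod (f x))\<^sup>2) = 0"
    using assms(2) L2_norm_sq[of f] by simp
  then have "AE x in lborel. (cmod (f x))\<^sup>2 = 0"
    using integral_nonneg_eq_0_iff_AE[OF L2_integrable[OF assms(1)]] by simp
  then show ?thesis by simp
qed

lemma L2_norm_cong_AE:
  assumes "f \<in> L2" "g \<in> L2" "AE x in lborel. f x = g x"
  shows "L2_norm f = L2_norm g"
  unfolding L2_norm_def using assms
  by (intro arg_cong[where f = sqrt] integral_cong_AE) auto

text \<open>
  Integrate \<open>x y \<le> t x\<^sup>2 / 2 + y\<^sup>2 / (2 t)\<close> with \<open>t\<close> the quotient of the two norms.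
\<close>

lemma integral_cmod_mult_le:
  assumes "f \<in> L2" "g \<in> L2"
  shows "(LINT x|lborel. cmod (f x) * cmod (g x)) \<le> L2_norm f * L2_norm g"
proof (cases "L2_norm f = 0 \<or> L2_norm g = 0")
  case True
  then have "AE x in lborel. cmod (f x) * cmod (g x) = 0"
    using L2_norm_eq_0_AE[OF assms(1)] L2_norm_eq_0_AE[OF assms(2)] by auto
  then have "(LINT x|lborel. cmod (f x) * cmod (g x)) = 0"
    by (simp add: integral_eq_zero_AE)
  then show ?thesis using True by auto
next
  case False
  define t where "t = L2_norm g / L2_norm f"
  have pos: "L2_norm f > 0" "L2_norm g > 0"
    using False L2_norm_nonneg less_eq_real_def by auto
  then have t: "t > 0" by (simp add: t_def)
  have "(LINT x|lborel. cmod (f x) * cmod (g x))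
      \<le> (LINT x|lborel. t / 2 * (cmod (f x))\<^sup>2 + 1 / (2 * t) * (cmod (g x))\<^sup>2)"
  proof (rule integral_mono)
    show "integrable lborel (\<lambda>x. cmod (f x) * cmod (g x))"
      by (rule integrable_cmod_mult[OF assms])
    show "integrable lborel (\<lambda>x. t / 2 * (cmod (f x))\<^sup>2 + 1 / (2 * t) * (cmod (g x))\<^sup>2)"
      using assms[THEN L2_integrable] by simp
    show "cmod (f x) * cmod (g x) \<le> t / 2 * (cmod (f x))\<^sup>2 + 1 / (2 * t) * (cmod (g x))\<^sup>2" for x
    proof -
      have "0 \<le> (t * cmod (f x) - cmod (g x))\<^sup>2 / (2 * t)" using t by simp
      also have "\<dots> = t / 2 * (cmod (f x))\<^sup>2 + 1 / (2 * t) * (cmod (g x))\<^sup>2 - cmod (f x) * cmod (g x)"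
        using t by (simp add: power2_eq_square field_simps)
      finally show ?thesis by simp
    qed
  qed
  also have "\<dots> = t / 2 * (L2_norm f)\<^sup>2 + 1 / (2 * t) * (L2_norm g)\<^sup>2"
    using assms[THEN L2_integrable] by (simp add: L2_norm_sq)
  also have "\<dots> = L2_norm f * L2_norm g"
    using pos by (simp add: t_def power2_eq_square field_simps)
  finally show ?thesis .
qed

lemma L2_Cauchy_Schwarz:
  assumes "f \<in> L2" "g \<in> L2"
  shows "cmod (L2_inner f g) \<le> L2_norm f * L2_norm g"
proof -
  have "cmod (L2_inner f g) \<le> (LINT x|lborel. cmod (f x * cnj (g x)))"
    unfolding L2_inner_def by (rule integral_norm_bound)
  also have "\<dots> \<le> L2_norm f * L2_norm g"
    using integral_cmod_mult_le[OF assms] by (simp add: norm_mult)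
  finally show ?thesis .
qed

lemma L2_norm_triangle:
  assumes "f \<in> L2" "g \<in> L2"
  shows "L2_norm (\<lambda>x. f x + g x) \<le> L2_norm f + L2_norm g"
proof (rule power2_le_imp_le)
  note int = assms[THEN L2_integrable] integrable_cmod_mult[OF assms]
  have "(L2_norm (\<lambda>x. f x + g x))\<^sup>2 = (LINT x|lborel. (cmod (f x + g x))\<^sup>2)"
    by (rule L2_norm_sq)
  also have "\<dots> \<le> (LINT x|lborel. (cmod (f x))\<^sup>2 + 2 * (cmod (f x) * cmod (g x)) + (cmod (g x))\<^sup>2)"
  proof (rule integral_mono)
    show "integrable lborel (\<lambda>x. (cmod (f x + g x))\<^sup>2)"
      by (rule L2_integrable[OF L2_add[OF assms]])
    show "integrable lborel (\<lambda>x. (cmod (f x))\<^sup>2 + 2 * (cmod (f x) * cmod (g x)) + (cmod (g x))\<^sup>2)"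
      using int by simp
    show "(cmod (f x + g x))\<^sup>2 \<le> (cmod (f x))\<^sup>2 + 2 * (cmod (f x) * cmod (g x)) + (cmod (g x))\<^sup>2" for x
    proof -
      have "(cmod (f x + g x))\<^sup>2 \<le> (cmod (f x) + cmod (g x))\<^sup>2"
        by (intro power_mono norm_triangle_ineq) auto
      then show ?thesis by (simp add: power2_sum)
    qed
  qed
  also have "\<dots> = (L2_norm f)\<^sup>2 + 2 * (LINT x|lborel. cmod (f x) * cmod (g x)) + (L2_norm g)\<^sup>2"
    using int by (simp add: L2_norm_sq)
  also have "\<dots> \<le> (L2_norm f + L2_norm g)\<^sup>2"
    using integral_cmod_mult_le[OF assms] by (simp add: power2_sum)
  finally show "(L2_norm (\<lambda>x. f x + g x))\<^sup>2 \<le> (L2_norm f + L2_norm g)\<^sup>2" .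
qed simp

lemma L2_norm_cmult: "L2_norm (\<lambda>x. c * f x) = cmod c * L2_norm f"
  by (simp add: L2_norm_def norm_mult power_mult_distrib real_sqrt_mult)

lemma L2_norm_minus_commute: "L2_norm (\<lambda>x. f x - g x) = L2_norm (\<lambda>x. g x - f x)"
  by (simp add: L2_norm_def norm_minus_commute)

lemma L2_norm_triangle_sub:
  assumes "f \<in> L2" "g \<in> L2" "h \<in> L2"
  shows "L2_norm (\<lambda>x. f x - h x) \<le> L2_norm (\<lambda>x. f x - g x) + L2_norm (\<lambda>x. g x - h x)"
  using L2_norm_triangle[OF L2_diff[OF assms(1,2)] L2_diff[OF assms(2,3)]] by simp

lemma L2_inner_self: "L2_inner f f = of_real ((L2_norm f)\<^sup>2)"
proof -
  have "(\<lambda>x. f x * cnj (f x)) = (\<lambda>x. of_real ((cmod (f x))\<^sup>2))"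
    by (simp add: complex_norm_square [symmetric] del: of_real_power)
  then show ?thesis
    unfolding L2_inner_def L2_norm_sq by (simp del: of_real_power)
qed

lemma L2_inner_commute: "L2_inner g f = cnj (L2_inner f g)"
proof -
  have "L2_inner g f = (LINT x|lborel. cnj (f x * cnj (g x)))"
    by (simp add: L2_inner_def mult.commute)
  also have "\<dots> = cnj (L2_inner f g)"
    unfolding L2_inner_def by (rule Bochner_Integration.integral_cnj)
  finally show ?thesis .
qed

lemma L2_inner_add_right:
  "f \<in> L2 \<Longrightarrow> g \<in> L2 \<Longrightarrow> h \<in> L2 \<Longrightarrow> L2_inner h (\<lambda>x. f x + g x) = L2_inner h f + L2_inner h g"
  unfolding L2_inner_def by (simp add: distrib_left integrable_mult_cnj_L2)

lemma L2_inner_diff_left: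
  "f \<in> L2 \<Longrightarrow> g \<in> L2 \<Longrightarrow> h \<in> L2 \<Longrightarrow> L2_inner (\<lambda>x. f x - g x) h = L2_inner f h - L2_inner g h"
  unfolding L2_inner_def
  by (simp add: left_diff_distrib integrable_mult_cnj_L2)

lemma L2_inner_diff_right:
  "f \<in> L2 \<Longrightarrow> g \<in> L2 \<Longrightarrow> h \<in> L2 \<Longrightarrow> L2_inner h (\<lambda>x. f x - g x) = L2_inner h f - L2_inner h g"
  unfolding L2_inner_def
  by (simp add: right_diff_distrib integrable_mult_cnj_L2)

lemma L2_inner_cmult_left: "L2_inner (\<lambda>x. c * f x) h = c * L2_inner f h"
  unfolding L2_inner_def by (simp add: mult.assoc)

lemma L2_inner_sum_left:
  "(\<And>i. i \<in> S \<Longrightarrow> F i \<in> L2) \<Longrightarrow> h \<in> L2 \<Longrightarrow>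
     L2_inner (\<lambda>x. \<Sum>i\<in>S. F i x) h = (\<Sum>i\<in>S. L2_inner (F i) h)"
  unfolding L2_inner_def
  by (simp add: sum_distrib_right integrable_mult_cnj_L2)

lemma L2_norm_diff_sq:
  assumes "f \<in> L2" "g \<in> L2"
  shows "(L2_norm (\<lambda>x. f x - g x))\<^sup>2 = (L2_norm f)\<^sup>2 - 2 * Re (L2_inner f g) + (L2_norm g)\<^sup>2"
proof -
  have "of_real ((L2_norm (\<lambda>x. f x - g x))\<^sup>2) = L2_inner (\<lambda>x. f x - g x) (\<lambda>x. f x - g x)"
    by (rule L2_inner_self[symmetric])
  also have "\<dots> = L2_inner f f - L2_inner f g - (cnj (L2_inner f g) - L2_inner g g)"
    using assms by (simp add: L2_inner_diff_left L2_inner_diff_right L2_diff L2_inner_commute[of g f])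
  finally have "Re (of_real ((L2_norm (\<lambda>x. f x - g x))\<^sup>2))
      = Re (of_real ((L2_norm f)\<^sup>2) - L2_inner f g - (cnj (L2_inner f g) - of_real ((L2_norm g)\<^sup>2)))"
    by (simp only: L2_inner_self)
  then show ?thesis by (simp del: of_real_power)
qed

lemma nn_integral_cmod_sq: 
  "f \<in> L2 \<Longrightarrow> (\<integral>\<^sup>+x. ennreal ((cmod (f x))\<^sup>2) \<partial>lborel) = ennreal ((L2_norm f)\<^sup>2)"
  unfolding L2_norm_sq by (rule nn_integral_eq_integral[OF L2_integrable]) auto

lemma L2_from_nn_integral:
  assumes [measurable]: "f \<in> borel_measurable borel"
    and le: "(\<integral>\<^sup>+x. ennreal ((cmod (f x))\<^sup>2) \<partial>lborel) \<le> ennreal (r\<^sup>2)" and r: "0 \<le> r"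
  shows "f \<in> L2" "L2_norm f \<le> r"
proof -
  show f: "f \<in> L2"
  proof (intro L2I integrableI_bounded)
    have "(\<integral>\<^sup>+x. ennreal (norm ((cmod (f x))\<^sup>2)) \<partial>lborel) \<le> ennreal (r\<^sup>2)"
      using le by simp
    also have "\<dots> < \<infinity>" by simp
    finally show "(\<integral>\<^sup>+x. ennreal (norm ((cmod (f x))\<^sup>2)) \<partial>lborel) < \<infinity>" .
  qed measurable
  have "(L2_norm f)\<^sup>2 \<le> r\<^sup>2"
    using le unfolding nn_integral_cmod_sq[OF f] by (subst (asm) ennreal_le_iff) auto
  then show "L2_norm f \<le> r"
    using r by (rule power2_le_imp_le)
qed

text \<open>
  Fatou's lemma for the squared absolute values. It serves both the completeness of the space
  and the passage from truncations to general functions in Plancherel's theorem.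
\<close>

lemma L2_Fatou:
  assumes f: "\<And>m. f m \<in> L2" and [measurable]: "g \<in> borel_measurable borel"
    and lim: "AE x in lborel. (\<lambda>m. f m x) \<longlonglongrightarrow> g x"
    and le: "eventually (\<lambda>m. L2_norm (f m) \<le> r) sequentially" and r: "0 \<le> r"
  shows "g \<in> L2" "L2_norm g \<le> r"
proof -
  note [measurable] = f[THEN L2_measurable]
  have "(\<integral>\<^sup>+x. ennreal ((cmod (g x))\<^sup>2) \<partial>lborel)
      = (\<integral>\<^sup>+x. liminf (\<lambda>m. ennreal ((cmod (f m x))\<^sup>2)) \<partial>lborel)"
  proof (rule nn_integral_cong_AE, rule AE_mp[OF lim], intro AE_I2 impI)
    fix x assume "(\<lambda>m. f m x) \<longlonglongrightarrow> g x"
    then have "(\<lambda>m. ennreal ((cmod (f m x))\<^sup>2)) \<longlonglongrightarrow> ennreal ((cmod (g x))\<^sup>2)"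
      by (intro tendsto_ennrealI tendsto_power tendsto_norm)
    then show "ennreal ((cmod (g x))\<^sup>2) = liminf (\<lambda>m. ennreal ((cmod (f m x))\<^sup>2))"
      by (rule lim_imp_Liminf[OF sequentially_bot, symmetric])
  qed
  also have "\<dots> \<le> liminf (\<lambda>m. \<integral>\<^sup>+x. ennreal ((cmod (f m x))\<^sup>2) \<partial>lborel)"
    by (rule nn_integral_liminf) measurable
  also have "\<dots> \<le> limsup (\<lambda>m. \<integral>\<^sup>+x. ennreal ((cmod (f m x))\<^sup>2) \<partial>lborel)"
    by (rule Liminf_le_Limsup) simp
  also have "\<dots> \<le> ennreal (r\<^sup>2)"
  proof (rule Limsup_bounded, rule eventually_mono[OF le])
    fix m assume "L2_norm (f m) \<le> r"
    then show "(\<integral>\<^sup>+x. ennreal ((cmod (f m x))\<^sup>2) \<partial>lborel) \<le> ennreal (r\<^sup>2)"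
      unfolding nn_integral_cmod_sq[OF f] by (intro ennreal_leI power_mono) auto
  qed
  finally have "(\<integral>\<^sup>+x. ennreal ((cmod (g x))\<^sup>2) \<partial>lborel) \<le> ennreal (r\<^sup>2)" .
  from L2_from_nn_integral[OF assms(2) this r] show "g \<in> L2" "L2_norm g \<le> r" .
qed

text \<open>
  The Riesz-Fischer theorem. A subsequence with increments \<open>d k\<close> of norm at most \<open>4\<^sup>-\<^sup>k\<close> has
  \<open>\<Sum>k. 4\<^sup>k |d k|\<^sup>2\<close> integrable, so that almost everywhere \<open>|d k|\<close> is at most a constant times \<open>2\<^sup>-\<^sup>k\<close>
  and the subsequence converges; Fatou's lemma turns the pointwise limit into a limit in norm.
\<close>

lemma L2_complete:
  fixes f :: "nat \<Rightarrow> real \<Rightarrow> complex"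
  assumes f: "\<And>n. f n \<in> L2"
    and Cauchy: "\<And>e. e > 0 \<Longrightarrow> \<exists>N. \<forall>m\<ge>N. \<forall>n\<ge>N. L2_norm (\<lambda>x. f m x - f n x) < e"
  obtains g where "g \<in> L2" "(\<lambda>n. L2_norm (\<lambda>x. f n x - g x)) \<longlonglongrightarrow> 0"
proof -
  note [measurable] = f[THEN L2_measurable]
  obtain N where N: "\<And>k m n. m \<ge> N k \<Longrightarrow> n \<ge> N k \<Longrightarrow> L2_norm (\<lambda>x. f m x - f n x) < (1/4)^k"
  proof -
    have "\<forall>k. \<exists>N. \<forall>m\<ge>N. \<forall>n\<ge>N. L2_norm (\<lambda>x. f m x - f n x) < (1/4)^k"
      using Cauchy by simp
    then show ?thesis using that by metis
  qed
  \<comment> \<open>the summand k makes r unbounded, which the limit in norm uses\<close>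
  define r where "r k = k + Max (N ` {..k})" for k
  have r: "r k \<ge> N k" "r (Suc k) \<ge> N k" "r k \<ge> k" for k
  proof -
    have "N k \<le> Max (N ` {..k})" "N k \<le> Max (N ` {..Suc k})" by (intro Max_ge; simp)+
    then show "r k \<ge> N k" "r (Suc k) \<ge> N k" "r k \<ge> k" unfolding r_def by linarith+
  qed
  define d where "d k x = f (r (Suc k)) x - f (r k) x" for k x
  have dL2: "d k \<in> L2" for k unfolding d_def by (intro L2_diff f)
  note [measurable] = dL2[THEN L2_measurable]
  have dn: "L2_norm (d k) \<le> (1/4)^k" for k
    unfolding d_def using N[of k, OF r(2) r(1)] by simp
  have "(\<integral>\<^sup>+x. (\<Sum>k. ennreal (4^k * (cmod (d k x))\<^sup>2)) \<partial>lborel)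
      = (\<Sum>k. \<integral>\<^sup>+x. ennreal (4^k) * ennreal ((cmod (d k x))\<^sup>2) \<partial>lborel)"
    by (subst nn_integral_suminf) (auto simp: ennreal_mult)
  also have "\<dots> = (\<Sum>k. ennreal (4^k) * ennreal ((L2_norm (d k))\<^sup>2))"
    by (simp add: nn_integral_cmult nn_integral_cmod_sq[OF dL2])
  also have "\<dots> \<le> (\<Sum>k. ennreal ((1/4)^k))"
  proof (intro suminf_le)
    fix k
    have "4^k * (L2_norm (d k))\<^sup>2 \<le> 4^k * ((1/4)^k)\<^sup>2"
      by (intro mult_left_mono power_mono dn) auto
    also have "\<dots> = (1/4::real)^k"
      by (simp add: power2_eq_square power_divide field_simps)
    finally show "ennreal (4^k) * ennreal ((L2_norm (d k))\<^sup>2) \<le> ennreal ((1/4)^k)"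
      by (simp add: ennreal_mult[symmetric] ennreal_leI)
  qed auto
  also have "\<dots> = ennreal (\<Sum>k. (1/4)^k)"
    by (rule suminf_ennreal2) (auto intro: summable_geometric)
  finally have "(\<integral>\<^sup>+x. (\<Sum>k. ennreal (4^k * (cmod (d k x))\<^sup>2)) \<partial>lborel) \<noteq> \<infinity>"
    by (auto simp: top_unique)
  then have AEfin: "AE x in lborel. (\<Sum>k. ennreal (4^k * (cmod (d k x))\<^sup>2)) \<noteq> \<infinity>"
    by (rule nn_integral_noteq_infinite[rotated]) measurable
  have conv: "AE x in lborel. convergent (\<lambda>k. f (r k) x)"
    using AEfin
  proof (rule AE_mp, intro AE_I2 impI)
    fix x assume fin: "(\<Sum>k. ennreal (4^k * (cmod (d k x))\<^sup>2)) \<noteq> \<infinity>"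
    have sm: "summable (\<lambda>k. 4^k * (cmod (d k x))\<^sup>2)"
      by (rule summable_suminf_not_top) (use fin in simp_all)
    define M where "M = (\<Sum>k. 4^k * (cmod (d k x))\<^sup>2)"
    have M: "4^k * (cmod (d k x))\<^sup>2 \<le> M" for k
      unfolding M_def using sum_le_suminf[OF sm, of "{k}"] by simp
    have bd: "cmod (d k x) \<le> sqrt M * (1/2)^k" for k
    proof -
      have "(2^k * cmod (d k x))\<^sup>2 = 4^k * (cmod (d k x))\<^sup>2"
        by (simp add: power_mult_distrib power2_eq_square) (simp add: power_mult_distrib [symmetric])
      then have "2^k * cmod (d k x) \<le> sqrt M" using M[of k] real_le_rsqrt by presburger
      then show ?thesis by (simp add: field_simps power_divide)
    qed
    have "summable (\<lambda>k. sqrt M * (1/2)^k)"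
      by (intro summable_mult summable_geometric) auto
    then have "summable (\<lambda>k. d k x)"
      by (rule summable_comparison_test'[where N = 0]) (rule bd)
    then have "convergent (\<lambda>n. \<Sum>k<n. d k x)"
      by (simp add: summable_iff_convergent)
    moreover have "(\<Sum>k<n. d k x) = f (r n) x - f (r 0) x" for n
      unfolding d_def by (rule sum_lessThan_telescope)
    ultimately have "convergent (\<lambda>n. f (r n) x - f (r 0) x)" by simp
    then show "convergent (\<lambda>k. f (r k) x)"
      by (simp add: convergent_diff_const_right_iff)
  qed
  define g where "g x = lim (\<lambda>k. f (r k) x)" for x
  have [measurable]: "g \<in> borel_measurable borel"
    unfolding g_def by measurable
  have lim: "AE x in lborel. (\<lambda>k. f (r k) x) \<longlonglongrightarrow> g x"
    using conv unfolding g_def by (simp add: convergent_LIMSEQ_iff)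
  have diff: "(\<lambda>x. f n x - g x) \<in> L2" "L2_norm (\<lambda>x. f n x - g x) \<le> (1/4)^k" if n: "n \<ge> N k" for n k
  proof -
    have 1: "(\<lambda>x. f n x - f (r m) x) \<in> L2" for m by (intro L2_diff f)
    have 2: "AE x in lborel. (\<lambda>m. f n x - f (r m) x) \<longlonglongrightarrow> f n x - g x"
      using lim by eventually_elim (intro tendsto_diff tendsto_const)
    have 3: "eventually (\<lambda>m. L2_norm (\<lambda>x. f n x - f (r m) x) \<le> (1/4)^k) sequentially"
      using eventually_ge_at_top[of "N k"]
    proof eventually_elim
      case (elim m)
      then show ?case using N[OF n, of "r m"] r(3)[of m] by simp
    qed
    show "(\<lambda>x. f n x - g x) \<in> L2" "L2_norm (\<lambda>x. f n x - g x) \<le> (1/4)^k"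
      using L2_Fatou[OF 1 _ 2 3] by simp_all
  qed
  have gL2: "g \<in> L2"
    using L2_diff[OF f diff(1)[of 0 "N 0"], of "N 0"] by simp
  have "(\<lambda>n. L2_norm (\<lambda>x. f n x - g x)) \<longlonglongrightarrow> 0"
  proof (rule LIMSEQ_I)
    fix e :: real assume "e > 0"
    obtain k where k: "(1/4)^k < e" using real_arch_pow_inv[OF \<open>e > 0\<close>, of "1/4"] by auto
    show "\<exists>no. \<forall>n\<ge>no. norm (L2_norm (\<lambda>x. f n x - g x) - 0) < e"
      using diff(2)[of k] k by (intro exI[of _ "N k"]) force
  qed
  with gL2 show ?thesis by (rule that)
qed

section \<open>Bessel sequences and their synthesis operators\<close>

text \<open>
  A Bessel bound tested on finite index sets only, so that no summability has to be carried
  along; summability of the coefficients is a consequence.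
\<close>

definition bessel_bound :: "('i \<Rightarrow> real \<Rightarrow> complex) \<Rightarrow> real \<Rightarrow> bool" where
  "bessel_bound F B \<longleftrightarrow> 0 \<le> B \<and> (\<forall>i. F i \<in> L2) \<and>
     (\<forall>f\<in>L2. \<forall>S. finite S \<longrightarrow> (\<Sum>i\<in>S. (cmod (L2_inner f (F i)))\<^sup>2) \<le> B * (L2_norm f)\<^sup>2)"

lemma bessel_boundD:
  assumes "bessel_bound F B"
  shows "0 \<le> B" "F i \<in> L2"
    "f \<in> L2 \<Longrightarrow> finite S \<Longrightarrow> (\<Sum>i\<in>S. (cmod (L2_inner f (F i)))\<^sup>2) \<le> B * (L2_norm f)\<^sup>2"
  using assms by (auto simp: bessel_bound_def)

lemma bessel_summable:
  assumes "bessel_bound F B" "f \<in> L2"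
  shows "(\<lambda>i. (cmod (L2_inner f (F i)))\<^sup>2) summable_on UNIV"
  using bessel_boundD(3)[OF assms]
  by (intro nonneg_bdd_above_summable_on bdd_aboveI[of _ "B * (L2_norm f)\<^sup>2"]) auto

lemma bessel_infsum_le:
  assumes "bessel_bound F B" "f \<in> L2"
  shows "(\<Sum>\<^sub>\<infinity>i. (cmod (L2_inner f (F i)))\<^sup>2) \<le> B * (L2_norm f)\<^sup>2"
  using bessel_boundD(3)[OF assms]
  by (intro infsum_le_finite_sums[OF bessel_summable[OF assms]]) auto

lemma analysis_ell2:
  "bessel_bound F B \<Longrightarrow> f \<in> L2 \<Longrightarrow> (\<lambda>i. L2_inner f (F i)) \<in> ell2"
  using bessel_summable by (auto simp: ell2_def)

text \<open>
  The usual duality: pair \<open>u = \<Sum>i\<in>S. c i F i\<close> with itself, apply the Cauchy-Schwarz inequality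
  in the coefficients, bound the coefficients of \<open>u\<close> by the Bessel bound, and cancel one norm of \<open>u\<close>.
\<close>

lemma bessel_finite_synthesis:
  assumes F: "bessel_bound F B" and S: "finite S"
  shows "(L2_norm (\<lambda>x. \<Sum>i\<in>S. c i * F i x))\<^sup>2 \<le> B * (\<Sum>i\<in>S. (cmod (c i))\<^sup>2)"
proof -
  define u where "u = (\<lambda>x. \<Sum>i\<in>S. c i * F i x)"
  note FL2 = bessel_boundD(2)[OF F]
  have u: "u \<in> L2" unfolding u_def by (intro L2_sum L2_cmult FL2)
  have "(L2_norm u)\<^sup>2 = cmod (L2_inner u u)"
    by (simp add: L2_inner_self del: of_real_power)
  also have "L2_inner u u = (\<Sum>i\<in>S. c i * cnj (L2_inner u (F i)))"
    by (subst u_def) (simp add: L2_inner_sum_left L2_cmult FL2 u L2_inner_cmult_left L2_inner_commute[of "F _" u])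
  also have "cmod \<dots> \<le> (\<Sum>i\<in>S. cmod (c i * cnj (L2_inner u (F i))))"
    by (rule norm_sum)
  also have "\<dots> = (\<Sum>i\<in>S. \<bar>cmod (c i)\<bar> * \<bar>cmod (L2_inner u (F i))\<bar>)"
    by (simp add: norm_mult)
  also have "\<dots> \<le> L2_set (\<lambda>i. cmod (c i)) S * L2_set (\<lambda>i. cmod (L2_inner u (F i))) S"
    by (rule L2_set_mult_ineq)
  also have "\<dots> \<le> L2_set (\<lambda>i. cmod (c i)) S * sqrt (B * (L2_norm u)\<^sup>2)"
    unfolding L2_set_def using bessel_boundD(3)[OF F u S]
    by (intro mult_left_mono real_sqrt_le_mono) (auto intro: sum_nonneg)
  finally have le: "(L2_norm u)\<^sup>2 \<le> L2_set (\<lambda>i. cmod (c i)) S * sqrt B * L2_norm u"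
    by (simp add: real_sqrt_mult)
  have "L2_norm u \<le> L2_set (\<lambda>i. cmod (c i)) S * sqrt B"
  proof (cases "L2_norm u = 0")
    case True
    then show ?thesis using bessel_boundD(1)[OF F] by (simp add: L2_set_nonneg)
  next
    case False
    then have "L2_norm u > 0" using L2_norm_nonneg[of u] by linarith
    with le show ?thesis by (simp add: power2_eq_square)
  qed
  then have "(L2_norm u)\<^sup>2 \<le> (L2_set (\<lambda>i. cmod (c i)) S * sqrt B)\<^sup>2"
    by (intro power_mono) auto
  also have "\<dots> = B * (\<Sum>i\<in>S. (cmod (c i))\<^sup>2)"
    using bessel_boundD(1)[OF F]
    by (simp add: power_mult_distrib L2_set_def sum_nonneg)
  finally show ?thesis unfolding u_def .
qed

text \<open>
  By the previous lemma the squared distance of the partial sums over \<open>S\<close> and over a larger set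
  \<open>T\<close> is at most \<open>B\<close> times the mass of \<open>|c|\<^sup>2\<close> on \<open>T - S\<close>. Along finite sets \<open>Q n\<close> that leave out mass at most
  \<open>1 / (n + 1)\<close> the partial sums are a Cauchy sequence, and its limit is the limit along all
  finite sets.
\<close>

lemma synthesis_exists:
  assumes F: "bessel_bound F B" and c: "c \<in> ell2"
  shows "\<exists>s. L2_tendsto (\<lambda>S x. \<Sum>k\<in>S. c k * F k x) s (finite_subsets_at_top UNIV)"
proof -
  define a where "a k = (cmod (c k))\<^sup>2" for k
  have a: "a summable_on UNIV" "\<And>k. a k \<ge> 0" using c by (auto simp: ell2_def a_def[abs_def])
  define P where "P = (\<lambda>S x. \<Sum>k\<in>S. c k * F k x)"
  have P: "P S \<in> L2" for S
    unfolding P_def by (intro L2_sum L2_cmult bessel_boundD(2)[OF F])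
  have B: "B \<ge> 0" by (rule bessel_boundD(1)[OF F])
  have "\<exists>S. finite S \<and> (infsum a UNIV - sum a S \<le> 1 / Suc n)" for n :: nat
  proof -
    obtain S where "finite S" "dist (sum a S) (infsum a UNIV) \<le> 1 / Suc n"
      using infsum_finite_approximation[OF a(1), of "1 / Suc n"] by auto
    then show ?thesis by (auto simp: dist_real_def abs_le_iff intro!: exI[of _ S])
  qed
  then obtain R where R: "\<And>n. finite (R n)" "\<And>n. infsum a UNIV - sum a (R n) \<le> 1 / Suc n"
    by metis
  have close: "L2_norm (\<lambda>x. P T x - P S x) \<le> sqrt (B * (1 / Suc n))"
    if "R n \<subseteq> S" "S \<subseteq> T" "finite T" for S T n
  proof -
    have fin: "finite S" using that finite_subset by blast
    have "sum a (R n) \<le> sum a S"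
      using that fin a(2) by (intro sum_mono2) auto
    moreover have "sum a T \<le> infsum a UNIV"
      using that a by (intro finite_sum_le_infsum) auto
    ultimately have *: "sum a (T - S) \<le> 1 / Suc n"
      using R(2)[of n] that fin by (simp add: sum_diff)
    have "(\<lambda>x. P T x - P S x) = (\<lambda>x. \<Sum>k\<in>T - S. c k * F k x)"
      using that fin by (simp add: P_def sum_diff)
    then have "(L2_norm (\<lambda>x. P T x - P S x))\<^sup>2 \<le> B * sum a (T - S)"
      using bessel_finite_synthesis[OF F, of "T - S" c] that by (simp add: a_def)
    also have "\<dots> \<le> B * (1 / Suc n)"
      using * B by (intro mult_left_mono)
    finally show ?thesis by (rule real_le_rsqrt)
  qed
  define Q where "Q n = (\<Union>m\<le>n. R m)" for n
  have Q: "finite (Q n)" "R n \<subseteq> Q n" for n using R by (auto simp: Q_def)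
  have Qm: "Q m \<subseteq> Q n" if "m \<le> n" for m n using that by (fastforce simp: Q_def)
  have lim0: "(\<lambda>n. sqrt (B * (1 / Suc n))) \<longlonglongrightarrow> 0"
  proof -
    have "(\<lambda>n. B * (1 / Suc n)) \<longlonglongrightarrow> B * 0"
      by (intro tendsto_mult tendsto_const LIMSEQ_inverse_real_of_nat[unfolded inverse_eq_divide])
    then show ?thesis using tendsto_real_sqrt by fastforce
  qed
  have "\<exists>N. \<forall>m\<ge>N. \<forall>n\<ge>N. L2_norm (\<lambda>x. P (Q m) x - P (Q n) x) < e" if e: "e > 0" for e
  proof -
    from LIMSEQ_D[OF lim0, of "e / 2"] e
    obtain N where N: "sqrt (B * (1 / Suc N)) < e / 2" using B by auto
    have "L2_norm (\<lambda>x. P (Q m) x - P (Q n) x) < e" if "m \<ge> N" "n \<ge> N" for m n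
    proof -
      have "L2_norm (\<lambda>x. P (Q m) x - P (Q n) x)
          \<le> L2_norm (\<lambda>x. P (Q m) x - P (Q N) x) + L2_norm (\<lambda>x. P (Q N) x - P (Q n) x)"
        by (intro L2_norm_triangle_sub P)
      also have "\<dots> \<le> sqrt (B * (1 / Suc N)) + sqrt (B * (1 / Suc N))"
        using close[OF Q(2) Qm[OF that(1)] Q(1)] close[OF Q(2) Qm[OF that(2)] Q(1)]
        by (intro add_mono) (simp_all add: L2_norm_minus_commute[of "P (Q N)"])
      also have "\<dots> < e" using N by simp
      finally show ?thesis .
    qed
    then show ?thesis by blast
  qed
  then obtain s where s: "s \<in> L2" "(\<lambda>n. L2_norm (\<lambda>x. P (Q n) x - s x)) \<longlonglongrightarrow> 0"
    using L2_complete[of "\<lambda>n. P (Q n)"] P by blast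
  have "((\<lambda>S. L2_norm (\<lambda>x. P S x - s x)) \<longlongrightarrow> 0) (finite_subsets_at_top UNIV)"
  proof (rule tendstoI)
    fix e :: real assume e: "e > 0"
    have "(\<lambda>n. sqrt (B * (1 / Suc n)) + L2_norm (\<lambda>x. P (Q n) x - s x)) \<longlonglongrightarrow> 0 + 0"
      by (intro tendsto_add lim0 s)
    then have "eventually (\<lambda>n. sqrt (B * (1 / Suc n)) + L2_norm (\<lambda>x. P (Q n) x - s x) < e) sequentially"
      using e by (simp add: order_tendstoD(2))
    then obtain n where n: "sqrt (B * (1 / Suc n)) + L2_norm (\<lambda>x. P (Q n) x - s x) < e"
      by (auto simp: eventually_sequentially)
    have "L2_norm (\<lambda>x. P T x - s x) < e" if "finite T" "Q n \<subseteq> T" for T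
      using L2_norm_triangle_sub[OF P[of T] P[of "Q n"] s(1)] close[OF Q(2) that(2,1)] n by linarith
    then show "\<forall>\<^sub>F S in finite_subsets_at_top UNIV. dist (L2_norm (\<lambda>x. P S x - s x)) 0 < e"
      unfolding eventually_finite_subsets_at_top by (intro exI[of _ "Q n"]) (auto simp: Q)
  qed
  then show ?thesis using P s(1) unfolding L2_tendsto_def P_def by blast
qed

lemma L2_tendsto_inner:
  assumes h: "L2_tendsto h g flt" and f: "f \<in> L2"
  shows "((\<lambda>i. L2_inner (h i) f) \<longlongrightarrow> L2_inner g f) flt"
proof -
  have hi: "h i \<in> L2" "g \<in> L2" and lim: "((\<lambda>i. L2_norm (\<lambda>x. h i x - g x)) \<longlongrightarrow> 0) flt" for i
    using h by (auto simp: L2_tendsto_def)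
  have "((\<lambda>i. L2_norm (\<lambda>x. h i x - g x) * L2_norm f) \<longlongrightarrow> 0 * L2_norm f) flt"
    by (intro tendsto_mult lim tendsto_const)
  then have lim': "((\<lambda>i. L2_norm (\<lambda>x. h i x - g x) * L2_norm f) \<longlongrightarrow> 0) flt" by simp
  have bd: "norm (L2_inner (h i) f - L2_inner g f) \<le> L2_norm (\<lambda>x. h i x - g x) * L2_norm f" for i
    using L2_Cauchy_Schwarz[OF L2_diff[OF hi] f] by (simp add: L2_inner_diff_left hi f)
  have "((\<lambda>i. L2_inner (h i) f - L2_inner g f) \<longlongrightarrow> 0) flt"
    by (rule Lim_null_comparison[OF always_eventually lim']) (use bd in blast)
  then show ?thesis by (simp add: LIM_zero_iff)
qed

text \<open>
  The weak form of the synthesis operator, in which the chosen limit enters only through inner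
  products.
\<close>

lemma synthesis_L2:
  assumes F: "bessel_bound F B" and c: "c \<in> ell2"
  shows "synthesis F c \<in> L2"
    and "f \<in> L2 \<Longrightarrow>
      ((\<lambda>k. c k * cnj (L2_inner f (F k))) has_sum L2_inner (synthesis F c) f) UNIV"
proof -
  have t: "L2_tendsto (\<lambda>S x. \<Sum>k\<in>S. c k * F k x) (synthesis F c) (finite_subsets_at_top UNIV)"
    unfolding synthesis_def by (rule someI_ex[OF synthesis_exists[OF F c]])
  then show "synthesis F c \<in> L2" by (simp add: L2_tendsto_def)
  assume f: "f \<in> L2"
  show "((\<lambda>k. c k * cnj (L2_inner f (F k))) has_sum L2_inner (synthesis F c) f) UNIV"
    using L2_tendsto_inner[OF t f]
    by (simp add: has_sum_def L2_inner_sum_left L2_cmult bessel_boundD(2)[OF F] f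
        L2_inner_cmult_left L2_inner_commute[of "F _" f])
qed

text \<open>
  The analysis operator satisfies the equation that defines the adjoint. The solution is unique,
  since pairing with the unit sequences recovers every component; hence the choice in the
  definition of the adjoint returns the analysis operator pointwise on the space.
\<close>

lemma adjoint_synthesis:
  fixes F :: "'i::countable \<Rightarrow> real \<Rightarrow> complex"
  assumes F: "bessel_bound F B" and f: "f \<in> L2"
  shows "L2_adjoint (synthesis F) f = (\<lambda>i. L2_inner f (F i))"
proof -
  let ?P = "\<lambda>S. \<forall>f\<in>L2. S f \<in> ell2 \<and>
     (\<forall>c\<in>ell2. L2_inner (synthesis F c) f = ell2_inner c (S f))"
  have "?P (\<lambda>f i. L2_inner f (F i))"
    using analysis_ell2[OF F] synthesis_L2(2)[OF F] by (auto simp: ell2_inner_def intro!: infsumI[symmetric])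
  then have P: "?P (L2_adjoint (synthesis F))"
    unfolding L2_adjoint_def by (rule someI[where P = ?P])
  show ?thesis
  proof
    fix i :: 'i
    define c where "c k = (if k = i then 1 else 0 :: complex)" for k
    have c: "c \<in> ell2"
    proof -
      have "(\<lambda>k. (cmod (c k))\<^sup>2) summable_on UNIV \<longleftrightarrow> (\<lambda>k. (cmod (c k))\<^sup>2) summable_on {i}"
        by (intro summable_on_cong_neutral) (auto simp: c_def)
      then show ?thesis by (simp add: ell2_def)
    qed
    have *: "(\<Sum>\<^sub>\<infinity>k. c k * d k) = d i" for d
    proof -
      have "(\<Sum>\<^sub>\<infinity>k. c k * d k) = (\<Sum>\<^sub>\<infinity>k\<in>{i}. c k * d k)"
        by (intro infsum_cong_neutral) (auto simp: c_def)
      then show ?thesis by (simp add: c_def)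
    qed
    have "cnj (L2_adjoint (synthesis F) f i) = L2_inner (synthesis F c) f"
      using P f c * by (simp add: ell2_inner_def)
    also have "\<dots> = cnj (L2_inner f (F i))"
      using infsumI[OF synthesis_L2(2)[OF F c f]] * by simp
    finally show "L2_adjoint (synthesis F) f i = L2_inner f (F i)" by simp
  qed
qed

lemma Bessel_seq_if_bessel_bound:
  assumes "bessel_bound F B"
  shows "Bessel_seq F"
proof -
  have "(\<lambda>i. (cmod (L2_inner f (F i)))\<^sup>2) summable_on UNIV \<and>
      (\<Sum>\<^sub>\<infinity>i. (cmod (L2_inner f (F i)))\<^sup>2) \<le> (B + 1) * (L2_norm f)\<^sup>2" if "f \<in> L2" for f
    using bessel_summable[OF assms that] bessel_infsum_le[OF assms that]
    by (simp add: distrib_right add_increasing2)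
  then show ?thesis
    unfolding Bessel_seq_def using bessel_boundD(1,2)[OF assms]
    by (auto intro!: exI[of _ "B + 1"])
qed

lemma ell2_product_summable:
  assumes "c \<in> ell2" "d \<in> ell2"
  shows "(\<lambda>k. norm (c k * cnj (d k))) summable_on UNIV"
proof -
  have "(\<lambda>k. (cmod (c k))\<^sup>2 + (cmod (d k))\<^sup>2) summable_on UNIV"
    using assms by (intro summable_on_add) (auto simp: ell2_def)
  then show ?thesis
  proof (rule summable_on_comparison_test)
    show "norm (c k * cnj (d k)) \<le> (cmod (c k))\<^sup>2 + (cmod (d k))\<^sup>2" for k
      using zero_le_power2[of "cmod (c k) - cmod (d k)"]
        zero_le_power2[of "cmod (c k)"] zero_le_power2[of "cmod (d k)"]
      unfolding power2_diff norm_mult complex_mod_cnj by linarith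
  qed auto
qed

lemma bessel_bound_add:
  assumes F: "bessel_bound F B" and G: "bessel_bound G B'" and H: "\<And>i. H i = (\<lambda>x. F i x + G i x)"
  shows "bessel_bound H (2 * B + 2 * B')"
proof -
  note FL = bessel_boundD(2)[OF F] and GL = bessel_boundD(2)[OF G]
  have "(\<Sum>i\<in>S. (cmod (L2_inner f (H i)))\<^sup>2) \<le> (2 * B + 2 * B') * (L2_norm f)\<^sup>2"
    if f: "f \<in> L2" and S: "finite S" for f S
  proof -
    have "(\<Sum>i\<in>S. (cmod (L2_inner f (H i)))\<^sup>2)
        \<le> (\<Sum>i\<in>S. 2 * (cmod (L2_inner f (F i)))\<^sup>2 + 2 * (cmod (L2_inner f (G i)))\<^sup>2)"
    proof (rule sum_mono)
      fix i
      have "(cmod (L2_inner f (H i)))\<^sup>2 \<le> (cmod (L2_inner f (F i)) + cmod (L2_inner f (G i)))\<^sup>2"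
        unfolding H L2_inner_add_right[OF FL GL f] by (intro power_mono norm_triangle_ineq) auto
      also have "\<dots> \<le> 2 * (cmod (L2_inner f (F i)))\<^sup>2 + 2 * (cmod (L2_inner f (G i)))\<^sup>2"
        using zero_le_power2[of "cmod (L2_inner f (F i)) - cmod (L2_inner f (G i))"]
        by (simp add: power2_eq_square algebra_simps)
      finally show "(cmod (L2_inner f (H i)))\<^sup>2 \<le> 2 * (cmod (L2_inner f (F i)))\<^sup>2 + 2 * (cmod (L2_inner f (G i)))\<^sup>2" .
    qed
    also have "\<dots> = 2 * (\<Sum>i\<in>S. (cmod (L2_inner f (F i)))\<^sup>2) + 2 * (\<Sum>i\<in>S. (cmod (L2_inner f (G i)))\<^sup>2)"
      by (simp add: sum.distrib sum_distrib_left)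
    also have "\<dots> \<le> 2 * (B * (L2_norm f)\<^sup>2) + 2 * (B' * (L2_norm f)\<^sup>2)"
      by (intro add_mono mult_left_mono bessel_boundD(3)[OF F f S] bessel_boundD(3)[OF G f S]) auto
    finally show ?thesis by (simp add: algebra_simps)
  qed
  then show ?thesis
    using bessel_boundD(1)[OF F] bessel_boundD(1)[OF G] L2_add[OF FL GL] unfolding bessel_bound_def H by auto
qed

lemma bessel_product_infsum_le:
  assumes F: "bessel_bound F B" and G: "bessel_bound G B'" and f: "f \<in> L2" and h: "h \<in> L2"
  shows "cmod (\<Sum>\<^sub>\<infinity>k. L2_inner f (F k) * cnj (L2_inner h (G k)))
    \<le> sqrt (B * B') * L2_norm f * L2_norm h"
proof -
  let ?p = "\<lambda>k. L2_inner f (F k) * cnj (L2_inner h (G k))"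
  have s: "(\<lambda>k. norm (?p k)) summable_on UNIV"
    by (intro ell2_product_summable analysis_ell2[OF F f] analysis_ell2[OF G h])
  have "cmod (infsum ?p UNIV) \<le> (\<Sum>\<^sub>\<infinity>k. norm (?p k))"
    by (rule norm_infsum_bound[OF s])
  also have "\<dots> \<le> sqrt (B * B') * L2_norm f * L2_norm h"
  proof (rule infsum_le_finite_sums[OF s])
    fix S :: "'a set" assume S: "finite S"
    have "(\<Sum>k\<in>S. norm (?p k)) = (\<Sum>k\<in>S. \<bar>cmod (L2_inner f (F k))\<bar> * \<bar>cmod (L2_inner h (G k))\<bar>)"
      by (simp add: norm_mult)
    also have "\<dots> \<le> L2_set (\<lambda>k. cmod (L2_inner f (F k))) S * L2_set (\<lambda>k. cmod (L2_inner h (G k))) S"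
      by (rule L2_set_mult_ineq)
    also have "\<dots> \<le> sqrt (B * (L2_norm f)\<^sup>2) * sqrt (B' * (L2_norm h)\<^sup>2)"
      unfolding L2_set_def using bessel_boundD(3)[OF F f S] bessel_boundD(3)[OF G h S] bessel_boundD(1)[OF F]
      by (intro mult_mono real_sqrt_le_mono) (auto intro: sum_nonneg)
    also have "\<dots> = sqrt (B * B') * L2_norm f * L2_norm h"
      by (simp add: real_sqrt_mult)
    finally show "(\<Sum>k\<in>S. norm (?p k)) \<le> sqrt (B * B') * L2_norm f * L2_norm h" .
  qed
  finally show ?thesis .
qed

section \<open>Fourier series on an interval\<close>

lemma cis_measurable [measurable]: "cis \<in> borel_measurable borel"
  by (intro borel_measurable_continuous_onI continuous_on_cis continuous_on_id)

definition fmode :: "real \<Rightarrow> int \<Rightarrow> real \<Rightarrow> complex" where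
  "fmode p k x = cis (2 * pi * of_int k * x / p)"

lemma fmode_measurable [measurable]: "fmode p k \<in> borel_measurable borel"
  unfolding fmode_def by measurable

lemma fmode_0 [simp]: "fmode p 0 x = 1"
  by (simp add: fmode_def)

lemma norm_fmode [simp]: "cmod (fmode p k x) = 1"
  by (simp add: fmode_def)

lemma fmode_mult: "fmode p k x * fmode p l x = fmode p (k + l) x"
  by (simp add: fmode_def cis_mult add_divide_distrib [symmetric] distrib_right distrib_left)

lemma cnj_fmode: "cnj (fmode p k x) = fmode p (- k) x"
  by (simp add: fmode_def cis_cnj)

lemma cis_2pi_int [simp]: "cis (2 * pi * of_int n) = 1"
  by (simp add: cis.code complex_eq_iff)

lemma fmode_periodic: "p \<noteq> 0 \<Longrightarrow> fmode p k (x + of_int l * p) = fmode p k x"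
proof -
  assume "p \<noteq> 0"
  then have "2 * pi * of_int k * (x + of_int l * p) / p = 2 * pi * of_int k * x / p + 2 * pi * of_int (k * l)"
    by (simp add: field_simps)
  then show ?thesis
    unfolding fmode_def by (simp only: cis_mult [symmetric] cis_2pi_int) simp
qed

lemma fmode_inj_on:
  assumes "p > 0" "x \<in> {u..<u+p}" "y \<in> {u..<u+p}" "fmode p 1 x = fmode p 1 y"
  shows "x = y"
proof -
  have "cis (2 * pi * x / p - 2 * pi * y / p) = 1"
    using assms(4) by (simp add: fmode_def cis_divide [symmetric])
  then have "cos (2 * pi * x / p - 2 * pi * y / p) = 1"
    by (metis cis.sel(1) one_complex.sel(1))
  then obtain n :: int where "2 * pi * x / p - 2 * pi * y / p = of_int n * 2 * pi"
    by (auto simp: cos_one_2pi_int)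
  then have "2 * pi * (x - y) = 2 * pi * (of_int n * p)"
    using assms(1) by (simp add: field_simps)
  then have n: "x - y = of_int n * p" by simp
  have "\<bar>x - y\<bar> < p" using assms(2,3) by auto
  then have "\<bar>of_int n\<bar> * p < 1 * p" using n assms(1) by (simp add: abs_mult)
  then have "\<bar>real_of_int n\<bar> < 1" using assms(1) by (simp add: mult_less_cancel_right)
  then have "n = 0" by linarith
  then show ?thesis using n by simp
qed

lemma integral_fmode:
  assumes p: "p > 0"
  shows "(LINT x|lborel. indicator {u..<u+p} x * fmode p k x) = (if k = 0 then of_real p else 0)"
proof -
  have "(LINT x|lborel. indicator {u..<u+p} x * fmode p k x)
      = (LINT x|lborel. indicator {u..u+p} x *\<^sub>R fmode p k x)"
  proof (rule integral_cong_AE)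
    have "AE x in lborel. x \<noteq> u + p" by (rule AE_lborel_singleton)
    then show "AE x in lborel. indicator {u..<u+p} x * fmode p k x = indicator {u..u+p} x *\<^sub>R fmode p k x"
      by (rule AE_mp) (auto intro!: AE_I2 simp: indicator_def)
  qed measurable
  also have "\<dots> = (if k = 0 then of_real p else 0)"
  proof (cases "k = 0")
    case True
    have "(LINT x|lborel. indicator {u..u+p} x *\<^sub>R (1::complex)) = of_real p"
      using p by (simp add: scaleR_conv_of_real)
    with True show ?thesis by simp
  next
    case False
    define w where "w = 2 * pi * of_int k / p"
    have w: "w \<noteq> 0" using False p by (simp add: w_def)
    have fmode: "fmode p k x = exp (\<i> * of_real w * of_real x)" for x
      by (simp add: fmode_def cis_conv_exp w_def mult_ac)
    have "(LINT x|lborel. indicator {u..u+p} x *\<^sub>R fmode p k x)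
        = fmode p k (u + p) / (\<i> * of_real w) - fmode p k u / (\<i> * of_real w)"
    proof (rule integral_FTC_Icc)
      show "u \<le> u + p" using p by simp
      show "continuous_on {u..u+p} (fmode p k)"
        unfolding fmode by (intro continuous_intros)
      fix x
      have "((\<lambda>x. exp (\<i> * of_real w * x) / (\<i> * of_real w)) has_field_derivative exp (\<i> * of_real w * of_real x)) (at (of_real x))"
        using w by (auto intro!: derivative_eq_intros)
      then have "((\<lambda>x. exp (\<i> * of_real w * of_real x) / (\<i> * of_real w)) has_vector_derivative exp (\<i> * of_real w * of_real x)) (at x)"
        by (rule has_vector_derivative_real_field)
      then show "((\<lambda>x. fmode p k x / (\<i> * of_real w)) has_vector_derivative fmode p k x) (at x within {u..u+p})"
        unfolding fmode by (rule has_vector_derivative_at_within)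
    qed
    also have "fmode p k (u + p) = fmode p k u"
      using fmode_periodic[of p k u 1] p by simp
    finally show ?thesis using False by simp
  qed
  finally show ?thesis .
qed

text \<open>
  The exponentials cut off to one period starting at \<open>u\<close>. With the sign of the index chosen
  here the coefficient of \<open>G\<close> is the integral of \<open>G\<close> against \<open>fmode p k\<close>, which is the form
  in which wavelet coefficients arise.
\<close>

definition cut_fmode :: "real \<Rightarrow> real \<Rightarrow> int \<Rightarrow> real \<Rightarrow> complex" where
  "cut_fmode u p k x = indicator {u..<u+p} x * fmode p (- k) x"

lemma indicator_L2:
  assumes "S \<in> sets borel" "emeasure lborel S < \<infinity>"
  shows "(\<lambda>x. indicator S x) \<in> L2"
proof (rule L2I)
  have "(\<lambda>x. (cmod (indicator S x))\<^sup>2) = indicat_real S"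
    by (auto simp: indicator_def)
  then show "integrable lborel (\<lambda>x. (cmod (indicator S x))\<^sup>2)"
    using assms by simp
qed (use assms in simp)

lemma interval_indicator_L2: "(\<lambda>x. indicator {u..<v} x) \<in> L2"
  by (rule indicator_L2, simp, cases "u \<le> v") auto

lemma cut_fmode_L2: "cut_fmode u p k \<in> L2"
  unfolding cut_fmode_def
  by (rule L2_mult_bounded[OF interval_indicator_L2, where M = 1]) auto

lemma cut_fmode_inner:
  assumes "p > 0"
  shows "L2_inner (cut_fmode u p k) (cut_fmode u p l) = (if k = l then of_real p else 0)"
proof -
  have "cut_fmode u p k x * cnj (cut_fmode u p l x) = indicator {u..<u+p} x * fmode p (l - k) x" for x
    by (auto simp: cut_fmode_def cnj_fmode fmode_mult indicator_def algebra_simps)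
  then show ?thesis
    unfolding L2_inner_def using integral_fmode[OF assms, of u "l - k"] by auto
qed

lemma L2_inner_cut_fmode:
  "L2_inner f (cut_fmode u p k) = (LINT x|lborel. f x * indicator {u..<u+p} x * fmode p k x)"
proof -
  have "cnj (indicator {u..<u+p} x) = (indicator {u..<u+p} x :: complex)" for x :: real
    by (simp add: indicator_def)
  then show ?thesis
    unfolding L2_inner_def cut_fmode_def by (simp add: cnj_fmode mult.assoc)
qed

lemma bessel_bound_orthogonal:
  fixes F :: "'i \<Rightarrow> real \<Rightarrow> complex"
  assumes F: "\<And>k. F k \<in> L2"
    and orth: "\<And>k l. L2_inner (F k) (F l) = (if k = l then of_real p else 0)" and p: "p \<ge> 0"
  shows "bessel_bound F p"
proof -
  have "(\<Sum>i\<in>S. (cmod (L2_inner f (F i)))\<^sup>2) \<le> p * (L2_norm f)\<^sup>2"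
    if f: "f \<in> L2" and S: "finite S" for f S
  proof -
    define c where "c k = L2_inner f (F k)" for k
    define u where "u = (\<lambda>x. \<Sum>k\<in>S. c k * F k x)"
    define s where "s = (\<Sum>k\<in>S. (cmod (c k))\<^sup>2)"
    have s: "s \<ge> 0" unfolding s_def by (intro sum_nonneg) auto
    have u: "u \<in> L2" unfolding u_def by (intro L2_sum L2_cmult F)
    have s': "of_real s = (\<Sum>k\<in>S. c k * cnj (c k))"
      unfolding s_def by (simp add: complex_norm_square [symmetric])
    have Fu: "L2_inner u (F l) = of_real p * c l" if "l \<in> S" for l
    proof -
      have "L2_inner u (F l) = (\<Sum>k\<in>S. c k * (if k = l then of_real p else 0))"
        unfolding u_def by (simp add: L2_inner_sum_left L2_cmult F L2_inner_cmult_left orth)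
      also have "\<dots> = of_real p * c l"
        using that S by (simp add: if_distrib[of "(*) _"] sum.delta cong: if_cong)
      finally show ?thesis .
    qed
    have "L2_inner u u = (\<Sum>k\<in>S. c k * cnj (L2_inner u (F k)))"
      by (subst u_def) (simp add: L2_inner_sum_left L2_cmult F u L2_inner_cmult_left L2_inner_commute[of "F _" u])
    also have "\<dots> = of_real p * (\<Sum>k\<in>S. c k * cnj (c k))"
      by (simp add: Fu sum_distrib_left mult_ac)
    finally have "of_real ((L2_norm u)\<^sup>2) = complex_of_real (p * s)"
      by (simp add: L2_inner_self s')
    then have nu: "(L2_norm u)\<^sup>2 = p * s"
      by (simp only: of_real_eq_iff)
    have "L2_inner u f = (\<Sum>k\<in>S. c k * cnj (c k))"
      by (simp add: u_def L2_inner_sum_left L2_cmult F f L2_inner_cmult_left L2_inner_commute[of "F _" f] c_def)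
    then have "s = cmod (L2_inner u f)"
      using s by (simp flip: s')
    also have "\<dots> \<le> L2_norm u * L2_norm f"
      by (rule L2_Cauchy_Schwarz[OF u f])
    finally have "s\<^sup>2 \<le> (L2_norm u * L2_norm f)\<^sup>2"
      using s by (intro power_mono)
    also have "\<dots> = s * (p * (L2_norm f)\<^sup>2)"
      by (simp add: power_mult_distrib nu)
    finally have "s * s \<le> s * (p * (L2_norm f)\<^sup>2)" by (simp add: power2_eq_square)
    then show ?thesis
      using s p unfolding s_def[symmetric] c_def[symmetric]
      by (cases "s = 0") (auto simp: mult_le_cancel_left)
  qed
  then show ?thesis using F p by (auto simp: bessel_bound_def)
qed

lemma bessel_bound_cut_fmode: "p > 0 \<Longrightarrow> bessel_bound (cut_fmode u p) p"
  by (rule bessel_bound_orthogonal[OF cut_fmode_L2 cut_fmode_inner]) auto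

text \<open>
  By the Stone-Weierstrass theorem it is enough to treat real polynomials on the circle in
  place of \<open>g\<close>. Instead of writing these as trigonometric sums, let \<open>V\<close> be the space of bounded
  functions \<open>r\<close> for which \<open>h r\<close> is orthogonal to all exponentials, and \<open>W\<close> the multipliers of
  \<open>V\<close>. The multipliers form an algebra that contains the exponentials, hence their real and
  imaginary parts, hence every real polynomial in them; and \<open>1 \<in> V\<close> by hypothesis.
\<close>

lemma integral_continuous_circle_zero:
  fixes h :: "real \<Rightarrow> complex" and g :: "complex \<Rightarrow> real"
  assumes h: "integrable lborel h"
    and zero: "\<And>k. (LINT x|lborel. h x * fmode p k x) = 0"
    and g: "continuous_on (sphere 0 1) g"
  shows "(LINT x|lborel. h x * of_real (g (fmode p 1 x))) = 0"
proof -
  have [measurable]: "h \<in> borel_measurable borel" using h by auto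
  define V where "V = {r :: real \<Rightarrow> complex. r \<in> borel_measurable borel \<and> (\<exists>M. \<forall>x. cmod (r x) \<le> M) \<and>
     (\<forall>k. (LINT x|lborel. h x * (r x * fmode p k x)) = 0)}"
  define W where "W = {q :: real \<Rightarrow> complex. \<forall>r\<in>V. (\<lambda>x. q x * r x) \<in> V}"
  have hint: "integrable lborel (\<lambda>x. h x * r x)"
    if [measurable]: "r \<in> borel_measurable borel" and "\<And>x. cmod (r x) \<le> M" for r M
  proof (rule Bochner_Integration.integrable_bound)
    show "integrable lborel (\<lambda>x. of_real M * h x)" using h by simp
    have "cmod (h x) * cmod (r x) \<le> \<bar>M\<bar> * cmod (h x)" for x
      using that(2)[of x] by (subst mult.commute) (intro mult_right_mono, auto)
    then show "AE x in lborel. norm (h x * r x) \<le> norm (of_real M * h x)"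
      by (simp add: norm_mult)
  qed measurable
  have hint2: "integrable lborel (\<lambda>x. h x * (r x * fmode p k x))" if "r \<in> V" for r k
    using that unfolding V_def by (auto intro!: hint simp: norm_mult)
  have Vadd: "(\<lambda>x. r x + r' x) \<in> V" if rr: "r \<in> V" "r' \<in> V" for r r'
  proof -
    obtain M where M: "\<And>x. cmod (r x) \<le> M" using rr(1) by (auto simp: V_def)
    obtain M' where M': "\<And>x. cmod (r' x) \<le> M'" using rr(2) by (auto simp: V_def)
    have "cmod (r x + r' x) \<le> M + M'" for x
      by (rule norm_triangle_mono[OF M M'])
    moreover have "(LINT x|lborel. h x * ((r x + r' x) * fmode p k x)) = 0" for k
      using that hint2[OF that(1), of k] hint2[OF that(2), of k]
      by (simp add: distrib_left distrib_right V_def)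
    ultimately show ?thesis using that by (auto simp: V_def)
  qed
  have Vcmult: "(\<lambda>x. c * r x) \<in> V" if rV: "r \<in> V" for r c
  proof -
    obtain M where "\<And>x. cmod (r x) \<le> M" using rV by (auto simp: V_def)
    then have "cmod (c * r x) \<le> cmod c * M" for x
      by (simp add: norm_mult mult_left_mono)
    moreover have "(LINT x|lborel. h x * (c * r x * fmode p k x)) = 0" for k
    proof -
      have "(LINT x|lborel. h x * (c * r x * fmode p k x)) = (LINT x|lborel. c * (h x * (r x * fmode p k x)))"
        by (simp add: mult_ac)
      then show ?thesis using that by (simp add: V_def)
    qed
    ultimately show ?thesis using that by (auto simp: V_def)
  qed
  have Vone: "(\<lambda>x. 1) \<in> V"
    using zero by (auto simp: V_def)
  have Wadd: "(\<lambda>x. q x + q' x) \<in> W" if "q \<in> W" "q' \<in> W" for q q'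
    using that Vadd by (fastforce simp: W_def distrib_right)
  have Wcmult: "(\<lambda>x. c * q x) \<in> W" if "q \<in> W" for q c
    using that Vcmult by (fastforce simp: W_def mult.assoc)
  have Wconst: "(\<lambda>x. c) \<in> W" for c
    using Vcmult by (auto simp: W_def)
  have Wmult: "(\<lambda>x. q x * q' x) \<in> W" if "q \<in> W" "q' \<in> W" for q q'
    using that by (auto simp: W_def mult.assoc)
  have Wfmode: "fmode p l \<in> W" for l
    unfolding W_def V_def
  proof (safe)
    fix r M k assume [measurable]: "r \<in> borel_measurable borel" and M: "\<forall>x. cmod (r x) \<le> M"
      and z: "\<forall>k. (LINT x|lborel. h x * (r x * fmode p k x)) = 0"
    show "(\<lambda>x. fmode p l x * r x) \<in> borel_measurable borel" by measurable
    show "\<exists>M. \<forall>x. cmod (fmode p l x * r x) \<le> M" using M by (auto simp: norm_mult)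
    have eq: "h x * (fmode p l x * r x * fmode p k x) = h x * (r x * fmode p (l + k) x)" for x
      by (simp add: fmode_mult[symmetric] mult_ac)
    show "(LINT x|lborel. h x * (fmode p l x * r x * fmode p k x)) = 0" unfolding eq using z by blast
  qed
  have Wpoly: "(\<lambda>x. of_real (P (fmode p 1 x))) \<in> W" if "real_polynomial_function P" for P
    using that
  proof (induction P rule: real_polynomial_function.induct)
    case (linear f)
    have fz: "f z = Re z * f 1 + Im z * f \<i>" for z
    proof -
      have "f z = f (Re z *\<^sub>R 1 + Im z *\<^sub>R \<i>)"
        by (rule arg_cong[where f = f]) (simp add: complex_eq_iff)
      also have "\<dots> = Re z * f 1 + Im z * f \<i>"
        using linear by (simp add: linear_add linear_scale bounded_linear.linear)
      finally show ?thesis .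
    qed
    have "complex_of_real (f (fmode p 1 x)) =
        (of_real (f 1) / 2) * (fmode p 1 x + fmode p (-1) x)
        + (of_real (f \<i>) / (2 * \<i>)) * (fmode p 1 x + (-1) * fmode p (-1) x)" for x
    proof -
      let ?z = "fmode p 1 x"
      have c: "fmode p (-1) x = cnj ?z" by (simp add: cnj_fmode)
      have "?z + cnj ?z = of_real (2 * Re ?z)" "?z + (-1) * cnj ?z = of_real (2 * Im ?z) * \<i>"
        by (simp_all add: complex_eq_iff)
      then show ?thesis by (simp only: c) (simp add: fz[of ?z] mult_ac)
    qed
    then show ?case
      using Wadd[OF Wcmult[OF Wadd[OF Wfmode Wfmode]] Wcmult[OF Wadd[OF Wfmode Wcmult[OF Wfmode]]],
        of "of_real (f 1) / 2" 1 "-1" "of_real (f \<i>) / (2 * \<i>)" 1 "-1" "-1"] by simp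
  next
    case (const c) show ?case by (rule Wconst)
  next
    case (add f g) then show ?case using Wadd by simp
  next
    case (mult f g) then show ?case using Wmult by simp
  qed
  have pz: "(LINT x|lborel. h x * of_real (P (fmode p 1 x))) = 0"
    and pV: "(\<lambda>x. complex_of_real (P (fmode p 1 x))) \<in> V" if P: "real_polynomial_function P" for P
  proof -
    have "(\<lambda>x. of_real (P (fmode p 1 x)) * 1) \<in> V"
      using Wpoly[OF P] Vone unfolding W_def by fastforce
    then show *: "(\<lambda>x. complex_of_real (P (fmode p 1 x))) \<in> V" by simp
    then have "(LINT x|lborel. h x * (of_real (P (fmode p 1 x)) * fmode p 0 x)) = 0"
      unfolding V_def by blast
    then show "(LINT x|lborel. h x * of_real (P (fmode p 1 x))) = 0" by simp
  qed
  define g' where "g' z = (if z \<in> sphere 0 1 then g z else 0)" for z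
  have [measurable]: "g' \<in> borel_measurable borel"
    unfolding g'_def by (rule borel_measurable_continuous_on_if) (auto simp: g)
  have gg: "g (fmode p 1 x) = g' (fmode p 1 x)" for x by (simp add: g'_def)
  have "bounded (g ` sphere 0 1)"
    by (intro compact_imp_bounded compact_continuous_image g) auto
  then obtain M where M: "\<And>z. z \<in> sphere 0 1 \<Longrightarrow> \<bar>g z\<bar> \<le> M"
    unfolding bounded_iff by (metis imageI real_norm_def)
  have gint: "integrable lborel (\<lambda>x. h x * of_real (g' (fmode p 1 x)))"
  proof (rule hint[where M = M])
    show "cmod (of_real (g' (fmode p 1 x))) \<le> M" for x
      using M[of "fmode p 1 x"] by (simp add: g'_def)
  qed measurable
  have "cmod (LINT x|lborel. h x * of_real (g' (fmode p 1 x))) \<le> e * (LINT x|lborel. cmod (h x))"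
    if e: "e > 0" for e
  proof -
    obtain P where P: "real_polynomial_function P" "\<And>z. z \<in> sphere 0 1 \<Longrightarrow> \<bar>g z - P z\<bar> < e"
      using Stone_Weierstrass_real_polynomial_function[OF compact_sphere g e] by blast
    have Pint: "integrable lborel (\<lambda>x. h x * of_real (P (fmode p 1 x)))"
      using hint2[OF pV[OF P(1)], of 0] by simp
    have "(LINT x|lborel. h x * of_real (g' (fmode p 1 x)))
        = (LINT x|lborel. h x * of_real (g' (fmode p 1 x)) - h x * of_real (P (fmode p 1 x)))"
      using gint Pint pz[OF P(1)] by simp
    also have "cmod \<dots> \<le> (LINT x|lborel. e * cmod (h x))"
    proof (rule Bochner_Integration.integral_norm_bound_integral)
      show "integrable lborel (\<lambda>x. h x * of_real (g' (fmode p 1 x)) - h x * of_real (P (fmode p 1 x)))"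
        using gint Pint by simp
      show "integrable lborel (\<lambda>x. e * cmod (h x))" using h by simp
      fix x
      have "cmod (h x * of_real (g' (fmode p 1 x)) - h x * of_real (P (fmode p 1 x)))
          = cmod (h x) * \<bar>g (fmode p 1 x) - P (fmode p 1 x)\<bar>"
        by (simp add: gg right_diff_distrib[symmetric] norm_mult flip: of_real_diff)
      also have "\<dots> \<le> cmod (h x) * e"
        using P(2)[of "fmode p 1 x"] by (intro mult_left_mono) auto
      finally show "cmod (h x * of_real (g' (fmode p 1 x)) - h x * of_real (P (fmode p 1 x))) \<le> e * cmod (h x)"
        by (simp add: mult.commute)
    qed
    finally show ?thesis by simp
  qed
  note small = this
  have "cmod (LINT x|lborel. h x * of_real (g' (fmode p 1 x))) \<le> 0"
  proof (rule field_le_epsilon)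
    fix e :: real assume e: "e > 0"
    define H where "H = (LINT x|lborel. cmod (h x))"
    have H: "H \<ge> 0" by (simp add: H_def)
    have "cmod (LINT x|lborel. h x * of_real (g' (fmode p 1 x))) \<le> e / (H + 1) * H"
    proof -
      have "e / (H + 1) > 0" using e H by (intro divide_pos_pos) auto
      from small[OF this] show ?thesis unfolding H_def .
    qed
    also have "\<dots> \<le> e" using e H by (simp add: field_simps)
    finally show "cmod (LINT x|lborel. h x * of_real (g' (fmode p 1 x))) \<le> 0 + e" by simp
  qed
  then show ?thesis by (simp add: gg)
qed

text \<open>
  The exponentials are total on an interval of one period. The indicator of a compact arc \<open>X\<close> is
  the pointwise limit of the continuous functions \<open>1 / (1 + n dist(z, X))\<close>, so that the cut-off
  function \<open>h\<close> has vanishing integral over compact subintervals. These and the vanishing of the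
  full integral determine the integrals over all half-lines, which generate the Borel sets.
\<close>

lemma cut_fmode_total:
  assumes p: "p > 0" and f: "f \<in> L2" and zero: "\<And>k. L2_inner f (cut_fmode u p k) = 0"
  shows "AE x in lborel. x \<in> {u..<u+p} \<longrightarrow> f x = 0"
proof -
  note [measurable] = L2_measurable[OF f]
  define h where "h x = f x * indicator {u..<u+p} x" for x
  have h: "integrable lborel h"
    unfolding h_def by (rule integrable_mult_L2[OF f interval_indicator_L2])
  then have hm [measurable]: "h \<in> borel_measurable borel" by auto
  have hz: "(LINT x|lborel. h x * fmode p k x) = 0" for k
    using zero[of k] unfolding L2_inner_cut_fmode h_def .
  have Icc: "(LINT x|lborel. indicator {s..t} x *\<^sub>R h x) = 0" if st: "u \<le> s" "s \<le> t" "t < u + p" for s t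
  proof -
    define X where "X = fmode p 1 ` {s..t}"
    have "continuous_on {s..t} (fmode p 1)"
      unfolding fmode_def by (intro continuous_on_cis continuous_intros) (use p in auto)
    then have X: "compact X" "X \<noteq> {}"
      unfolding X_def using st by (auto intro!: compact_continuous_image)
    have inX: "fmode p 1 x \<in> X \<longleftrightarrow> x \<in> {s..t}" if "x \<in> {u..<u+p}" for x
    proof
      assume "fmode p 1 x \<in> X"
      then obtain y where y: "y \<in> {s..t}" "fmode p 1 x = fmode p 1 y" unfolding X_def by blast
      then have "y \<in> {u..<u+p}" using st by auto
      then show "x \<in> {s..t}" using fmode_inj_on[OF p that _ y(2)] y(1) by simp
    qed (auto simp: X_def)
    define g where "g n z = 1 / (1 + real n * infdist z X)" for n z
    have pos: "1 + real n * infdist z X \<ge> 1" for n z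
      by (simp add: infdist_nonneg)
    have gc: "continuous_on A (g n)" for n A
      unfolding g_def
      by (intro continuous_intros continuous_on_infdist) (use pos in \<open>smt (verit)\<close>)
    have gm: "g n \<in> borel_measurable borel" for n
      by (rule borel_measurable_continuous_onI[OF gc])
    have "(\<lambda>n. LINT x|lborel. h x * of_real (g n (fmode p 1 x)))
        \<longlonglongrightarrow> (LINT x|lborel. indicator {s..t} x *\<^sub>R h x)"
    proof (rule integral_dominated_convergence)
      show "(\<lambda>x. indicator {s..t} x *\<^sub>R h x) \<in> borel_measurable lborel" by measurable
      show "(\<lambda>x. h x * of_real (g n (fmode p 1 x))) \<in> borel_measurable lborel" for n
        using measurable_compose[OF fmode_measurable[of p 1] gm[of n]] by measurable
      show "integrable lborel (\<lambda>x. cmod (h x))" using h by simp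
      show "AE x in lborel. norm (h x * of_real (g n (fmode p 1 x))) \<le> cmod (h x)" for n
      proof (rule AE_I2)
        fix x
        have "\<bar>g n (fmode p 1 x)\<bar> \<le> 1"
          unfolding g_def using pos[of n "fmode p 1 x"] by (simp add: abs_le_iff divide_le_eq)
        then show "norm (h x * of_real (g n (fmode p 1 x))) \<le> cmod (h x)"
          by (simp add: norm_mult mult_left_le)
      qed
      show "AE x in lborel. (\<lambda>n. h x * of_real (g n (fmode p 1 x))) \<longlonglongrightarrow> indicator {s..t} x *\<^sub>R h x"
      proof (rule AE_I2)
        fix x
        \<comment> \<open>outside the interval there is nothing to show because h vanishes there\<close>
        consider "x \<notin> {u..<u+p}" | "x \<in> {s..t}" "x \<in> {u..<u+p}" | "x \<notin> {s..t}" "x \<in> {u..<u+p}" by blast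
        then show "(\<lambda>n. h x * of_real (g n (fmode p 1 x))) \<longlonglongrightarrow> indicator {s..t} x *\<^sub>R h x"
        proof cases
          case 1
          then show ?thesis by (simp add: h_def)
        next
          case 2
          then have "infdist (fmode p 1 x) X = 0" using inX by simp
          then show ?thesis using 2 by (simp add: g_def)
        next
          case 3
          define d where "d = infdist (fmode p 1 x) X"
          have "d \<noteq> 0"
            using 3 inX[OF 3(2)] in_closed_iff_infdist_zero[OF compact_imp_closed[OF X(1)] X(2)]
            by (simp add: d_def)
          then have d: "d > 0" unfolding d_def using infdist_nonneg[of "fmode p 1 x" X] by linarith
          have "filterlim (\<lambda>n. real n * d) at_top sequentially"
            using filterlim_tendsto_pos_mult_at_top[OF tendsto_const d filterlim_real_sequentially]
            by (simp add: mult.commute)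
          then have "filterlim (\<lambda>n. 1 + real n * d) at_top sequentially"
            by (intro filterlim_tendsto_add_at_top[OF tendsto_const])
          then have "(\<lambda>n. 1 / (1 + real n * d)) \<longlonglongrightarrow> 0"
            using tendsto_inverse_0_at_top by (simp add: inverse_eq_divide)
          then have "(\<lambda>n. h x * of_real (1 / (1 + real n * d))) \<longlonglongrightarrow> h x * of_real 0"
            by (intro tendsto_mult tendsto_const tendsto_of_real)
          then show ?thesis using 3 by (simp add: g_def d_def)
        qed
      qed
    qed
    moreover have "(LINT x|lborel. h x * of_real (g n (fmode p 1 x))) = 0" for n
      by (rule integral_continuous_circle_zero[OF h hz gc])
    ultimately show ?thesis by (simp add: LIMSEQ_const_iff)
  qed
  have all: "(LINT x|lborel. h x) = 0" using hz[of 0] by simp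
  have atMost: "(LINT x|lborel. indicator {..t} x *\<^sub>R h x) = 0" for t
  proof -
    consider "t < u" | "u \<le> t" "t < u + p" | "u + p \<le> t" by linarith
    then show ?thesis
    proof cases
      case 1
      then have "(\<lambda>x. indicator {..t} x *\<^sub>R h x) = (\<lambda>x. 0)"
        by (auto simp: h_def indicator_def)
      then show ?thesis by simp
    next
      case 2
      then have "(\<lambda>x. indicator {..t} x *\<^sub>R h x) = (\<lambda>x. indicator {u..t} x *\<^sub>R h x)"
        by (auto simp: h_def indicator_def)
      then show ?thesis using Icc[of u t] 2 by simp
    next
      case 3
      then have "(\<lambda>x. indicator {..t} x *\<^sub>R h x) = h"
        by (auto simp: h_def indicator_def)
      then show ?thesis using all by simp
    qed
  qed
  have sets0: "set_lebesgue_integral lborel A h = 0" if "A \<in> sets lborel" for A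
  proof -
    have "A \<in> sigma_sets UNIV (range (atMost :: real \<Rightarrow> real set))"
      using that by (simp add: borel_eq_atMost)
    have "Int_stable (range (atMost :: real \<Rightarrow> real set))"
      by (auto simp: Int_stable_def)
    moreover have "range (atMost :: real \<Rightarrow> real set) \<subseteq> Pow UNIV" by simp
    moreover note \<open>A \<in> sigma_sets UNIV (range (atMost :: real \<Rightarrow> real set))\<close>
    ultimately have "A \<in> sets borel \<and> set_lebesgue_integral lborel A h = 0"
    proof (induction rule: sigma_sets_induct_disjoint)
      case (basic A)
      then show ?case using atMost by (auto simp: set_lebesgue_integral_def)
    next
      case empty
      show ?case by (simp add: set_lebesgue_integral_def)
    next
      case (compl A)
      then have A: "A \<in> sets borel" by simp
      have "set_lebesgue_integral lborel (UNIV - A) h = (LINT x|lborel. h x - indicator A x *\<^sub>R h x)"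
        unfolding set_lebesgue_integral_def
        by (intro Bochner_Integration.integral_cong) (auto simp: indicator_def)
      also have "\<dots> = 0"
        using compl A h all by (simp add: set_lebesgue_integral_def integrable_mult_indicator)
      finally show ?case using A by auto
    next
      case (union A)
      have "set_lebesgue_integral lborel (\<Union>i. A i) h = (\<Sum>i. set_lebesgue_integral lborel (A i) h)"
        using union h
        by (intro lebesgue_integral_countable_add)
           (auto simp: disjoint_family_on_def set_integrable_def intro!: integrable_mult_indicator)
      then show ?case using union by auto
    qed
    then show ?thesis by simp
  qed
  have "AE x in lborel. h x = 0" by (rule sigma_finite_measure.density_zero[OF sigma_finite_lborel h sets0])
  then show ?thesis by (rule AE_mp) (auto intro!: AE_I2 simp: h_def)
qed

text \<open>
  The Fourier series of \<open>f\<close>, without the normalizing factor \<open>1 / p\<close>, converges in norm to some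
  \<open>s\<close>, being the synthesis of square-summable coefficients. The function \<open>p f - s\<close> has vanishing coefficients, so it vanishes on the interval
  by totality and is orthogonal to \<open>h\<close>; the expansion of the inner product of \<open>s\<close> and \<open>h\<close> is the claim.
\<close>

lemma parseval_interval:
  assumes p: "p > 0" and f: "f \<in> L2" and h: "h \<in> L2"
    and fs: "AE x in lborel. x \<notin> {u..<u+p} \<longrightarrow> f x = 0"
    and hs: "AE x in lborel. x \<notin> {u..<u+p} \<longrightarrow> h x = 0"
  shows "((\<lambda>k. (LINT x|lborel. f x * fmode p k x) * cnj (LINT x|lborel. h x * fmode p k x))
    has_sum of_real p * L2_inner f h) UNIV"
proof -
  note B = bessel_bound_cut_fmode[OF p, of u]
  define c where "c k = L2_inner f (cut_fmode u p k)" for k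
  have c: "c \<in> ell2" unfolding c_def[abs_def] by (rule analysis_ell2[OF B f])
  define s where "s = synthesis (cut_fmode u p) c"
  have s: "s \<in> L2" unfolding s_def by (rule synthesis_L2(1)[OF B c])
  have ss: "((\<lambda>k. c k * cnj (L2_inner g (cut_fmode u p k))) has_sum L2_inner s g) UNIV" if "g \<in> L2" for g
    unfolding s_def by (rule synthesis_L2(2)[OF B c that])
  have "L2_inner s (cut_fmode u p m) = of_real p * c m" for m
  proof -
    have "((\<lambda>k. c k * cnj (if m = k then of_real p else 0)) has_sum L2_inner s (cut_fmode u p m)) UNIV"
      using ss[OF cut_fmode_L2, of u p m] by (simp add: cut_fmode_inner[OF p])
    then have "((\<lambda>k. c k * cnj (if m = k then of_real p else 0)) has_sum L2_inner s (cut_fmode u p m)) {m}"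
      by (rule has_sum_cong_neutral[THEN iffD1, rotated -1]) auto
    then show ?thesis by (auto dest: has_sum_unique[OF has_sum_finite[of "{m}"], rotated] simp: mult.commute)
  qed
  then have "L2_inner (\<lambda>x. of_real p * f x - s x) (cut_fmode u p m) = 0" for m
    by (simp add: L2_inner_diff_left L2_cmult f s cut_fmode_L2 L2_inner_cmult_left c_def)
  then have "AE x in lborel. x \<in> {u..<u+p} \<longrightarrow> of_real p * f x - s x = 0"
    by (intro cut_fmode_total[OF p L2_diff[OF L2_cmult[OF f] s]])
  then have "AE x in lborel. (of_real p * f x - s x) * cnj (h x) = 0"
    using hs by (rule AE_mp[OF _ AE_mp]) (auto intro!: AE_I2)
  then have "L2_inner (\<lambda>x. of_real p * f x - s x) h = 0"
    unfolding L2_inner_def by (rule integral_eq_zero_AE)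
  then have sh: "L2_inner s h = of_real p * L2_inner f h"
    by (simp add: L2_inner_diff_left L2_cmult f s h L2_inner_cmult_left)
  have coef: "L2_inner g (cut_fmode u p k) = (LINT x|lborel. g x * fmode p k x)"
    if g: "g \<in> L2" and gs: "AE x in lborel. x \<notin> {u..<u+p} \<longrightarrow> g x = 0" for g k
  proof -
    note [measurable] = L2_measurable[OF g]
    show ?thesis unfolding L2_inner_cut_fmode
      by (rule integral_cong_AE, measurable, rule AE_mp[OF gs]) (auto intro!: AE_I2 simp: indicator_def)
  qed
  show ?thesis using ss[OF h] unfolding sh c_def coef[OF f fs] coef[OF h hs] .
qed

lemma parseval_norm:
  assumes "p > 0" "f \<in> L2" "AE x in lborel. x \<notin> {u..<u+p} \<longrightarrow> f x = 0"
  shows "((\<lambda>k. (cmod (LINT x|lborel. f x * fmode p k x))\<^sup>2) has_sum p * (L2_norm f)\<^sup>2) UNIV"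
proof -
  have "((\<lambda>k. complex_of_real ((cmod (LINT x|lborel. f x * fmode p k x))\<^sup>2))
      has_sum complex_of_real (p * (L2_norm f)\<^sup>2)) UNIV"
    using parseval_interval[OF assms(1,2,2,3,3)]
    by (simp only: complex_norm_square L2_inner_self of_real_mult)
  then show ?thesis by (simp only: has_sum_of_real_iff)
qed

section \<open>Sums over the integers and periodization\<close>

lemma nn_integral_count_space_has_sum:
  fixes f :: "int \<Rightarrow> real"
  assumes s: "(f has_sum s) UNIV" and nn: "\<And>k. 0 \<le> f k"
  shows "(\<integral>\<^sup>+k. ennreal (f k) \<partial>count_space UNIV) = ennreal s"
proof -
  have "(\<lambda>k. norm (f k)) summable_on UNIV"
    using s nn by (simp add: has_sum_imp_summable)
  then have a: "Infinite_Set_Sum.abs_summable_on f UNIV"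
    using abs_summable_equivalent[of f UNIV] by blast
  then show ?thesis
    using nn by (simp add: nn_integral_conv_infsetsum infsetsum_infsum infsumI[OF s])
qed

lemma nn_integral_count_space_int_le:
  fixes f :: "int \<Rightarrow> ennreal"
  assumes "\<And>F. finite F \<Longrightarrow> (\<Sum>k\<in>F. f k) \<le> M"
  shows "(\<integral>\<^sup>+k. f k \<partial>count_space UNIV) \<le> M"
proof -
  have "(\<integral>\<^sup>+k. f k \<partial>count_space UNIV) = (\<Sum>n. f (int_decode n))"
    unfolding nn_integral_count_space_nat[symmetric]
    by (rule nn_integral_bij_count_space[symmetric]) (rule bij_int_decode)
  also have "\<dots> = (SUP n. \<Sum>i<n. f (int_decode i))" by (rule suminf_eq_SUP)
  also have "\<dots> \<le> M"
  proof (rule SUP_least)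
    fix n
    have "inj_on int_decode {..<n}" using bij_int_decode by (meson bij_is_inj inj_on_subset subset_UNIV)
    then have "(\<Sum>i<n. f (int_decode i)) = sum f (int_decode ` {..<n})"
      by (simp add: sum.reindex)
    then show "(\<Sum>i<n. f (int_decode i)) \<le> M" using assms by simp
  qed
  finally show ?thesis .
qed

text \<open>
  Each point lies in exactly one of the intervals \<open>[l p, (l + 1) p)\<close>; translate them all to
  \<open>[0, p)\<close>.
\<close>

lemma nn_integral_tiling:
  fixes u :: "real \<Rightarrow> ennreal" and p :: real
  assumes [measurable]: "u \<in> borel_measurable borel" and p: "p > 0"
  shows "(\<integral>\<^sup>+x. u x \<partial>lborel) =
    (\<integral>\<^sup>+x. (\<integral>\<^sup>+l. u (x + of_int l * p) * indicator {0..<p} x \<partial>count_space UNIV) \<partial>lborel)"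
proof -
  have one: "u x = (\<integral>\<^sup>+l. u x * indicator {0..<p} (x - of_int l * p) \<partial>count_space UNIV)" for x
  proof -
    have "indicator {0..<p} (x - of_int l * p) = (indicator {\<lfloor>x / p\<rfloor>} l :: ennreal)" for l :: int
    proof -
      have "x - of_int l * p \<in> {0..<p} \<longleftrightarrow> of_int l \<le> x / p \<and> x / p < of_int l + 1"
        using p by (auto simp: field_simps)
      also have "\<dots> \<longleftrightarrow> l = \<lfloor>x / p\<rfloor>" using floor_eq_iff[of "x / p" l] by auto
      finally show ?thesis by (auto simp: indicator_def)
    qed
    then show ?thesis by simp
  qed
  have "(\<integral>\<^sup>+x. u x \<partial>lborel) =
      (\<integral>\<^sup>+x. (\<integral>\<^sup>+l. u x * indicator {0..<p} (x - of_int l * p) \<partial>count_space UNIV) \<partial>lborel)"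
    by (rule nn_integral_cong) (rule one)
  also have "\<dots> = (\<integral>\<^sup>+l. (\<integral>\<^sup>+x. u x * indicator {0..<p} (x - of_int l * p) \<partial>lborel) \<partial>count_space UNIV)"
    by (rule nn_integral_count_space_nn_integral) auto
  also have "\<dots> = (\<integral>\<^sup>+l. (\<integral>\<^sup>+x. u (x + of_int l * p) * indicator {0..<p} x \<partial>lborel) \<partial>count_space UNIV)"
  proof (rule nn_integral_cong)
    fix l :: int
    show "(\<integral>\<^sup>+x. u x * indicator {0..<p} (x - of_int l * p) \<partial>lborel) =
        (\<integral>\<^sup>+x. u (x + of_int l * p) * indicator {0..<p} x \<partial>lborel)"
      by (subst nn_integral_real_affine[where c = 1 and t = "of_int l * p"]) (auto simp: add.commute)
  qed
  also have "\<dots> = (\<integral>\<^sup>+x. (\<integral>\<^sup>+l. u (x + of_int l * p) * indicator {0..<p} x \<partial>count_space UNIV) \<partial>lborel)"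
    by (rule nn_integral_count_space_nn_integral[symmetric]) auto
  finally show ?thesis .
qed

text \<open>
  A Bessel inequality for a function that need not be supported in one period. Let \<open>T\<close> be the
  trigonometric polynomial whose coefficients are the conjugates of those of \<open>G\<close>. Then
  \<open>\<Sum>|c k|\<^sup>2 = \<integral> G T\<close>, and writing \<open>|G| \<le> (|g| \<surd>w) \<surd>w\<close> the Cauchy-Schwarz inequality leaves the
  integral of \<open>w |T|\<^sup>2\<close>. As \<open>T\<close> is periodic, only the periodization of \<open>w\<close> enters there,
  which is at most \<open>M\<close>, so the integral is at most \<open>M p \<Sum>|c k|\<^sup>2\<close>.
\<close>

lemma coefficient_bound:
  assumes p: "p > 0" and G: "integrable lborel G"
    and [measurable]: "g \<in> borel_measurable borel" "w \<in> borel_measurable borel"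
    and w: "\<And>x. 0 \<le> w x"
    and Gle: "AE x in lborel. cmod (G x) \<le> cmod (g x) * w x"
    and M: "\<And>x F. finite F \<Longrightarrow> (\<Sum>l\<in>F. w (x + of_int l * p)) \<le> M"
    and gw: "integrable lborel (\<lambda>x. (cmod (g x))\<^sup>2 * w x)"
    and S: "finite S"
  shows "(\<Sum>k\<in>S. (cmod (LINT x|lborel. G x * fmode p k x))\<^sup>2)
    \<le> p * M * (LINT x|lborel. (cmod (g x))\<^sup>2 * w x)"
proof -
  have [measurable]: "G \<in> borel_measurable borel" using G by auto
  have M0: "M \<ge> 0" using M[of "{}"] by simp
  define c where "c k = (LINT x|lborel. G x * fmode p k x)" for k
  define s where "s = (\<Sum>k\<in>S. (cmod (c k))\<^sup>2)"
  have s: "s \<ge> 0" unfolding s_def by (intro sum_nonneg) auto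
  define T where "T x = (\<Sum>k\<in>S. cnj (c k) * fmode p k x)" for x
  have [measurable]: "T \<in> borel_measurable borel" unfolding T_def by measurable
  have Gh: "integrable lborel (\<lambda>x. G x * fmode p k x)" for k
    by (rule Bochner_Integration.integrable_bound[OF G]) (auto simp: norm_mult)
  have GTsum: "(\<lambda>x. G x * T x) = (\<lambda>x. \<Sum>k\<in>S. cnj (c k) * (G x * fmode p k x))"
    by (simp add: T_def sum_distrib_left mult.left_commute)
  have "(LINT x|lborel. G x * T x) = (\<Sum>k\<in>S. LINT x|lborel. cnj (c k) * (G x * fmode p k x))"
    unfolding GTsum by (rule Bochner_Integration.integral_sum) (use Gh in simp)
  also have "\<dots> = (\<Sum>k\<in>S. cnj (c k) * c k)"
    by (simp add: c_def)
  also have "\<dots> = of_real s"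
    unfolding s_def of_real_sum by (intro sum.cong refl) (simp only: complex_norm_square mult.commute)
  finally have GT: "(LINT x|lborel. G x * T x) = of_real s" .
  define g1 where "g1 x = complex_of_real (cmod (g x) * sqrt (w x))" for x :: real
  define T1 where "T1 x = complex_of_real (sqrt (w x)) * T x" for x
  have sqw: "(sqrt (w x))\<^sup>2 = w x" for x using w by simp
  have [measurable]: "g1 \<in> borel_measurable borel" unfolding g1_def by measurable
  have g1: "g1 \<in> L2"
    using gw w by (intro L2I) (simp_all add: g1_def norm_mult power_mult_distrib)
  have ng1: "(L2_norm g1)\<^sup>2 = (LINT x|lborel. (cmod (g x))\<^sup>2 * w x)"
    using w by (simp add: L2_norm_sq g1_def norm_mult power_mult_distrib)
  have period: "T (x + of_int l * p) = T x" for x l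
    using p by (simp add: T_def fmode_periodic)
  have TI: "(\<integral>\<^sup>+x. ennreal ((cmod (T x))\<^sup>2) * indicator {0..<p} x \<partial>lborel) \<le> ennreal (p * s)"
  proof -
    \<comment> \<open>the negated index undoes the sign convention of cut_fmode\<close>
    define u where "u = (\<lambda>x. \<Sum>k\<in>uminus ` S. cnj (c (- k)) * cut_fmode 0 p k x)"
    have u: "u \<in> L2" unfolding u_def by (intro L2_sum L2_cmult cut_fmode_L2)
    have uT: "u x = T x * indicator {0..<p} x" for x
      unfolding u_def T_def cut_fmode_def by (subst sum.reindex) (auto simp: sum_distrib_left sum_distrib_right mult_ac)
    have "(L2_norm u)\<^sup>2 \<le> p * (\<Sum>k\<in>uminus ` S. (cmod (cnj (c (- k))))\<^sup>2)"
      unfolding u_def using S by (intro bessel_finite_synthesis bessel_bound_cut_fmode p) auto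
    also have "(\<Sum>k\<in>uminus ` S. (cmod (cnj (c (- k))))\<^sup>2) = s"
      unfolding s_def by (subst sum.reindex) auto
    finally have "(\<integral>\<^sup>+x. ennreal ((cmod (u x))\<^sup>2) \<partial>lborel) \<le> ennreal (p * s)"
      unfolding nn_integral_cmod_sq[OF u] by (rule ennreal_leI)
    also have "(\<integral>\<^sup>+x. ennreal ((cmod (u x))\<^sup>2) \<partial>lborel)
        = (\<integral>\<^sup>+x. ennreal ((cmod (T x))\<^sup>2) * indicator {0..<p} x \<partial>lborel)"
      by (intro nn_integral_cong) (auto simp: uT indicator_def)
    finally show ?thesis .
  qed
  have "(\<integral>\<^sup>+x. ennreal ((cmod (T1 x))\<^sup>2) \<partial>lborel) = (\<integral>\<^sup>+x. ennreal (w x * (cmod (T x))\<^sup>2) \<partial>lborel)"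
    using w by (simp add: T1_def norm_mult power_mult_distrib)
  also have "\<dots> = (\<integral>\<^sup>+x. (\<integral>\<^sup>+l. ennreal (w (x + of_int l * p) * (cmod (T (x + of_int l * p)))\<^sup>2)
      * indicator {0..<p} x \<partial>count_space UNIV) \<partial>lborel)"
    by (rule nn_integral_tiling[OF _ p]) measurable
  also have "\<dots> \<le> (\<integral>\<^sup>+x. ennreal M * (ennreal ((cmod (T x))\<^sup>2) * indicator {0..<p} x) \<partial>lborel)"
  proof (rule nn_integral_mono)
    fix x
    have "(\<integral>\<^sup>+l. ennreal (w (x + of_int l * p) * (cmod (T (x + of_int l * p)))\<^sup>2)
          * indicator {0..<p} x \<partial>count_space UNIV)
        = (\<integral>\<^sup>+l. ennreal (w (x + of_int l * p)) * (ennreal ((cmod (T x))\<^sup>2) * indicator {0..<p} x) \<partial>count_space UNIV)"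
      by (simp add: period ennreal_mult w mult.assoc)
    also have "\<dots> = (\<integral>\<^sup>+l. ennreal (w (x + of_int l * p)) \<partial>count_space UNIV) * (ennreal ((cmod (T x))\<^sup>2) * indicator {0..<p} x)"
      by (rule nn_integral_multc) auto
    also have "\<dots> \<le> ennreal M * (ennreal ((cmod (T x))\<^sup>2) * indicator {0..<p} x)"
    proof (intro mult_right_mono nn_integral_count_space_int_le)
      fix F :: "int set" assume "finite F"
      then show "(\<Sum>l\<in>F. ennreal (w (x + of_int l * p))) \<le> ennreal M"
        using M[of F x] w by (subst sum_ennreal) (auto intro: ennreal_leI)
    qed auto
    finally show "(\<integral>\<^sup>+l. ennreal (w (x + of_int l * p) * (cmod (T (x + of_int l * p)))\<^sup>2)
        * indicator {0..<p} x \<partial>count_space UNIV)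
      \<le> ennreal M * (ennreal ((cmod (T x))\<^sup>2) * indicator {0..<p} x)" .
  qed
  also have "\<dots> = ennreal M * (\<integral>\<^sup>+x. ennreal ((cmod (T x))\<^sup>2) * indicator {0..<p} x \<partial>lborel)"
    by (rule nn_integral_cmult) measurable
  also have "\<dots> \<le> ennreal M * ennreal (p * s)"
    by (intro mult_left_mono TI) auto
  also have "\<dots> = ennreal ((sqrt (M * (p * s)))\<^sup>2)"
    using M0 p s by (simp add: ennreal_mult)
  finally have T1le: "(\<integral>\<^sup>+x. ennreal ((cmod (T1 x))\<^sup>2) \<partial>lborel) \<le> ennreal ((sqrt (M * (p * s)))\<^sup>2)" .
  have [measurable]: "T1 \<in> borel_measurable borel" unfolding T1_def by measurable
  have T1: "T1 \<in> L2" "L2_norm T1 \<le> sqrt (M * (p * s))"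
    using L2_from_nn_integral[OF _ T1le] M0 p s by auto
  have "s = cmod (LINT x|lborel. G x * T x)" using GT s by simp
  also have "\<dots> \<le> (LINT x|lborel. cmod (g1 x) * cmod (T1 x))"
  proof -
    have GTint: "integrable lborel (\<lambda>x. G x * T x)"
      unfolding GTsum using Gh by simp
    have "cmod (LINT x|lborel. G x * T x) \<le> (LINT x|lborel. cmod (G x * T x))"
      by (rule integral_norm_bound)
    also have "\<dots> \<le> (LINT x|lborel. cmod (g1 x) * cmod (T1 x))"
    proof (rule integral_mono_AE)
      show "integrable lborel (\<lambda>x. cmod (G x * T x))" using GTint by simp
      show "integrable lborel (\<lambda>x. cmod (g1 x) * cmod (T1 x))" by (rule integrable_cmod_mult[OF g1 T1(1)])
      show "AE x in lborel. cmod (G x * T x) \<le> cmod (g1 x) * cmod (T1 x)"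
        using Gle
      proof (rule AE_mp, intro AE_I2 impI)
        fix x assume le: "cmod (G x) \<le> cmod (g x) * w x"
        have "cmod (g1 x) * cmod (T1 x) = cmod (g x) * (sqrt (w x))\<^sup>2 * cmod (T x)"
          using w[of x] unfolding g1_def T1_def by (simp add: norm_mult power2_eq_square)
        then have "cmod (g1 x) * cmod (T1 x) = cmod (g x) * w x * cmod (T x)"
          by (simp only: sqw)
        then show "cmod (G x * T x) \<le> cmod (g1 x) * cmod (T1 x)"
          using le by (simp add: norm_mult mult_right_mono)
      qed
    qed
    finally show ?thesis .
  qed
  also have "\<dots> \<le> L2_norm g1 * L2_norm T1" by (rule integral_cmod_mult_le[OF g1 T1(1)])
  also have "\<dots> \<le> L2_norm g1 * sqrt (M * (p * s))" by (intro mult_left_mono T1) auto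
  finally have "s\<^sup>2 \<le> (L2_norm g1 * sqrt (M * (p * s)))\<^sup>2" using s by (intro power_mono)
  also have "\<dots> = s * (p * M * (L2_norm g1)\<^sup>2)"
    using M0 p s by (simp add: power_mult_distrib)
  finally have "s * s \<le> s * (p * M * (L2_norm g1)\<^sup>2)" by (simp add: power2_eq_square)
  then have "s \<le> p * M * (L2_norm g1)\<^sup>2"
    using s M0 p by (cases "s = 0") (auto simp: mult_le_cancel_left)
  then show ?thesis unfolding s_def c_def ng1 .
qed

section \<open>Plancherel's theorem for integrable functions\<close>

lemma fourier_kernel: "exp (complex_of_real (- 2 * pi) * \<i> * complex_of_real x * complex_of_real \<gamma>) = cis (- (2 * pi * x * \<gamma>))"
  by (simp add: cis_conv_exp mult_ac)

lemma fourier_L1_cis: "fourier_L1 f \<gamma> = (LINT x|lborel. f x * cis (- (2 * pi * x * \<gamma>)))"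
  unfolding fourier_L1_def by (simp only: fourier_kernel)

lemma fourier_L1_measurable [measurable]:
  assumes [measurable]: "f \<in> borel_measurable borel"
  shows "fourier_L1 f \<in> borel_measurable borel"
  unfolding fourier_L1_cis[abs_def]
  by (rule sigma_finite_measure.borel_measurable_lebesgue_integral[OF sigma_finite_lborel]) measurable

lemma integrable_mult_cis:
  assumes "integrable lborel f" and [measurable]: "m \<in> borel_measurable borel"
  shows "integrable lborel (\<lambda>x. f x * cis (m x))"
  using assms(1) by (intro Bochner_Integration.integrable_bound[OF assms(1)]) (auto simp: norm_mult)

lemma fourier_L1_diff:
  "integrable lborel f \<Longrightarrow> integrable lborel g \<Longrightarrow>
    fourier_L1 (\<lambda>x. f x - g x) \<gamma> = fourier_L1 f \<gamma> - fourier_L1 g \<gamma>"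
  by (simp add: fourier_L1_cis left_diff_distrib integrable_mult_cis)

lemma fourier_L1_cmult: "fourier_L1 (\<lambda>x. c * f x) \<gamma> = c * fourier_L1 f \<gamma>"
  by (simp add: fourier_L1_cis mult.assoc)

text \<open>
  Parseval's identity for \<open>f\<close> times the exponential of frequency \<open>-t\<close> says that the values of
  \<open>|\<F> f|\<^sup>2\<close> on the shifted lattice \<open>t + \<int> / L\<close> have sum \<open>L \<parallel>f\<parallel>\<^sup>2\<close>, whatever \<open>t\<close> is. Integrating over \<open>t\<close>
  in a period of length \<open>1 / L\<close> gives the integral of \<open>|\<F> f|\<^sup>2\<close> over the line.
\<close>

lemma plancherel_compact:
  assumes L: "L > 0" and f: "f \<in> L2" and supp: "\<And>x. x \<notin> {u..<u+L} \<Longrightarrow> f x = 0"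
  shows "fourier_L1 f \<in> L2" "L2_norm (fourier_L1 f) = L2_norm f"
proof -
  note [measurable] = L2_measurable[OF f]
  have inner: "(\<integral>\<^sup>+l. ennreal ((cmod (fourier_L1 f (t + of_int l * (1 / L))))\<^sup>2) \<partial>count_space UNIV)
      = ennreal (L * (L2_norm f)\<^sup>2)" for t
  proof -
    define G where "G x = f x * cis (- (2 * pi * x * t))" for x
    have G: "G \<in> L2" unfolding G_def by (rule L2_mult_bounded[OF f, where M = 1]) auto
    have nG: "L2_norm G = L2_norm f" by (simp add: L2_norm_def G_def norm_mult)
    have "((\<lambda>k. (cmod (LINT x|lborel. G x * fmode L k x))\<^sup>2) has_sum L * (L2_norm G)\<^sup>2) UNIV"
      by (rule parseval_norm[OF L G, of u]) (use supp in \<open>simp add: G_def\<close>)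
    then have "(\<integral>\<^sup>+k. ennreal ((cmod (LINT x|lborel. G x * fmode L k x))\<^sup>2) \<partial>count_space UNIV) = ennreal (L * (L2_norm G)\<^sup>2)"
      by (rule nn_integral_count_space_has_sum) simp
    also have "(\<integral>\<^sup>+k. ennreal ((cmod (LINT x|lborel. G x * fmode L k x))\<^sup>2) \<partial>count_space UNIV)
        = (\<integral>\<^sup>+l. ennreal ((cmod (LINT x|lborel. G x * fmode L (- l) x))\<^sup>2) \<partial>count_space UNIV)"
      by (rule nn_integral_bij_count_space[symmetric]) (simp add: bij_uminus)
    also have "(\<lambda>l. LINT x|lborel. G x * fmode L (- l) x) = (\<lambda>l. fourier_L1 f (t + of_int l * (1 / L)))"
      unfolding fourier_L1_cis G_def fmode_def mult.assoc cis_mult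
      by (intro ext Bochner_Integration.integral_cong refl arg_cong2[where f = "(*)"] arg_cong[where f = cis])
         (simp add: algebra_simps)
    finally show ?thesis using nG by simp
  qed
  have "(\<integral>\<^sup>+\<gamma>. ennreal ((cmod (fourier_L1 f \<gamma>))\<^sup>2) \<partial>lborel) =
     (\<integral>\<^sup>+t. (\<integral>\<^sup>+l. ennreal ((cmod (fourier_L1 f (t + of_int l * (1 / L))))\<^sup>2) * indicator {0..<1/L} t
        \<partial>count_space UNIV) \<partial>lborel)"
    using L by (intro nn_integral_tiling) auto
  also have "\<dots> = (\<integral>\<^sup>+t. ennreal (L * (L2_norm f)\<^sup>2) * indicator {0..<1/L} t \<partial>lborel)"
  proof (rule nn_integral_cong)
    fix t
    show "(\<integral>\<^sup>+l. ennreal ((cmod (fourier_L1 f (t + of_int l * (1 / L))))\<^sup>2) * indicator {0..<1/L} t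
        \<partial>count_space UNIV) = ennreal (L * (L2_norm f)\<^sup>2) * indicator {0..<1/L} t"
      by (subst nn_integral_multc, simp) (simp only: inner)
  qed
  also have "\<dots> = ennreal (L * (L2_norm f)\<^sup>2) * ennreal (1 / L)"
    using L by (simp add: nn_integral_cmult)
  also have "\<dots> = ennreal ((L2_norm f)\<^sup>2)"
    using L by (simp flip: ennreal_mult)
  finally have eq: "(\<integral>\<^sup>+\<gamma>. ennreal ((cmod (fourier_L1 f \<gamma>))\<^sup>2) \<partial>lborel) = ennreal ((L2_norm f)\<^sup>2)" .
  show FL2: "fourier_L1 f \<in> L2"
    by (rule L2_from_nn_integral(1)[OF _ eq_refl[OF eq]]) auto
  have "(L2_norm (fourier_L1 f))\<^sup>2 = (L2_norm f)\<^sup>2"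
    using eq unfolding nn_integral_cmod_sq[OF FL2] by simp
  then show "L2_norm (fourier_L1 f) = L2_norm f"
    by (simp add: power2_eq_iff_nonneg)
qed

text \<open>
  The upper end point is written as lower end point plus length because the results on
  Fourier series speak about intervals of that form.
\<close>

definition trunc :: "nat \<Rightarrow> (real \<Rightarrow> complex) \<Rightarrow> real \<Rightarrow> complex" where
  "trunc n f x = f x * indicator {- real n..<- real n + (2 * real n + 1)} x"

lemma trunc_L2: "f \<in> L2 \<Longrightarrow> trunc n f \<in> L2"
  unfolding trunc_def by (rule L2_mult_indicator) auto

lemma trunc_integrable: "f \<in> L2 \<Longrightarrow> integrable lborel (trunc n f)"
  unfolding trunc_def by (rule integrable_mult_L2[OF _ interval_indicator_L2])

lemma trunc_eventually: "eventually (\<lambda>n. trunc n f x = f x) sequentially"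
proof -
  obtain N where N: "\<bar>x\<bar> < real N" using reals_Archimedean2 by blast
  show ?thesis
    using eventually_ge_at_top[of N]
    by eventually_elim (use N in \<open>auto simp: trunc_def indicator_def\<close>)
qed

lemma norm_trunc_le: "cmod (trunc n f x) \<le> cmod (f x)"
  by (simp add: trunc_def indicator_def)

lemma trunc_tendsto:
  assumes f: "f \<in> L2"
  shows "L2_tendsto (\<lambda>n. trunc n f) f sequentially"
proof -
  note [measurable] = L2_measurable[OF f] L2_measurable[OF trunc_L2[OF f]]
  have "(\<lambda>n. LINT x|lborel. (cmod (trunc n f x - f x))\<^sup>2) \<longlonglongrightarrow> integral\<^sup>L lborel (\<lambda>x::real. 0)"
  proof (rule integral_dominated_convergence)
    show "integrable lborel (\<lambda>x. (cmod (f x))\<^sup>2)" by (rule L2_integrable[OF f])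
    show "AE x in lborel. norm ((cmod (trunc n f x - f x))\<^sup>2) \<le> (cmod (f x))\<^sup>2" for n
      by (rule AE_I2) (simp add: trunc_def indicator_def)
    show "AE x in lborel. (\<lambda>n. (cmod (trunc n f x - f x))\<^sup>2) \<longlonglongrightarrow> 0"
    proof (rule AE_I2)
      fix x show "(\<lambda>n. (cmod (trunc n f x - f x))\<^sup>2) \<longlonglongrightarrow> 0"
        by (rule tendsto_eventually) (rule eventually_mono[OF trunc_eventually[of f x]], simp)
    qed
  qed measurable
  then have "(\<lambda>n. sqrt (LINT x|lborel. (cmod (trunc n f x - f x))\<^sup>2)) \<longlonglongrightarrow> sqrt 0"
    by (intro tendsto_real_sqrt) simp
  then have "(\<lambda>n. L2_norm (\<lambda>x. trunc n f x - f x)) \<longlonglongrightarrow> 0" by (simp add: L2_norm_def)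
  then show ?thesis using trunc_L2[OF f] f by (simp add: L2_tendsto_def)
qed

lemma L2_tendsto_norm:
  assumes "L2_tendsto h g flt"
  shows "((\<lambda>i. L2_norm (h i)) \<longlongrightarrow> L2_norm g) flt"
proof -
  have hi: "h i \<in> L2" "g \<in> L2" and lim: "((\<lambda>i. L2_norm (\<lambda>x. h i x - g x)) \<longlongrightarrow> 0) flt" for i
    using assms by (auto simp: L2_tendsto_def)
  have bd: "norm (L2_norm (h i) - L2_norm g) \<le> L2_norm (\<lambda>x. h i x - g x)" for i
    using L2_norm_triangle[OF L2_diff[OF hi(1) hi(2)] hi(2), of i]
      L2_norm_triangle[OF L2_diff[OF hi(2) hi(1)[of i]] hi(1)[of i]]
    by (simp add: L2_norm_minus_commute[of g])
  have "((\<lambda>i. L2_norm (h i) - L2_norm g) \<longlongrightarrow> 0) flt"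
    by (rule Lim_null_comparison[OF always_eventually lim]) (use bd in blast)
  then show ?thesis by (simp add: LIM_zero_iff)
qed

lemma plancherel_trunc:
  assumes f: "f \<in> L2"
  shows "fourier_L1 (trunc n f) \<in> L2" "L2_norm (fourier_L1 (trunc n f)) = L2_norm (trunc n f)"
    "L2_norm (\<lambda>\<gamma>. fourier_L1 (trunc n f) \<gamma> - fourier_L1 (trunc m f) \<gamma>) = L2_norm (\<lambda>x. trunc n f x - trunc m f x)"
proof -
  show "fourier_L1 (trunc n f) \<in> L2" "L2_norm (fourier_L1 (trunc n f)) = L2_norm (trunc n f)"
    by (rule plancherel_compact[OF _ trunc_L2[OF f], of "2 * real n + 1" "- real n"]; simp add: trunc_def)+
  have "L2_norm (fourier_L1 (\<lambda>x. trunc n f x - trunc m f x)) = L2_norm (\<lambda>x. trunc n f x - trunc m f x)"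
    by (rule plancherel_compact(2)[OF _ L2_diff[OF trunc_L2[OF f] trunc_L2[OF f]],
          of "2 * real (max m n) + 1" "- real (max m n)"]) (auto simp: trunc_def indicator_def)
  then show "L2_norm (\<lambda>\<gamma>. fourier_L1 (trunc n f) \<gamma> - fourier_L1 (trunc m f) \<gamma>) = L2_norm (\<lambda>x. trunc n f x - trunc m f x)"
    unfolding fourier_L1_diff[OF trunc_integrable[OF f] trunc_integrable[OF f], abs_def] .
qed

text \<open>
  The truncations converge to \<open>f\<close> in norm and their transforms converge pointwise to that of
  \<open>f\<close>, by dominated convergence. The differences of the transforms have the norms of the
  differences of the truncations, so Fatou's lemma gives convergence of the transforms in norm.
\<close>

lemma plancherel_L1:
  assumes f: "f \<in> L2" and fi: "integrable lborel f"
  shows "fourier_L1 f \<in> L2" "L2_norm (fourier_L1 f) = L2_norm f"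
proof -
  note [measurable] = L2_measurable[OF f] L2_measurable[OF trunc_L2[OF f]]
  have lim: "(\<lambda>n. fourier_L1 (trunc n f) \<gamma>) \<longlonglongrightarrow> fourier_L1 f \<gamma>" for \<gamma>
    unfolding fourier_L1_cis
  proof (rule integral_dominated_convergence)
    show "integrable lborel (\<lambda>x. cmod (f x))" using fi by simp
    show "AE x in lborel. norm (trunc n f x * cis (- (2 * pi * x * \<gamma>))) \<le> cmod (f x)" for n
      by (rule AE_I2) (simp add: norm_mult norm_trunc_le)
    show "AE x in lborel. (\<lambda>n. trunc n f x * cis (- (2 * pi * x * \<gamma>))) \<longlonglongrightarrow> f x * cis (- (2 * pi * x * \<gamma>))"
    proof (rule AE_I2)
      fix x show "(\<lambda>n. trunc n f x * cis (- (2 * pi * x * \<gamma>))) \<longlonglongrightarrow> f x * cis (- (2 * pi * x * \<gamma>))"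
        by (rule tendsto_eventually) (rule eventually_mono[OF trunc_eventually[of f x]], simp)
    qed
  qed measurable
  note tL2 = trunc_L2[OF f] and PL = plancherel_trunc[OF f]
  have d: "(\<lambda>\<gamma>. fourier_L1 (trunc n f) \<gamma> - fourier_L1 f \<gamma>) \<in> L2"
    "L2_norm (\<lambda>\<gamma>. fourier_L1 (trunc n f) \<gamma> - fourier_L1 f \<gamma>) \<le> L2_norm (\<lambda>x. trunc n f x - f x)" for n
  proof -
    have 1: "(\<lambda>\<gamma>. fourier_L1 (trunc n f) \<gamma> - fourier_L1 (trunc m f) \<gamma>) \<in> L2" for m
      by (intro L2_diff PL(1))
    have 2: "AE \<gamma> in lborel. (\<lambda>m. fourier_L1 (trunc n f) \<gamma> - fourier_L1 (trunc m f) \<gamma>)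
        \<longlonglongrightarrow> fourier_L1 (trunc n f) \<gamma> - fourier_L1 f \<gamma>"
      by (intro AE_I2 tendsto_diff tendsto_const lim)
    have 3: "eventually (\<lambda>m. L2_norm (\<lambda>\<gamma>. fourier_L1 (trunc n f) \<gamma> - fourier_L1 (trunc m f) \<gamma>)
        \<le> L2_norm (\<lambda>x. trunc n f x - f x)) sequentially"
      using eventually_ge_at_top[of n]
    proof eventually_elim
      case (elim m)
      have "(L2_norm (\<lambda>x. trunc n f x - trunc m f x))\<^sup>2 \<le> (L2_norm (\<lambda>x. trunc n f x - f x))\<^sup>2"
        unfolding L2_norm_sq
        by (rule integral_mono[OF L2_integrable[OF L2_diff[OF tL2 tL2]] L2_integrable[OF L2_diff[OF tL2 f]]])
           (use elim in \<open>auto simp: trunc_def indicator_def\<close>)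
      then show ?case unfolding PL(3) by (rule power2_le_imp_le) simp
    qed
    show "(\<lambda>\<gamma>. fourier_L1 (trunc n f) \<gamma> - fourier_L1 f \<gamma>) \<in> L2"
      "L2_norm (\<lambda>\<gamma>. fourier_L1 (trunc n f) \<gamma> - fourier_L1 f \<gamma>) \<le> L2_norm (\<lambda>x. trunc n f x - f x)"
      using L2_Fatou[OF 1 _ 2 3] by simp_all
  qed
  show F: "fourier_L1 f \<in> L2" using L2_diff[OF PL(1) d(1), of 0 0] by simp
  have lim0: "(\<lambda>n. L2_norm (\<lambda>x. trunc n f x - f x)) \<longlonglongrightarrow> 0"
    using trunc_tendsto[OF f] by (simp add: L2_tendsto_def)
  have "(\<lambda>n. L2_norm (\<lambda>\<gamma>. fourier_L1 (trunc n f) \<gamma> - fourier_L1 f \<gamma>)) \<longlonglongrightarrow> 0"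
    by (rule Lim_null_comparison[OF always_eventually lim0]) (use d(2) in simp)
  then have "L2_tendsto (\<lambda>n. fourier_L1 (trunc n f)) (fourier_L1 f) sequentially"
    using PL(1) F by (simp add: L2_tendsto_def)
  then have "(\<lambda>n. L2_norm (trunc n f)) \<longlonglongrightarrow> L2_norm (fourier_L1 f)"
    using L2_tendsto_norm PL(2) by fastforce
  then show "L2_norm (fourier_L1 f) = L2_norm f"
    using L2_tendsto_norm[OF trunc_tendsto[OF f]] LIMSEQ_unique by blast
qed

section \<open>The Fourier transform on the space of square-integrable functions\<close>

text \<open>
  The relation whose Hilbert choice is \<^const>\<open>fourier_L2\<close>. Working with the relation lets identities
  pass to the limit before a representative is picked.
\<close>

definition is_FT :: "(real \<Rightarrow> complex) \<Rightarrow> (real \<Rightarrow> complex) \<Rightarrow> bool" where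
  "is_FT f g \<longleftrightarrow> (\<exists>h. (\<forall>n::nat. integrable lborel (h n)) \<and>
     L2_tendsto h f sequentially \<and> L2_tendsto (\<lambda>n. fourier_L1 (h n)) g sequentially)"

lemma is_FT_L2: "is_FT f g \<Longrightarrow> f \<in> L2" "is_FT f g \<Longrightarrow> g \<in> L2"
  by (auto simp: is_FT_def L2_tendsto_def)

lemma is_FT_exists:
  assumes f: "f \<in> L2"
  shows "\<exists>g. is_FT f g"
proof -
  note PL = plancherel_trunc[OF f] and tf = trunc_tendsto[OF f]
  have tL2: "trunc n f \<in> L2" for n by (rule trunc_L2[OF f])
  have lim0: "(\<lambda>n. L2_norm (\<lambda>x. trunc n f x - f x)) \<longlonglongrightarrow> 0"
    using tf by (simp add: L2_tendsto_def)
  have "\<exists>N. \<forall>m\<ge>N. \<forall>n\<ge>N. L2_norm (\<lambda>\<gamma>. fourier_L1 (trunc m f) \<gamma> - fourier_L1 (trunc n f) \<gamma>) < e"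
    if e: "e > 0" for e
  proof -
    obtain N where N: "\<And>n. n \<ge> N \<Longrightarrow> L2_norm (\<lambda>x. trunc n f x - f x) < e / 2"
      using LIMSEQ_D[OF lim0, of "e / 2"] e by auto
    have "L2_norm (\<lambda>x. trunc m f x - trunc n f x) < e" if "m \<ge> N" "n \<ge> N" for m n
      using L2_norm_triangle_sub[OF tL2[of m] f tL2[of n]] N[OF that(1)] N[OF that(2)]
      by (simp add: L2_norm_minus_commute[of f])
    then show ?thesis unfolding PL(3) by blast
  qed
  then obtain g where "g \<in> L2" "(\<lambda>n. L2_norm (\<lambda>\<gamma>. fourier_L1 (trunc n f) \<gamma> - g \<gamma>)) \<longlonglongrightarrow> 0"
    using L2_complete[of "\<lambda>n. fourier_L1 (trunc n f)"] PL(1) by blast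
  then have "L2_tendsto (\<lambda>n. fourier_L1 (trunc n f)) g sequentially"
    using PL(1) by (simp add: L2_tendsto_def)
  then show ?thesis using tf trunc_integrable[OF f] unfolding is_FT_def
    by (intro exI[of _ g] exI[of _ "\<lambda>n. trunc n f"]) simp
qed

abbreviation (input) FT ("\<F>") where "\<F> \<equiv> fourier_L2"

lemma is_FT_fourier_L2: "f \<in> L2 \<Longrightarrow> is_FT f (\<F> f)"
  using someI_ex[OF is_FT_exists] unfolding fourier_L2_def is_FT_def by blast

lemma is_FT_norm:
  assumes "is_FT f g"
  shows "L2_norm g = L2_norm f"
proof -
  obtain h where h: "\<And>n. integrable lborel (h n)" "L2_tendsto h f sequentially"
    "L2_tendsto (\<lambda>n. fourier_L1 (h n)) g sequentially"
    using assms unfolding is_FT_def by blast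
  have "h n \<in> L2" for n using h(2) by (simp add: L2_tendsto_def)
  then have "(\<lambda>n. L2_norm (h n)) \<longlonglongrightarrow> L2_norm g"
    using L2_tendsto_norm[OF h(3)] plancherel_L1(2) h(1) by simp
  then show ?thesis using L2_tendsto_norm[OF h(2)] LIMSEQ_unique by blast
qed

lemma L2_tendsto_add:
  assumes h: "L2_tendsto h f flt" and k: "L2_tendsto k g flt"
  shows "L2_tendsto (\<lambda>i x. h i x + k i x) (\<lambda>x. f x + g x) flt"
proof -
  have L: "h i \<in> L2" "f \<in> L2" "k i \<in> L2" "g \<in> L2" for i using h k by (auto simp: L2_tendsto_def)
  have l: "((\<lambda>i. L2_norm (\<lambda>x. h i x - f x) + L2_norm (\<lambda>x. k i x - g x)) \<longlongrightarrow> 0) flt"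
    using h k by (auto simp: L2_tendsto_def intro: tendsto_add_zero)
  have b: "norm (L2_norm (\<lambda>x. (h i x + k i x) - (f x + g x))) \<le> L2_norm (\<lambda>x. h i x - f x) + L2_norm (\<lambda>x. k i x - g x)" for i
    using L2_norm_triangle[OF L2_diff[OF L(1,2)] L2_diff[OF L(3,4)], of i i] by (simp add: algebra_simps)
  have "((\<lambda>i. L2_norm (\<lambda>x. (h i x + k i x) - (f x + g x))) \<longlongrightarrow> 0) flt"
    by (rule Lim_null_comparison[OF always_eventually l]) (use b in blast)
  then show ?thesis using L by (simp add: L2_tendsto_def L2_add)
qed

lemma L2_tendsto_cmult:
  assumes h: "L2_tendsto h f flt"
  shows "L2_tendsto (\<lambda>i x. c * h i x) (\<lambda>x. c * f x) flt"
proof -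
  have "((\<lambda>i. cmod c * L2_norm (\<lambda>x. h i x - f x)) \<longlongrightarrow> 0) flt"
    using h by (intro tendsto_mult_right_zero) (simp add: L2_tendsto_def)
  then show ?thesis using h
    by (simp add: L2_tendsto_def L2_cmult right_diff_distrib[symmetric] L2_norm_cmult)
qed

lemma fourier_L1_add:
  "integrable lborel f \<Longrightarrow> integrable lborel g \<Longrightarrow>
    fourier_L1 (\<lambda>x. f x + g x) \<gamma> = fourier_L1 f \<gamma> + fourier_L1 g \<gamma>"
  by (simp add: fourier_L1_cis distrib_right integrable_mult_cis)

lemma is_FT_linear:
  assumes "is_FT f g" "is_FT f' g'"
  shows "is_FT (\<lambda>x. f x + c * f' x) (\<lambda>x. g x + c * g' x)"
proof -
  obtain h where h: "\<And>n. integrable lborel (h n)" "L2_tendsto h f sequentially"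
    "L2_tendsto (\<lambda>n. fourier_L1 (h n)) g sequentially"
    using assms(1) unfolding is_FT_def by blast
  obtain h' where h': "\<And>n. integrable lborel (h' n)" "L2_tendsto h' f' sequentially"
    "L2_tendsto (\<lambda>n. fourier_L1 (h' n)) g' sequentially"
    using assms(2) unfolding is_FT_def by blast
  have "fourier_L1 (\<lambda>x. h n x + c * h' n x) = (\<lambda>\<gamma>. fourier_L1 (h n) \<gamma> + c * fourier_L1 (h' n) \<gamma>)" for n
    using h(1) h'(1) by (auto simp: fourier_L1_add fourier_L1_cmult)
  then show ?thesis
    unfolding is_FT_def using h h'
    by (intro exI[of _ "\<lambda>n x. h n x + c * h' n x"]) (auto intro: L2_tendsto_add L2_tendsto_cmult)
qed

lemma is_FT_unique:
  assumes "is_FT f g" "is_FT f' g'" and ff: "AE x in lborel. f x = f' x"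
  shows "AE x in lborel. g x = g' x"
proof -
  have "is_FT (\<lambda>x. f x + (-1) * f' x) (\<lambda>x. g x + (-1) * g' x)"
    by (rule is_FT_linear[OF assms(1,2)])
  then have d: "is_FT (\<lambda>x. f x - f' x) (\<lambda>x. g x - g' x)" by simp
  have "L2_norm (\<lambda>x. f x - f' x) = L2_norm (\<lambda>x. 0)"
    using ff by (intro L2_norm_cong_AE is_FT_L2[OF d]) auto
  then have "L2_norm (\<lambda>x. g x - g' x) = 0"
    using is_FT_norm[OF d] by (simp add: L2_norm_def)
  then have "AE x in lborel. g x - g' x = 0"
    by (rule L2_norm_eq_0_AE[OF is_FT_L2(2)[OF d]])
  then show ?thesis by simp
qed

lemma fourier_L2_L2: "f \<in> L2 \<Longrightarrow> \<F> f \<in> L2"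
  by (rule is_FT_L2[OF is_FT_fourier_L2])

lemma fourier_L2_norm: "f \<in> L2 \<Longrightarrow> L2_norm (\<F> f) = L2_norm f"
  by (rule is_FT_norm[OF is_FT_fourier_L2])

lemma fourier_L2_AE: "is_FT f g \<Longrightarrow> AE x in lborel. \<F> f x = g x"
  by (rule is_FT_unique[OF is_FT_fourier_L2]) (auto dest: is_FT_L2)

lemma is_FT_inner_Re:
  assumes "is_FT f g" "is_FT f' g'"
  shows "Re (L2_inner g g') = Re (L2_inner f f')"
proof -
  have d: "is_FT (\<lambda>x. f x - f' x) (\<lambda>x. g x - g' x)"
    using is_FT_linear[OF assms, of "-1"] by simp
  show ?thesis
    using is_FT_norm[OF d] is_FT_norm[OF assms(1)] is_FT_norm[OF assms(2)]
      L2_norm_diff_sq[OF is_FT_L2(1)[OF assms(1)] is_FT_L2(1)[OF assms(2)]]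
      L2_norm_diff_sq[OF is_FT_L2(2)[OF assms(1)] is_FT_L2(2)[OF assms(2)]] by simp
qed

lemma is_FT_zero: "is_FT (\<lambda>x. 0) (\<lambda>x. 0)"
proof -
  obtain g where g: "is_FT (\<lambda>x. 0) g" using is_FT_exists[of "\<lambda>x. 0"] by auto
  from is_FT_linear[OF g g, of "-1"] show ?thesis by simp
qed

lemma is_FT_cmult: "is_FT f g \<Longrightarrow> is_FT (\<lambda>x. c * f x) (\<lambda>x. c * g x)"
  using is_FT_linear[OF is_FT_zero, of f g c] by simp

text \<open>
  Polarization: the real part is determined by norms of differences, and the imaginary part is
  the real part after multiplication by \<open>-\<i>\<close>.
\<close>

lemma is_FT_inner:
  assumes "is_FT f g" "is_FT f' g'"
  shows "L2_inner g g' = L2_inner f f'"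
  using is_FT_inner_Re[OF assms] is_FT_inner_Re[OF is_FT_cmult[OF assms(1), of "- \<i>"] assms(2)]
  unfolding L2_inner_cmult_left by (simp add: complex_eq_iff)

lemma fourier_L2_inner: "f \<in> L2 \<Longrightarrow> g \<in> L2 \<Longrightarrow> L2_inner (\<F> f) (\<F> g) = L2_inner f g"
  by (rule is_FT_inner[OF is_FT_fourier_L2 is_FT_fourier_L2])

section \<open>Affine changes of variable and inversion\<close>

lemma fourier_L1_multiplication:
  assumes f: "integrable lborel f" and g: "integrable lborel g"
  shows "(LINT x|lborel. fourier_L1 f x * g x) = (LINT x|lborel. f x * fourier_L1 g x)"
proof -
  have [measurable]: "f \<in> borel_measurable borel" "g \<in> borel_measurable borel" using f g by auto
  have int: "integrable (lborel \<Otimes>\<^sub>M lborel) (\<lambda>(x, y). f x * g y * cis (- (2 * pi * x * y)))"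
  proof (rule lborel_pair.Fubini_integrable)
    show "(\<lambda>(x, y). f x * g y * cis (- (2 * pi * x * y))) \<in> borel_measurable (lborel \<Otimes>\<^sub>M lborel)"
      by measurable
    have "integrable lborel (\<lambda>x. cmod (f x) * (LINT y|lborel. cmod (g y)))"
      using f by simp
    then show "integrable lborel (\<lambda>x. LINT y|lborel. norm (case (x, y) of (x, y) \<Rightarrow> f x * g y * cis (- (2 * pi * x * y))))"
      by (simp add: norm_mult)
    show "AE x in lborel. integrable lborel (\<lambda>y. case (x, y) of (x, y) \<Rightarrow> f x * g y * cis (- (2 * pi * x * y)))"
      using g by (auto intro!: integrable_mult_cis)
  qed
  have "(LINT y|lborel. fourier_L1 f y * g y) = (LINT y|lborel. LINT x|lborel. f x * g y * cis (- (2 * pi * x * y)))"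
    unfolding fourier_L1_cis Bochner_Integration.integral_mult_left_zero[symmetric]
    by (intro Bochner_Integration.integral_cong refl) (simp add: mult_ac)
  also have "\<dots> = (LINT x|lborel. LINT y|lborel. f x * g y * cis (- (2 * pi * x * y)))"
    using lborel_pair.Fubini_integral[OF int] by simp
  also have "\<dots> = (LINT x|lborel. f x * fourier_L1 g x)"
    unfolding fourier_L1_cis Bochner_Integration.integral_mult_right_zero[symmetric]
    by (intro Bochner_Integration.integral_cong refl) (simp add: mult_ac)
  finally show ?thesis .
qed

lemma L2_tendsto_cnj:
  "L2_tendsto h g flt \<Longrightarrow> L2_tendsto (\<lambda>i x. cnj (h i x)) (\<lambda>x. cnj (g x)) flt"
proof -
  assume h: "L2_tendsto h g flt"
  have "L2_norm (\<lambda>x. cnj (h i x) - cnj (g x)) = L2_norm (\<lambda>x. h i x - g x)" for i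
    unfolding L2_norm_def complex_cnj_diff[symmetric] complex_mod_cnj ..
  then show ?thesis using h by (simp add: L2_tendsto_def L2_cnj)
qed

lemma L2_tendsto_integral_mult:
  assumes h: "L2_tendsto h f sequentially" and k: "L2_tendsto k g sequentially"
  shows "(\<lambda>n. LINT x|lborel. h n x * k n x) \<longlonglongrightarrow> (LINT x|lborel. f x * g x)"
proof -
  have L: "h i \<in> L2" "f \<in> L2" "k i \<in> L2" "g \<in> L2" for i using h k by (auto simp: L2_tendsto_def)
  have "(\<lambda>n. L2_norm (h n) * L2_norm (\<lambda>x. k n x - g x)) \<longlonglongrightarrow> L2_norm f * 0"
    using k by (intro tendsto_mult L2_tendsto_norm[OF h]) (simp add: L2_tendsto_def)
  then have l: "(\<lambda>n. L2_norm (h n) * L2_norm (\<lambda>x. k n x - g x)) \<longlonglongrightarrow> 0" by simp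
  have b: "cmod ((LINT x|lborel. h n x * k n x) - (LINT x|lborel. h n x * g x))
      \<le> L2_norm (h n) * L2_norm (\<lambda>x. k n x - g x)" for n
  proof -
    have "(LINT x|lborel. h n x * k n x) - (LINT x|lborel. h n x * g x)
        = (LINT x|lborel. h n x * (k n x - g x))"
      using integrable_mult_L2[OF L(1) L(3)] integrable_mult_L2[OF L(1) L(4)]
      by (simp add: right_diff_distrib)
    also have "cmod \<dots> \<le> (LINT x|lborel. cmod (h n x) * cmod (k n x - g x))"
      using integral_norm_bound[of lborel "\<lambda>x. h n x * (k n x - g x)"] by (simp add: norm_mult)
    also have "\<dots> \<le> L2_norm (h n) * L2_norm (\<lambda>x. k n x - g x)"
      by (rule integral_cmod_mult_le[OF L(1) L2_diff[OF L(3,4)]])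
    finally show ?thesis .
  qed
  have 1: "(\<lambda>n. (LINT x|lborel. h n x * k n x) - (LINT x|lborel. h n x * g x)) \<longlonglongrightarrow> 0"
    by (rule Lim_null_comparison[OF always_eventually l]) (use b in blast)
  have 2: "(\<lambda>n. LINT x|lborel. h n x * g x) \<longlonglongrightarrow> (LINT x|lborel. f x * g x)"
    using L2_tendsto_inner[OF h L2_cnj[OF L(4)]] by (simp add: L2_inner_def)
  show ?thesis using tendsto_add[OF 1 2] by simp
qed

text \<open>
  The formula passes from integrable functions, where it is Fubini's theorem, to the limit.
\<close>

lemma is_FT_multiplication:
  assumes "is_FT f g" "is_FT f' g'"
  shows "(LINT x|lborel. g x * f' x) = (LINT x|lborel. f x * g' x)"
proof -
  obtain h where h: "\<And>n. integrable lborel (h n)" "L2_tendsto h f sequentially"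
    "L2_tendsto (\<lambda>n. fourier_L1 (h n)) g sequentially"
    using assms(1) unfolding is_FT_def by blast
  obtain h' where h': "\<And>n. integrable lborel (h' n)" "L2_tendsto h' f' sequentially"
    "L2_tendsto (\<lambda>n. fourier_L1 (h' n)) g' sequentially"
    using assms(2) unfolding is_FT_def by blast
  have "(\<lambda>n. LINT x|lborel. fourier_L1 (h n) x * h' n x) \<longlonglongrightarrow> (LINT x|lborel. g x * f' x)"
    by (rule L2_tendsto_integral_mult[OF h(3) h'(2)])
  then have "(\<lambda>n. LINT x|lborel. h n x * fourier_L1 (h' n) x) \<longlonglongrightarrow> (LINT x|lborel. g x * f' x)"
    by (simp add: fourier_L1_multiplication[OF h(1) h'(1)])
  then show ?thesis
    using L2_tendsto_integral_mult[OF h(2) h'(3)] LIMSEQ_unique by blast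
qed

lemma L2_affine:
  assumes f: "f \<in> L2" and c: "c \<noteq> 0"
  shows "(\<lambda>x. f (t + c * x)) \<in> L2"
    and "L2_norm (\<lambda>x. f (t + c * x)) = L2_norm f / sqrt \<bar>c\<bar>"
proof -
  note [measurable] = L2_measurable[OF f]
  show "(\<lambda>x. f (t + c * x)) \<in> L2"
    using lborel_integrable_real_affine[OF L2_integrable[OF f] c, of t] by (intro L2I) auto
  have "(LINT x|lborel. (cmod (f x))\<^sup>2) = \<bar>c\<bar> * (LINT x|lborel. (cmod (f (t + c * x)))\<^sup>2)"
    using lborel_integral_real_affine[OF c, of "\<lambda>x. (cmod (f x))\<^sup>2" t] by simp
  then show "L2_norm (\<lambda>x. f (t + c * x)) = L2_norm f / sqrt \<bar>c\<bar>"
    unfolding L2_norm_def using c by (simp add: real_sqrt_mult)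
qed

lemma L2_tendsto_affine:
  assumes h: "L2_tendsto h f flt" and c: "c \<noteq> 0"
  shows "L2_tendsto (\<lambda>i x. h i (t + c * x)) (\<lambda>x. f (t + c * x)) flt"
proof -
  have L: "h i \<in> L2" "f \<in> L2" for i using h by (auto simp: L2_tendsto_def)
  have "((\<lambda>i. L2_norm (\<lambda>x. h i x - f x) / sqrt \<bar>c\<bar>) \<longlongrightarrow> 0) flt"
    using h by (intro tendsto_divide_zero) (simp add: L2_tendsto_def)
  then show ?thesis
    using L2_affine(1)[OF L(1) c] L2_affine(1)[OF L(2) c] L2_affine(2)[OF L2_diff[OF L] c]
    by (simp add: L2_tendsto_def)
qed

lemma L2_tendsto_mult_cis:
  assumes h: "L2_tendsto h f flt" and [measurable]: "m \<in> borel_measurable borel"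
  shows "L2_tendsto (\<lambda>i x. cis (m x) * h i x) (\<lambda>x. cis (m x) * f x) flt"
proof -
  have L: "h i \<in> L2" "f \<in> L2" for i using h by (auto simp: L2_tendsto_def)
  have *: "(\<lambda>x. cis (m x) * f x) \<in> L2" if "f \<in> L2" for f
    using L2_mult_bounded[OF that, of "\<lambda>x. cis (m x)" 1] by (simp add: mult.commute)
  have "L2_norm (\<lambda>x. cis (m x) * h i x - cis (m x) * f x) = L2_norm (\<lambda>x. h i x - f x)" for i
    unfolding right_diff_distrib[symmetric] L2_norm_def by (simp add: norm_mult)
  then show ?thesis using h L * by (simp add: L2_tendsto_def)
qed

lemma fourier_L1_affine:
  assumes "c > 0"
  shows "fourier_L1 (\<lambda>x. f (c * x - t)) \<gamma> = of_real (1 / c) * (cis (- (2 * pi * (t / c) * \<gamma>)) * fourier_L1 f (\<gamma> / c))"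
proof -
  let ?F = "\<lambda>x. f x * cis (- (2 * pi * ((x + t) / c) * \<gamma>))"
  have "(LINT x|lborel. ?F x) = \<bar>c\<bar> *\<^sub>R (LINT x|lborel. ?F (- t + c * x))"
    by (rule lborel_integral_real_affine) (use assms in simp)
  also have "(\<lambda>x. ?F (- t + c * x)) = (\<lambda>x. f (c * x - t) * cis (- (2 * pi * x * \<gamma>)))"
    using assms by (intro ext) (simp add: add.commute[of "- t"])
  finally have "(LINT x|lborel. ?F x) = c *\<^sub>R fourier_L1 (\<lambda>x. f (c * x - t)) \<gamma>"
    using assms by (simp add: fourier_L1_cis)
  moreover have Fx: "?F x = cis (- (2 * pi * (t / c) * \<gamma>)) * (f x * cis (- (2 * pi * x * (\<gamma> / c))))" for x
  proof -
    have "- (2 * pi * ((x + t) / c) * \<gamma>) = - (2 * pi * (t / c) * \<gamma>) + - (2 * pi * x * (\<gamma> / c))"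
      using assms by (simp add: field_simps)
    then show ?thesis by (simp only: cis_mult[symmetric]) (simp add: mult_ac)
  qed
  moreover have "(LINT x|lborel. ?F x) = cis (- (2 * pi * (t / c) * \<gamma>)) * fourier_L1 f (\<gamma> / c)"
    unfolding Fx by (simp add: fourier_L1_cis)
  ultimately have "c *\<^sub>R fourier_L1 (\<lambda>x. f (c * x - t)) \<gamma> = cis (- (2 * pi * (t / c) * \<gamma>)) * fourier_L1 f (\<gamma> / c)"
    by simp
  then show ?thesis using assms by (simp add: scaleR_conv_of_real field_simps)
qed

text \<open>
  The transform of the dilated and translated function \<open>D\<^sub>c T\<^sub>t f\<close>.
\<close>

lemma is_FT_affine:
  assumes fg: "is_FT f g" and c: "c > 0"
  shows "is_FT (\<lambda>x. of_real (sqrt c) * f (c * x - t))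
    (\<lambda>\<gamma>. of_real (1 / sqrt c) * (cis (- (2 * pi * (t / c) * \<gamma>)) * g (\<gamma> / c)))"
proof -
  obtain h where h: "\<And>n. integrable lborel (h n)" "L2_tendsto h f sequentially"
    "L2_tendsto (\<lambda>n. fourier_L1 (h n)) g sequentially"
    using fg unfolding is_FT_def by blast
  have e1: "L2_tendsto (\<lambda>n x. of_real (sqrt c) * h n (c * x - t)) (\<lambda>x. of_real (sqrt c) * f (c * x - t)) sequentially"
    using L2_tendsto_cmult[OF L2_tendsto_affine[OF h(2), of c "- t"], of "of_real (sqrt c)"] c
    by (simp add: algebra_simps)
  have e2: "L2_tendsto (\<lambda>n \<gamma>. of_real (1 / sqrt c) * (cis (- (2 * pi * (t / c) * \<gamma>)) * fourier_L1 (h n) (\<gamma> / c)))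
     (\<lambda>\<gamma>. of_real (1 / sqrt c) * (cis (- (2 * pi * (t / c) * \<gamma>)) * g (\<gamma> / c))) sequentially"
    using L2_tendsto_cmult[OF L2_tendsto_mult_cis[OF L2_tendsto_affine[OF h(3), of "1 / c" 0],
          of "\<lambda>\<gamma>. - (2 * pi * (t / c) * \<gamma>)"], of "of_real (1 / sqrt c)"] c by simp
  have cc: "complex_of_real (sqrt c) * of_real (1 / c) = of_real (1 / sqrt c)"
    unfolding of_real_mult[symmetric] of_real_eq_iff using c by (simp add: real_div_sqrt field_simps)
  have e3: "fourier_L1 (\<lambda>x. of_real (sqrt c) * h n (c * x - t))
      = (\<lambda>\<gamma>. of_real (1 / sqrt c) * (cis (- (2 * pi * (t / c) * \<gamma>)) * fourier_L1 (h n) (\<gamma> / c)))" for n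
    by (rule ext) (simp only: fourier_L1_cmult fourier_L1_affine[OF c] mult.assoc[symmetric] cc)
  have e4: "integrable lborel (\<lambda>x. complex_of_real (sqrt c) * h n (c * x - t))" for n
    using lborel_integrable_real_affine[OF h(1)[of n], of c "- t"] c by (simp add: algebra_simps)
  show ?thesis
    unfolding is_FT_def
    by (rule exI[of _ "\<lambda>n x. of_real (sqrt c) * h n (c * x - t)"]) (use e1 e2 e3 e4 in simp)
qed

lemma is_FT_cnj:
  assumes fg: "is_FT f g"
  shows "is_FT (\<lambda>x. cnj (f x)) (\<lambda>\<gamma>. cnj (g (- \<gamma>)))"
proof -
  obtain h where h: "\<And>n. integrable lborel (h n)" "L2_tendsto h f sequentially"
    "L2_tendsto (\<lambda>n. fourier_L1 (h n)) g sequentially"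
    using fg unfolding is_FT_def by blast
  have e1: "fourier_L1 (\<lambda>x. cnj (h n x)) = (\<lambda>\<gamma>. cnj (fourier_L1 (h n) (- \<gamma>)))" for n
    unfolding fourier_L1_cis Bochner_Integration.integral_cnj[symmetric] by (simp add: cis_cnj)
  have e2: "L2_tendsto (\<lambda>n \<gamma>. cnj (fourier_L1 (h n) (- \<gamma>))) (\<lambda>\<gamma>. cnj (g (- \<gamma>))) sequentially"
    using L2_tendsto_cnj[OF L2_tendsto_affine[OF h(3), of "-1" 0]] by simp
  show ?thesis unfolding is_FT_def
    by (rule exI[of _ "\<lambda>n x. cnj (h n x)"]) (use h(1) e1 e2 L2_tendsto_cnj[OF h(2)] in simp)
qed

text \<open>
  Let \<open>f(x) = k(-x)\<close> where \<open>k\<close> is the transform of \<open>g\<close>. By the multiplication formula and the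
  rule for conjugates, the inner product of the transform of \<open>f\<close> with \<open>g\<close> is \<open>\<parallel>f\<parallel>\<^sup>2 = \<parallel>g\<parallel>\<^sup>2\<close>.
  Expanding the square shows that the transform of \<open>f\<close> differs from \<open>g\<close> by a function of norm \<open>0\<close>.
\<close>

lemma fourier_L2_surj:
  assumes g: "g \<in> L2"
  shows "\<exists>f\<in>L2. AE \<gamma> in lborel. \<F> f \<gamma> = g \<gamma>"
proof -
  obtain k where k: "is_FT g k" using is_FT_exists[OF g] by blast
  define f where "f = (\<lambda>x. k (- x))"
  have f: "f \<in> L2" and nf: "L2_norm f = L2_norm g"
    using L2_affine[OF is_FT_L2(2)[OF k], of "-1" 0] is_FT_norm[OF k] by (auto simp: f_def)
  note F = is_FT_fourier_L2[OF f]
  have "L2_inner (\<F> f) g = (LINT x|lborel. f x * cnj (k (- x)))"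
    using is_FT_multiplication[OF F is_FT_cnj[OF k]] by (simp add: L2_inner_def)
  also have "\<dots> = of_real ((L2_norm f)\<^sup>2)"
    using L2_inner_self[of f] by (simp add: L2_inner_def f_def)
  finally have "Re (L2_inner (\<F> f) g) = (L2_norm g)\<^sup>2"
    using nf by (simp del: of_real_power)
  then have "(L2_norm (\<lambda>x. \<F> f x - g x))\<^sup>2 = 0"
    using L2_norm_diff_sq[OF fourier_L2_L2[OF f] g] fourier_L2_norm[OF f] nf by simp
  then have "AE x in lborel. \<F> f x - g x = 0"
    by (intro L2_norm_eq_0_AE L2_diff fourier_L2_L2 f g) simp
  then show ?thesis using f by auto
qed

section \<open>Lattice and dilation sums of power tails\<close>

text \<open>
  The majorant of the part of the generator's transform outside \<open>[-R, R]\<close>. It is defined at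
  every point, so that bounds on its lattice sums hold everywhere and not only almost everywhere.
\<close>

definition power_tail :: "real \<Rightarrow> real \<Rightarrow> real \<Rightarrow> real \<Rightarrow> real" where
  "power_tail C s R y = (if R < \<bar>y\<bar> then C * \<bar>y\<bar> powr (- s) else 0)"

lemma power_tail_nonneg: "0 \<le> C \<Longrightarrow> 0 \<le> power_tail C s R y"
  by (simp add: power_tail_def)

lemma power_tail_measurable [measurable]: "power_tail C s R \<in> borel_measurable borel"
  unfolding power_tail_def by measurable

text \<open>
  Comparison of the sum with the integral of the decreasing function \<open>x powr (- (1 + \<sigma>))\<close>, done
  step by step with the mean value theorem for its antiderivative.
\<close>

lemma powr_sum_bound:
  fixes x L \<sigma> :: real
  assumes x: "x > 0" and L: "L > 0" and \<sigma>: "\<sigma> > 0"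
  shows "(\<Sum>i\<le>n. (x + real i * L) powr (- (1 + \<sigma>)))
    \<le> x powr (- (1 + \<sigma>)) + (x powr (- \<sigma>) - (x + real n * L) powr (- \<sigma>)) / (\<sigma> * L)"
proof (induction n)
  case 0
  then show ?case by simp
next
  case (Suc n)
  define y where "y = x + real n * L"
  have y: "y > 0" using x L by (simp add: y_def add_pos_nonneg)
  have "\<exists>z>y. z < y + L \<and> (y + L) powr (- \<sigma>) - y powr (- \<sigma>) = (y + L - y) * (- \<sigma> * z powr (- \<sigma> - 1))"
    using y L by (intro MVT2) (auto intro!: derivative_eq_intros simp: powr_diff field_simps)
  then obtain z where z: "z > y" "z < y + L"
    "(y + L) powr (- \<sigma>) - y powr (- \<sigma>) = L * (- \<sigma> * z powr (- \<sigma> - 1))" by auto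
  have "(y + L) powr (- (1 + \<sigma>)) \<le> z powr (- \<sigma> - 1)"
  proof -
    have e: "- (1 + \<sigma>) = - \<sigma> - 1" by simp
    show ?thesis unfolding e using z y \<sigma> by (intro powr_mono2') auto
  qed
  then have "(\<sigma> * L) * (y + L) powr (- (1 + \<sigma>)) \<le> (\<sigma> * L) * z powr (- \<sigma> - 1)"
    using \<sigma> L by (intro mult_left_mono) auto
  also have "\<dots> = y powr (- \<sigma>) - (y + L) powr (- \<sigma>)"
    using z(3) by (simp add: algebra_simps)
  finally have "(y + L) powr (- (1 + \<sigma>)) \<le> (y powr (- \<sigma>) - (y + L) powr (- \<sigma>)) / (\<sigma> * L)"
    using \<sigma> L by (simp add: pos_le_divide_eq mult.commute)
  moreover have y': "x + real (Suc n) * L = y + L" by (simp add: y_def algebra_simps)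
  ultimately show ?case
    using Suc.IH unfolding sum.atMost_Suc y' y_def[symmetric] diff_divide_distrib by linarith
qed

lemma half_lattice_sum:
  fixes y L R \<sigma> :: real
  assumes R: "R > 0" and L: "L > 0" and \<sigma>: "\<sigma> > 0" and F: "finite (F :: int set)"
  shows "(\<Sum>l\<in>F. if R < y + of_int l * L then (y + of_int l * L) powr (- (1 + \<sigma>)) else 0)
    \<le> R powr (- (1 + \<sigma>)) + R powr (- \<sigma>) / (\<sigma> * L)"
proof -
  define F' where "F' = {l \<in> F. R < y + of_int l * L}"
  have F': "finite F'" using F by (simp add: F'_def)
  have eq: "(\<Sum>l\<in>F. if R < y + of_int l * L then (y + of_int l * L) powr (- (1 + \<sigma>)) else 0)
      = (\<Sum>l\<in>F'. (y + of_int l * L) powr (- (1 + \<sigma>)))"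
    unfolding F'_def by (rule sum.inter_filter[OF F, symmetric])
  show ?thesis
  proof (cases "F' = {}")
    case True
    then show ?thesis using R L \<sigma> unfolding eq by simp
  next
    case False
    define l0 where "l0 = Min F'"
    define n where "n = nat (Max F' - l0)"
    define x where "x = y + of_int l0 * L"
    have "l0 \<in> F'" unfolding l0_def by (rule Min_in[OF F' False])
    then have x: "x > R" by (simp add: F'_def x_def)
    have sub: "F' \<subseteq> (\<lambda>i. l0 + int i) ` {..n}"
    proof
      fix l assume l: "l \<in> F'"
      then have "l0 \<le> l" "l \<le> Max F'" unfolding l0_def using F' by auto
      then show "l \<in> (\<lambda>i. l0 + int i) ` {..n}"
        by (intro image_eqI[of _ _ "nat (l - l0)"]) (auto simp: n_def)
    qed
    have "(\<Sum>l\<in>F'. (y + of_int l * L) powr (- (1 + \<sigma>)))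
        \<le> (\<Sum>l\<in>(\<lambda>i. l0 + int i) ` {..n}. (y + of_int l * L) powr (- (1 + \<sigma>)))"
      by (rule sum_mono2[OF _ sub]) auto
    also have "\<dots> = (\<Sum>i\<le>n. (x + real i * L) powr (- (1 + \<sigma>)))"
      by (subst sum.reindex) (auto simp: inj_on_def x_def algebra_simps)
    also have "\<dots> \<le> x powr (- (1 + \<sigma>)) + (x powr (- \<sigma>) - (x + real n * L) powr (- \<sigma>)) / (\<sigma> * L)"
      using x R by (intro powr_sum_bound L \<sigma>) auto
    also have "\<dots> \<le> x powr (- (1 + \<sigma>)) + x powr (- \<sigma>) / (\<sigma> * L)"
      using L \<sigma> by (intro add_left_mono divide_right_mono) auto
    also have "\<dots> \<le> R powr (- (1 + \<sigma>)) + R powr (- \<sigma>) / (\<sigma> * L)"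
      using x R L \<sigma> by (intro add_mono divide_right_mono powr_mono2') auto
    finally show ?thesis unfolding eq .
  qed
qed

text \<open>
  The lattice points beyond \<open>R\<close> and those before \<open>-R\<close> contribute alike. On either side the point
  next to the origin contributes at most \<open>R powr (- (1 + \<sigma>))\<close> and the others at most the integral
  of the power beyond \<open>R\<close>, divided by the spacing.
\<close>

lemma power_tail_lattice_sum:
  assumes R: "R > 0" and L: "L > 0" and \<sigma>: "\<sigma> > 0" and C: "C \<ge> 0" and F: "finite (F :: int set)"
  shows "(\<Sum>l\<in>F. power_tail C (1 + \<sigma>) R (y + of_int l * L))
    \<le> 2 * C * (R powr (- (1 + \<sigma>)) + R powr (- \<sigma>) / (\<sigma> * L))"
proof -
  define H where "H y = (if R < y then y powr (- (1 + \<sigma>)) else 0)" for y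
  have t: "power_tail C (1 + \<sigma>) R y = C * (H y + H (- y))" for y
    using R by (auto simp: power_tail_def H_def abs_if)
  have "(\<Sum>l\<in>F. power_tail C (1 + \<sigma>) R (y + of_int l * L))
      = C * ((\<Sum>l\<in>F. H (y + of_int l * L)) + (\<Sum>l\<in>F. H (- (y + of_int l * L))))"
    by (simp add: t sum_distrib_left sum.distrib distrib_left)
  also have "(\<Sum>l\<in>F. H (- (y + of_int l * L))) = (\<Sum>l\<in>uminus ` F. H (- y + of_int l * L))"
  proof -
    have e: "- (y + of_int l * L) = - y + of_int (- l) * L" for l :: int by simp
    show ?thesis unfolding e by (subst sum.reindex) (simp add: inj_on_def, simp only: o_def)
  qed
  also have "C * ((\<Sum>l\<in>F. H (y + of_int l * L)) + (\<Sum>l\<in>uminus ` F. H (- y + of_int l * L)))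
      \<le> C * ((R powr (- (1 + \<sigma>)) + R powr (- \<sigma>) / (\<sigma> * L)) + (R powr (- (1 + \<sigma>)) + R powr (- \<sigma>) / (\<sigma> * L)))"
    unfolding H_def by (intro mult_left_mono add_mono half_lattice_sum R L \<sigma> C F finite_imageI)
  finally show ?thesis by (simp add: algebra_simps)
qed

text \<open>
  From the first dilate that leaves \<open>[-R, R]\<close> on, the terms are dominated by a geometric series
  of ratio \<open>a powr (- s)\<close>.
\<close>

lemma power_tail_dilation_sum:
  assumes a: "a > 1" and R: "R > 0" and s: "s > 0" and C: "C \<ge> 0" and F: "finite (F :: int set)"
  shows "(\<Sum>j\<in>F. power_tail C s R (a powi j * y)) \<le> C * R powr (- s) * (a powr s / (a powr s - 1))"
proof -
  define q where "q = a powr s"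
  have q: "q > 1" unfolding q_def using a s by (simp add: gr_one_powr)
  define F' where "F' = {j \<in> F. R < \<bar>a powi j * y\<bar>}"
  have F': "finite F'" using F by (simp add: F'_def)
  have eq: "(\<Sum>j\<in>F. power_tail C s R (a powi j * y)) = C * (\<Sum>j\<in>F'. \<bar>a powi j * y\<bar> powr (- s))"
    unfolding F'_def power_tail_def sum_distrib_left by (rule sum.inter_filter[OF F, symmetric])
  have "(\<Sum>j\<in>F'. \<bar>a powi j * y\<bar> powr (- s)) \<le> R powr (- s) * (q / (q - 1))"
  proof (cases "F' = {}")
    case True
    then show ?thesis using q by simp
  next
    case False
    define j0 where "j0 = Min F'"
    define t where "t = \<bar>a powi j0 * y\<bar>"
    define n where "n = nat (Max F' - j0)"
    have "j0 \<in> F'" unfolding j0_def by (rule Min_in[OF F' False])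
    then have t: "t > R" by (simp add: F'_def t_def)
    have sub: "F' \<subseteq> (\<lambda>i. j0 + int i) ` {..n}"
    proof
      fix j assume j: "j \<in> F'"
      then have "j0 \<le> j" "j \<le> Max F'" unfolding j0_def using F' by auto
      then show "j \<in> (\<lambda>i. j0 + int i) ` {..n}"
        by (intro image_eqI[of _ _ "nat (j - j0)"]) (auto simp: n_def)
    qed
    have pw: "\<bar>a powi (j0 + int i) * y\<bar> powr (- s) = t powr (- s) * (1 / q) ^ i" for i
    proof -
      have "\<bar>a powi (j0 + int i) * y\<bar> = a ^ i * t"
        using a by (simp add: power_int_add t_def abs_mult mult_ac)
      then have "\<bar>a powi (j0 + int i) * y\<bar> powr (- s) = (a ^ i) powr (- s) * t powr (- s)"
        using a t R by (simp add: powr_mult)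
      also have "(a ^ i) powr (- s) = (1 / q) ^ i"
        using a by (simp add: q_def powr_minus powr_realpow[symmetric] powr_powr mult.commute
            power_divide inverse_eq_divide)
      finally show ?thesis by simp
    qed
    have "(\<Sum>j\<in>F'. \<bar>a powi j * y\<bar> powr (- s)) \<le> (\<Sum>j\<in>(\<lambda>i. j0 + int i) ` {..n}. \<bar>a powi j * y\<bar> powr (- s))"
      by (rule sum_mono2[OF _ sub]) auto
    also have "\<dots> = t powr (- s) * (\<Sum>i\<le>n. (1 / q) ^ i)"
      by (subst sum.reindex) (auto simp: inj_on_def pw sum_distrib_left)
    also have "\<dots> \<le> R powr (- s) * (q / (q - 1))"
    proof (intro mult_mono)
      show "t powr (- s) \<le> R powr (- s)" using t R s by (intro powr_mono2') auto
      have "(\<Sum>i\<le>n. (1 / q) ^ i) \<le> (\<Sum>i. (1 / q) ^ i)"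
        using q by (intro sum_le_suminf summable_geometric) auto
      also have "\<dots> = q / (q - 1)"
        using q by (subst suminf_geometric) (auto simp: field_simps)
      finally show "(\<Sum>i\<le>n. (1 / q) ^ i) \<le> q / (q - 1)" .
    qed (use q in \<open>auto intro: sum_nonneg\<close>)
    finally show ?thesis .
  qed
  then have "C * (\<Sum>j\<in>F'. \<bar>a powi j * y\<bar> powr (- s)) \<le> C * (R powr (- s) * (q / (q - 1)))"
    using C by (rule mult_left_mono)
  then show ?thesis unfolding eq q_def by (simp add: mult.assoc)
qed

text \<open>
  For a divergent sum both sides are \<open>0\<close>, the left one by convention and the right one because
  \<^const>\<open>enn2real\<close> sends \<open>\<infinity>\<close> to \<open>0\<close>. The equation makes sums over all scales measurable.
\<close>

lemma infsum_nonneg_suminf: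
  fixes f :: "int \<Rightarrow> real"
  assumes "\<And>k. 0 \<le> f k"
  shows "infsum f UNIV = enn2real (\<Sum>n. ennreal (f (int_decode n)))"
proof -
  have nn: "(\<integral>\<^sup>+k. ennreal (f k) \<partial>count_space UNIV) = (\<Sum>n. ennreal (f (int_decode n)))"
    unfolding nn_integral_count_space_nat[symmetric]
    by (rule nn_integral_bij_count_space[symmetric]) (rule bij_int_decode)
  show ?thesis
  proof (cases "f summable_on UNIV")
    case True
    then have "(f has_sum infsum f UNIV) UNIV" by simp
    then have "(\<integral>\<^sup>+k. ennreal (f k) \<partial>count_space UNIV) = ennreal (infsum f UNIV)"
      using assms by (rule nn_integral_count_space_has_sum)
    then show ?thesis unfolding nn[symmetric] using assms by (simp add: infsum_nonneg)
  next
    case False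
    have "(\<integral>\<^sup>+k. ennreal (f k) \<partial>count_space UNIV) = top"
    proof (rule ccontr)
      assume ne: "(\<integral>\<^sup>+k. ennreal (f k) \<partial>count_space UNIV) \<noteq> top"
      define r where "r = enn2real (\<integral>\<^sup>+k. ennreal (f k) \<partial>count_space UNIV)"
      have r: "(\<integral>\<^sup>+k. ennreal (f k) \<partial>count_space UNIV) = ennreal r"
        unfolding r_def using ne by (simp add: less_top)
      have "sum f F \<le> r" if "finite F" for F
      proof -
        have "ennreal (sum f F) = (\<Sum>k\<in>F. ennreal (f k))" using assms by simp
        also have "\<dots> = (\<integral>\<^sup>+k. ennreal (f k) * indicator F k \<partial>count_space UNIV)"
          using that by (subst nn_integral_indicator_finite) auto
        also have "\<dots> \<le> (\<integral>\<^sup>+k. ennreal (f k) \<partial>count_space UNIV)"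
          by (intro nn_integral_mono) (auto simp: indicator_def)
        finally show ?thesis unfolding r by (subst (asm) ennreal_le_iff) (auto simp: r_def)
      qed
      then have "f summable_on UNIV"
        using assms by (intro nonneg_bdd_above_summable_on bdd_aboveI[of _ r]) auto
      with False show False by contradiction
    qed
    then show ?thesis unfolding nn using False by (simp add: infsum_not_exists)
  qed
qed

lemma infsum_int_measurable:
  fixes f :: "int \<Rightarrow> real \<Rightarrow> real"
  assumes [measurable]: "\<And>k. f k \<in> borel_measurable borel" and "\<And>k x. 0 \<le> f k x"
  shows "(\<lambda>x. \<Sum>\<^sub>\<infinity>k. f k x) \<in> borel_measurable borel"
  unfolding infsum_nonneg_suminf[of "\<lambda>k. f k _", OF assms(2)] by measurable

text \<open>
  The exceptional set is enlarged to a Borel null set, whose preimage under scaling is null.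
\<close>

lemma AE_scale:
  fixes P :: "real \<Rightarrow> bool"
  assumes P: "AE x in lborel. P x" and c: "c \<noteq> 0"
  shows "AE x in lborel. P (c * x)"
proof -
  obtain N where N: "{x \<in> space lborel. \<not> P x} \<subseteq> N" "emeasure lborel N = 0" "N \<in> sets lborel"
    using P by (rule AE_E)
  then have "AE x in lborel. x \<notin> N" by (intro AE_not_in null_setsI)
  then have "AE x in lborel. 0 + c * x \<notin> N"
    using N(3) c by (intro AE_borel_affine) auto
  then show ?thesis by (rule AE_mp) (use N(1) in \<open>auto intro!: AE_I2\<close>)
qed

section \<open>Wavelet coefficients in the frequency domain\<close>

lemma wavelet_system_eq:
  "wavelet_system a b \<phi> (j, k) = (\<lambda>x. of_real (sqrt (a powi j)) * \<phi> (a powi j * x - of_int k * b))"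
  by (simp add: wavelet_system_def dilation_def translation_def)

lemma wavelet_system_add:
  "wavelet_system a b (\<lambda>x. \<phi> x + \<phi>' x) i = (\<lambda>x. wavelet_system a b \<phi> i x + wavelet_system a b \<phi>' i x)"
  by (cases i) (simp add: wavelet_system_eq distrib_left)

lemma wavelet_system_L2:
  assumes "a > 0" "\<phi> \<in> L2"
  shows "wavelet_system a b \<phi> jk \<in> L2"
proof (cases jk)
  case (Pair j k)
  show ?thesis
    unfolding Pair wavelet_system_eq
    using is_FT_L2(1)[OF is_FT_affine[OF is_FT_fourier_L2[OF assms(2)], of "a powi j" "of_int k * b"]] assms(1) by simp
qed

abbreviation (input) wcoeff where
  "wcoeff a b \<phi> f jk \<equiv> L2_inner f (wavelet_system a b \<phi> jk)"

text \<open>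
  The index \<open>-j\<close> matches the scale \<open>j\<close> of the wavelet system.
\<close>

abbreviation (input) energy where
  "energy a \<phi> j \<gamma> \<equiv> (cmod (\<F> \<phi> (a powi (- j) * \<gamma>)))\<^sup>2"

text \<open>
  The function of which the wavelet coefficients at scale \<open>j\<close> are the Fourier coefficients.
\<close>

definition scale_prod :: "real \<Rightarrow> (real \<Rightarrow> complex) \<Rightarrow> (real \<Rightarrow> complex) \<Rightarrow> int \<Rightarrow> real \<Rightarrow> complex" where
  "scale_prod a f \<phi> j \<gamma> = \<F> f \<gamma> * cnj (\<F> \<phi> (a powi (- j) * \<gamma>))"

text \<open>
  The transform turns translation by \<open>k b\<close> at scale \<open>j\<close> into modulation by the exponential of
  period \<open>a\<^sup>j / b\<close>. This reduces statements about a single scale to Fourier series.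
\<close>

lemma wavelet_inner:
  assumes a: "a > 0" and b: "b > 0" and f: "f \<in> L2" and \<phi>: "\<phi> \<in> L2"
  shows "wcoeff a b \<phi> f (j, k) =
    of_real (1 / sqrt (a powi j)) * (LINT \<gamma>|lborel. scale_prod a f \<phi> j \<gamma> * fmode (a powi j / b) k \<gamma>)"
proof -
  define \<alpha> where "\<alpha> = a powi j"
  have \<alpha>: "\<alpha> > 0" using a by (simp add: \<alpha>_def)
  have FT: "is_FT (wavelet_system a b \<phi> (j, k)) (\<lambda>\<gamma>. of_real (1 / sqrt \<alpha>) *
      (cis (- (2 * pi * (of_int k * b / \<alpha>) * \<gamma>)) * \<F> \<phi> (\<gamma> / \<alpha>)))"
    unfolding wavelet_system_eq \<alpha>_def[symmetric] by (rule is_FT_affine[OF is_FT_fourier_L2[OF \<phi>] \<alpha>])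
  have "wcoeff a b \<phi> f (j, k) = L2_inner (\<F> f) (\<lambda>\<gamma>. of_real (1 / sqrt \<alpha>) *
      (cis (- (2 * pi * (of_int k * b / \<alpha>) * \<gamma>)) * \<F> \<phi> (\<gamma> / \<alpha>)))"
    by (rule is_FT_inner[OF is_FT_fourier_L2[OF f] FT, symmetric])
  also have "\<dots> = (LINT \<gamma>|lborel. \<F> f \<gamma> * cnj (of_real (1 / sqrt \<alpha>) *
      (cis (- (2 * pi * (of_int k * b / \<alpha>) * \<gamma>)) * \<F> \<phi> (\<gamma> / \<alpha>))))"
    unfolding L2_inner_def ..
  also have "\<dots> = (LINT \<gamma>|lborel. of_real (1 / sqrt \<alpha>) * (scale_prod a f \<phi> j \<gamma> * fmode (\<alpha> / b) k \<gamma>))"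
  proof (rule Bochner_Integration.integral_cong[OF refl])
    fix \<gamma>
    have e1: "a powi (- j) * \<gamma> = \<gamma> / \<alpha>"
      by (simp add: \<alpha>_def power_int_minus field_simps)
    have e2: "2 * pi * of_int k * \<gamma> / (\<alpha> / b) = 2 * pi * (of_int k * b / \<alpha>) * \<gamma>" by simp
    show "\<F> f \<gamma> * cnj (of_real (1 / sqrt \<alpha>) *
      (cis (- (2 * pi * (of_int k * b / \<alpha>) * \<gamma>)) * \<F> \<phi> (\<gamma> / \<alpha>))) =
      of_real (1 / sqrt \<alpha>) * (scale_prod a f \<phi> j \<gamma> * fmode (\<alpha> / b) k \<gamma>)"
      unfolding scale_prod_def fmode_def e1 e2 complex_cnj_mult complex_cnj_complex_of_real cis_cnj
      by (simp add: mult_ac)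
  qed
  also have "\<dots> = of_real (1 / sqrt \<alpha>) * (LINT \<gamma>|lborel. scale_prod a f \<phi> j \<gamma> * fmode (\<alpha> / b) k \<gamma>)"
    by (rule Bochner_Integration.integral_mult_right_zero)
  finally show ?thesis unfolding \<alpha>_def .
qed

lemma scale_prod_measurable [measurable]:
  assumes "f \<in> L2" "\<phi> \<in> L2"
  shows "scale_prod a f \<phi> j \<in> borel_measurable borel"
proof -
  note [measurable] = L2_measurable[OF fourier_L2_L2[OF assms(1)]] L2_measurable[OF fourier_L2_L2[OF assms(2)]]
  show ?thesis unfolding scale_prod_def[abs_def] by measurable
qed

lemma scale_prod_integrable:
  assumes a: "a > 0" and "f \<in> L2" "\<phi> \<in> L2"
  shows "integrable lborel (scale_prod a f \<phi> j)"
proof -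
  have "(\<lambda>\<gamma>. \<F> \<phi> (0 + a powi (- j) * \<gamma>)) \<in> L2"
    using a by (intro L2_affine(1) fourier_L2_L2 assms) simp
  then show ?thesis
    unfolding scale_prod_def[abs_def]
    by (intro integrable_mult_cnj_L2 fourier_L2_L2 assms) simp
qed

text \<open>
  The factor \<open>1 / a\<^sup>j\<close> from the normalization of the dilation cancels the length \<open>a\<^sup>j / b\<close> of the
  period in Parseval's identity up to \<open>1 / b\<close>, so that all scales contribute with equal weight.
\<close>

lemma scale_parseval:
  assumes a: "a > 0" and b: "b > 0" and f: "f \<in> L2" and h: "h \<in> L2" and \<phi>: "\<phi> \<in> L2" and \<phi>': "\<phi>' \<in> L2"
    and G: "scale_prod a f \<phi> j \<in> L2" and H: "scale_prod a h \<phi>' j \<in> L2"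
    and Gs: "AE x in lborel. x \<notin> {u..<u + a powi j / b} \<longrightarrow> scale_prod a f \<phi> j x = 0"
    and Hs: "AE x in lborel. x \<notin> {u..<u + a powi j / b} \<longrightarrow> scale_prod a h \<phi>' j x = 0"
  shows "((\<lambda>k. wcoeff a b \<phi> f (j, k) * cnj (wcoeff a b \<phi>' h (j, k)))
    has_sum of_real (1 / b) * L2_inner (scale_prod a f \<phi> j) (scale_prod a h \<phi>' j)) UNIV"
proof -
  define \<alpha> where "\<alpha> = a powi j"
  have \<alpha>: "\<alpha> > 0" using a by (simp add: \<alpha>_def)
  have 1: "((\<lambda>k. of_real (1 / \<alpha>) * ((LINT x|lborel. scale_prod a f \<phi> j x * fmode (\<alpha> / b) k x) *
      cnj (LINT x|lborel. scale_prod a h \<phi>' j x * fmode (\<alpha> / b) k x)))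
    has_sum of_real (1 / \<alpha>) * (of_real (\<alpha> / b) * L2_inner (scale_prod a f \<phi> j) (scale_prod a h \<phi>' j))) UNIV"
    using \<alpha> b Gs Hs unfolding \<alpha>_def by (intro has_sum_cmult_right parseval_interval[OF _ G H]) auto
  have 2: "complex_of_real (1 / \<alpha>) = of_real (1 / sqrt \<alpha>) * of_real (1 / sqrt \<alpha>)"
    unfolding of_real_mult[symmetric] of_real_eq_iff using \<alpha> by simp
  have 3: "of_real (1 / \<alpha>) * (x * cnj y) = (of_real (1 / sqrt \<alpha>) * x) * cnj (of_real (1 / sqrt \<alpha>) * y)" for x y
    unfolding 2 complex_cnj_mult complex_cnj_complex_of_real by (simp only: mult_ac)
  have 4: "of_real (1 / \<alpha>) * (of_real (\<alpha> / b) * z) = of_real (1 / b) * z" for z :: complex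
    using \<alpha> by simp
  show ?thesis using 1 unfolding 3 4 unfolding wavelet_inner[OF a b f \<phi>] wavelet_inner[OF a b h \<phi>'] \<alpha>_def .
qed

lemma scale_parseval_norm:
  assumes "a > 0" "b > 0" "f \<in> L2" "\<phi> \<in> L2" "scale_prod a f \<phi> j \<in> L2"
    and "AE x in lborel. x \<notin> {u..<u + a powi j / b} \<longrightarrow> scale_prod a f \<phi> j x = 0"
  shows "((\<lambda>k. (cmod (wcoeff a b \<phi> f (j, k)))\<^sup>2)
    has_sum (1 / b) * (L2_norm (scale_prod a f \<phi> j))\<^sup>2) UNIV"
proof -
  have "((\<lambda>k. complex_of_real ((cmod (wcoeff a b \<phi> f (j, k)))\<^sup>2))
    has_sum complex_of_real ((1 / b) * (L2_norm (scale_prod a f \<phi> j))\<^sup>2)) UNIV"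
    using scale_parseval[OF assms(1,2,3,3,4,4,5,5,6,6)]
    by (simp only: complex_norm_square L2_inner_self of_real_mult)
  then show ?thesis by (simp only: has_sum_of_real_iff)
qed

text \<open>
  The substitute for Parseval's identity when the transform of the generator is not supported
  in one period.
\<close>

lemma scale_bound:
  assumes a: "a > 0" and b: "b > 0" and f: "f \<in> L2" and \<phi>: "\<phi> \<in> L2"
    and [measurable]: "w \<in> borel_measurable borel" and w: "\<And>x. 0 \<le> w x"
    and le: "AE x in lborel. cmod (scale_prod a f \<phi> j x) \<le> cmod (\<F> f x) * w (a powi (- j) * x)"
    and M: "\<And>x F. finite F \<Longrightarrow> (\<Sum>l\<in>F. w (x + of_int l * (1 / b))) \<le> M"
    and S: "finite S"
  shows "(\<Sum>k\<in>S. (cmod (wcoeff a b \<phi> f (j, k)))\<^sup>2)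
    \<le> M / b * (LINT x|lborel. (cmod (\<F> f x))\<^sup>2 * w (a powi (- j) * x))"
proof -
  define \<alpha> where "\<alpha> = a powi j"
  have \<alpha>: "\<alpha> > 0" using a by (simp add: \<alpha>_def)
  note [measurable] = L2_measurable[OF fourier_L2_L2[OF f]]
  have e: "a powi (- j) * x = x / \<alpha>" for x
    by (simp add: \<alpha>_def power_int_minus field_simps)
  have wM: "w x \<le> M" for x using M[of "{0}" x] by simp
  have "(\<Sum>k\<in>S. (cmod (LINT x|lborel. scale_prod a f \<phi> j x * fmode (\<alpha> / b) k x))\<^sup>2)
    \<le> \<alpha> / b * M * (LINT x|lborel. (cmod (\<F> f x))\<^sup>2 * w (a powi (- j) * x))"
  proof (rule coefficient_bound[OF _ _ _ _ _ le])
    show "0 < \<alpha> / b" using \<alpha> b by simp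
    show "integrable lborel (scale_prod a f \<phi> j)" by (rule scale_prod_integrable[OF a f \<phi>])
    show "\<F> f \<in> borel_measurable borel" by measurable
    show "(\<lambda>x. w (a powi (- j) * x)) \<in> borel_measurable borel" by measurable
    show "0 \<le> w (a powi (- j) * x)" for x by (rule w)
    show "(\<Sum>l\<in>F. w (a powi (- j) * (x + of_int l * (\<alpha> / b)))) \<le> M" if "finite F" for F x
    proof -
      have "a powi (- j) * (x + of_int l * (\<alpha> / b)) = x / \<alpha> + of_int l * (1 / b)" for l
        unfolding e using \<alpha> b by (simp add: field_simps)
      then show ?thesis using M[OF that, of "x / \<alpha>"] by simp
    qed
    show "integrable lborel (\<lambda>x. (cmod (\<F> f x))\<^sup>2 * w (a powi (- j) * x))"
    proof (rule Bochner_Integration.integrable_bound)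
      show "integrable lborel (\<lambda>x. (cmod (\<F> f x))\<^sup>2 * M)"
        using L2_integrable[OF fourier_L2_L2[OF f]] by simp
      show "AE x in lborel. norm ((cmod (\<F> f x))\<^sup>2 * w (a powi (- j) * x)) \<le> norm ((cmod (\<F> f x))\<^sup>2 * M)"
        using w wM by (intro AE_I2) (simp add: abs_mult mult_left_mono order_trans[OF w wM])
    qed measurable
  qed (rule S)
  then have "(1 / \<alpha>) * (\<Sum>k\<in>S. (cmod (LINT x|lborel. scale_prod a f \<phi> j x * fmode (\<alpha> / b) k x))\<^sup>2)
    \<le> (1 / \<alpha>) * (\<alpha> / b * M * (LINT x|lborel. (cmod (\<F> f x))\<^sup>2 * w (a powi (- j) * x)))"
    using \<alpha> by (intro mult_left_mono) auto
  also have "\<dots> = M / b * (LINT x|lborel. (cmod (\<F> f x))\<^sup>2 * w (a powi (- j) * x))"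
    using \<alpha> by simp
  also have "(1 / \<alpha>) * (\<Sum>k\<in>S. (cmod (LINT x|lborel. scale_prod a f \<phi> j x * fmode (\<alpha> / b) k x))\<^sup>2)
      = (\<Sum>k\<in>S. (cmod (wcoeff a b \<phi> f (j, k)))\<^sup>2)"
    unfolding wavelet_inner[OF a b f \<phi>] \<alpha>_def[symmetric] sum_distrib_left
    using \<alpha> by (intro sum.cong refl) (simp add: norm_mult power_mult_distrib power_divide norm_divide)
  finally show ?thesis .
qed

section \<open>The Calderon sum of a frame generator\<close>

definition calderon :: "real \<Rightarrow> (real \<Rightarrow> complex) \<Rightarrow> real \<Rightarrow> real" where
  "calderon a g \<gamma> = (\<Sum>\<^sub>\<infinity>k::int. (cmod (g (a powi k * \<gamma>)))\<^sup>2)"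

lemma calderon_measurable [measurable]:
  assumes [measurable]: "g \<in> borel_measurable borel"
  shows "calderon a g \<in> borel_measurable borel"
  unfolding calderon_def[abs_def] by (rule infsum_int_measurable) auto

text \<open>
  Shifting the index of summation; this invariance is what makes the quotient in the definition
  of the dual generator the same function at every scale.
\<close>

lemma calderon_shift:
  assumes "a \<noteq> 0"
  shows "calderon a g (a powi m * \<gamma>) = calderon a g \<gamma>"
proof -
  have "calderon a g (a powi m * \<gamma>) = (\<Sum>\<^sub>\<infinity>k::int. (cmod (g (a powi (k + m) * \<gamma>)))\<^sup>2)"
    using assms by (simp add: calderon_def power_int_add mult.assoc)
  also have "\<dots> = (\<Sum>\<^sub>\<infinity>k::int. (cmod (g (a powi k * \<gamma>)))\<^sup>2)"
    by (rule infsum_reindex_bij_betw[where g = "\<lambda>k. k + m" and f = "\<lambda>k. (cmod (g (a powi k * \<gamma>)))\<^sup>2"])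
       (rule bij_betw_byWitness[where f' = "\<lambda>k. k - m"], auto)
  finally show ?thesis by (simp add: calderon_def)
qed

lemma calderon_nonneg: "0 \<le> calderon a g \<gamma>"
  unfolding calderon_def by (intro infsum_nonneg) auto

lemma sum_scales_uminus:
  fixes J :: "int set"
  shows "(\<Sum>j\<in>J. h (a powi (- j) * \<gamma>)) = (\<Sum>j\<in>uminus ` J. h (a powi j * \<gamma>))"
  by (subst sum.reindex) (simp_all add: inj_on_def)

lemma calderon_bounds:
  assumes "\<And>J. finite J \<Longrightarrow> (\<Sum>j\<in>J. (cmod (g (a powi j * \<gamma>)))\<^sup>2) \<le> Q"
  shows "(\<lambda>k::int. (cmod (g (a powi k * \<gamma>)))\<^sup>2) summable_on UNIV"
    "calderon a g \<gamma> \<le> Q"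
    "finite J \<Longrightarrow> (\<Sum>j\<in>J. (cmod (g (a powi j * \<gamma>)))\<^sup>2) \<le> calderon a g \<gamma>"
proof -
  show s: "(\<lambda>k::int. (cmod (g (a powi k * \<gamma>)))\<^sup>2) summable_on UNIV"
    using assms by (intro nonneg_bdd_above_summable_on bdd_aboveI[of _ Q]) auto
  show "calderon a g \<gamma> \<le> Q"
    unfolding calderon_def by (rule infsum_le_finite_sums[OF s]) (rule assms)
  show "finite J \<Longrightarrow> (\<Sum>j\<in>J. (cmod (g (a powi j * \<gamma>)))\<^sup>2) \<le> calderon a g \<gamma>"
    unfolding calderon_def using s by (intro finite_sum_le_infsum) auto
qed

text \<open>
  A bound for all finite partial sums of the Calderon sum, which includes its convergence; the
  bound for \<^const>\<open>calderon\<close> itself also holds where the sum diverges and has the default value \<open>0\<close>.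
\<close>

abbreviation (input) calderon_le where
  "calderon_le a g Q \<gamma> \<equiv> \<forall>J. finite J \<longrightarrow> (\<Sum>j\<in>J. (cmod (g (a powi j * \<gamma>)))\<^sup>2) \<le> Q"

lemma AE_single_scale:
  fixes g :: "real \<Rightarrow> complex" and a :: real
  assumes "AE \<gamma> in lborel. calderon_le a g Q \<gamma>"
  shows "AE \<gamma> in lborel. (cmod (g \<gamma>))\<^sup>2 \<le> Q"
  using assms
proof (rule AE_mp, intro AE_I2 impI)
  fix \<gamma> assume "calderon_le a g Q \<gamma>"
  from this[rule_format, of "{0}"] show "(cmod (g \<gamma>))\<^sup>2 \<le> Q" by simp
qed

lemma AE_scales:
  fixes P :: "real \<Rightarrow> bool" and a :: real
  assumes "AE x in lborel. P x" "a > 0"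
  shows "AE x in lborel. \<forall>j::int. P (a powi j * x)"
  unfolding AE_all_countable by (intro allI AE_scale[OF assms(1)]) (use assms(2) in auto)

text \<open>
  Almost everywhere inequalities are obtained by testing an integral inequality on the very set
  on which they fail.
\<close>

lemma pos_set_null:
  fixes D :: "real \<Rightarrow> real"
  assumes [measurable]: "E \<in> sets borel" and int: "integrable lborel (\<lambda>x. indicator E x * D x)"
    and pos: "\<And>x. x \<in> E \<Longrightarrow> D x > 0"
    and le: "(LINT x|lborel. indicator E x * D x) \<le> 0"
  shows "AE x in lborel. x \<notin> E"
proof -
  have nn: "0 \<le> indicator E x * D x" for x
    using pos[of x] by (auto simp: indicator_def)
  have "0 \<le> (LINT x|lborel. indicator E x * D x)"
    by (intro Bochner_Integration.integral_nonneg nn)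
  then have "(LINT x|lborel. indicator E x * D x) = 0" using le by linarith
  then have "AE x in lborel. indicator E x * D x = 0"
    using integral_nonneg_eq_0_iff_AE[OF int] nn by simp
  then show ?thesis
  proof (rule AE_mp, intro AE_I2 impI notI)
    fix x assume "indicator E x * D x = 0" "x \<in> E"
    with pos[of x] show False by simp
  qed
qed

lemma has_sum_le_bound:
  fixes f :: "'a \<Rightarrow> real"
  assumes "(f has_sum s) UNIV" "\<And>F. finite F \<Longrightarrow> sum f F \<le> B"
  shows "s \<le> B"
proof -
  have "infsum f UNIV \<le> B"
    using assms by (intro infsum_le_finite_sums has_sum_imp_summable) auto
  then show ?thesis using infsumI[OF assms(1)] by simp
qed

lemma has_sum_finite_sum:
  fixes f :: "'j \<Rightarrow> 'a \<Rightarrow> real"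
  assumes "finite J" "\<And>j. j \<in> J \<Longrightarrow> (f j has_sum s j) A"
  shows "((\<lambda>k. \<Sum>j\<in>J. f j k) has_sum (\<Sum>j\<in>J. s j)) A"
  using assms by (induction J rule: finite_induct) (auto intro!: has_sum_add)

lemma sum_le_product:
  fixes g :: "'a \<times> 'b \<Rightarrow> real"
  assumes "finite F" "\<And>x. 0 \<le> g x"
  shows "sum g F \<le> (\<Sum>j\<in>fst ` F. \<Sum>k\<in>snd ` F. g (j, k))"
proof -
  have "sum g F \<le> sum g (fst ` F \<times> snd ` F)"
    using assms by (intro sum_mono2) force+
  then show ?thesis by (simp add: sum.cartesian_product)
qed

lemma indicator_transform:
  assumes E [measurable]: "E \<in> sets borel" and sub: "E \<subseteq> {u..<v}"
  obtains f where "f \<in> L2" "AE x in lborel. \<F> f x = indicator E x"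
    "(L2_norm f)\<^sup>2 = measure lborel E" "emeasure lborel E < \<infinity>"
proof -
  have "emeasure lborel E \<le> emeasure lborel {u..<v}" by (rule emeasure_mono[OF sub]) simp
  also have "\<dots> < \<infinity>" by (cases "u \<le> v") auto
  finally have fin: "emeasure lborel E < \<infinity>" .
  have I: "(\<lambda>x. indicator E x) \<in> L2" by (rule indicator_L2[OF E fin])
  obtain f where f: "f \<in> L2" "AE x in lborel. \<F> f x = indicator E x"
    using fourier_L2_surj[OF I] by blast
  have "(L2_norm f)\<^sup>2 = (LINT x|lborel. (cmod (indicator E x))\<^sup>2)"
    using fourier_L2_norm[OF f(1)] L2_norm_cong_AE[OF fourier_L2_L2[OF f(1)] I f(2)] L2_norm_sq by metis
  also have "\<dots> = (LINT x|lborel. indicator E x)"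
    by (intro Bochner_Integration.integral_cong) (auto simp: indicator_def)
  also have "\<dots> = measure lborel E" by simp
  finally show ?thesis using that f fin by blast
qed

lemma scale_prod_indicator:
  assumes a: "a > 0" and f: "f \<in> L2" and fE: "AE x in lborel. \<F> f x = indicator E x"
    and \<psi>: "\<psi> \<in> L2" and E [measurable]: "E \<in> sets borel"
  shows "scale_prod a f \<psi> j \<in> L2"
    "(L2_norm (scale_prod a f \<psi> j))\<^sup>2 = (LINT x|lborel. indicator E x * energy a \<psi> j x)"
    "integrable lborel (\<lambda>x. indicator E x * energy a \<psi> j x)"
    "AE x in lborel. x \<notin> E \<longrightarrow> scale_prod a f \<psi> j x = 0"
proof -
  note [measurable] = L2_measurable[OF fourier_L2_L2[OF \<psi>]] scale_prod_measurable[OF f \<psi>, of a j]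
  have g: "(\<lambda>x. \<F> \<psi> (0 + a powi (- j) * x)) \<in> L2"
    using a by (intro L2_affine(1) fourier_L2_L2 \<psi>) simp
  then have g': "(\<lambda>x. \<F> \<psi> (a powi (- j) * x)) \<in> L2" by simp
  have eq: "AE x in lborel. scale_prod a f \<psi> j x = indicator E x * cnj (\<F> \<psi> (a powi (- j) * x))"
    using fE by (rule AE_mp) (auto intro!: AE_I2 simp: scale_prod_def)
  show S: "scale_prod a f \<psi> j \<in> L2"
    by (rule L2_bound[OF g', where M = 1], measurable, rule AE_mp[OF eq])
       (auto intro!: AE_I2 simp: indicator_def)
  have I: "(\<lambda>x. \<F> \<psi> (a powi (- j) * x) * indicator E x) \<in> L2"
    by (rule L2_mult_indicator[OF g' E])
  have e: "(cmod (\<F> \<psi> (a powi (- j) * x) * indicator E x))\<^sup>2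
      = indicator E x * energy a \<psi> j x" for x
    by (auto simp: indicator_def)
  show "integrable lborel (\<lambda>x. indicator E x * energy a \<psi> j x)"
    using L2_integrable[OF I] unfolding e .
  show "(L2_norm (scale_prod a f \<psi> j))\<^sup>2 = (LINT x|lborel. indicator E x * energy a \<psi> j x)"
    unfolding L2_norm_sq
    by (rule integral_cong_AE, measurable, rule AE_mp[OF eq]) (auto intro!: AE_I2 simp: indicator_def)
  show "AE x in lborel. x \<notin> E \<longrightarrow> scale_prod a f \<psi> j x = 0"
    using eq by (rule AE_mp) (auto intro!: AE_I2)
qed

text \<open>
  Cover the line by intervals that are no longer than the periods \<open>a\<^sup>j / b\<close> of the finitely many
  scales in \<open>J\<close>. If the transform of \<open>f\<close> is the indicator of a subset \<open>E\<close> of such an interval,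
  Parseval's identity applies at each of these scales and the Bessel inequality for \<open>f\<close> reads
  \<open>\<integral>\<^sub>E \<Sum>j\<in>J. |\<F> \<psi> (a\<^sup>-\<^sup>j x)|\<^sup>2 dx \<le> b B |E|\<close>. Take for \<open>E\<close> the set where the integrand exceeds \<open>b B\<close>.
\<close>

lemma calderon_upper_finite:
  assumes a: "a > 0" and b: "b > 0" and \<psi>: "\<psi> \<in> L2" and bb: "bessel_bound (wavelet_system a b \<psi>) B"
    and J: "finite J"
  shows "AE \<gamma> in lborel. (\<Sum>j\<in>J. energy a \<psi> j \<gamma>) \<le> b * B"
proof -
  note [measurable] = L2_measurable[OF fourier_L2_L2[OF \<psi>]]
  \<comment> \<open>the 1 only keeps the minimum defined when J is empty\<close>
  define \<delta> where "\<delta> = Min (insert 1 ((\<lambda>j. a powi j / b) ` J))"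
  have \<delta>: "\<delta> > 0" unfolding \<delta>_def using J a b by (subst Min_gr_iff) auto
  have \<delta>le: "\<delta> \<le> a powi j / b" if "j \<in> J" for j
    unfolding \<delta>_def using J that by (intro Min_le) auto
  define D where "D \<gamma> = (\<Sum>j\<in>J. energy a \<psi> j \<gamma>) - b * B" for \<gamma>
  have [measurable]: "D \<in> borel_measurable borel" unfolding D_def by measurable
  have "AE \<gamma> in lborel. \<gamma> \<notin> {\<gamma> \<in> {u..<u+\<delta>}. D \<gamma> > 0}" for u
  proof -
    define E where "E = {\<gamma> \<in> {u..<u+\<delta>}. D \<gamma> > 0}"
    have E [measurable]: "E \<in> sets borel" unfolding E_def by measurable
    obtain f where f: "f \<in> L2" "AE x in lborel. \<F> f x = indicator E x"
      and nf: "(L2_norm f)\<^sup>2 = measure lborel E" and fin: "emeasure lborel E < \<infinity>"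
      by (rule indicator_transform[OF E, of u "u + \<delta>"]) (auto simp: E_def)
    note sp = scale_prod_indicator[OF a f \<psi> E]
    have hs: "((\<lambda>k. (cmod (wcoeff a b \<psi> f (j, k)))\<^sup>2)
      has_sum (1 / b) * (L2_norm (scale_prod a f \<psi> j))\<^sup>2) UNIV" if "j \<in> J" for j
    proof (rule scale_parseval_norm[OF a b f(1) \<psi> sp(1)])
      show "AE x in lborel. x \<notin> {u..<u + a powi j / b} \<longrightarrow> scale_prod a f \<psi> j x = 0"
        by (rule AE_mp[OF sp(4)]) (use \<delta>le[OF that] in \<open>auto intro!: AE_I2 simp: E_def\<close>)
    qed
    have "(\<Sum>j\<in>J. (1 / b) * (L2_norm (scale_prod a f \<psi> j))\<^sup>2) \<le> B * (L2_norm f)\<^sup>2"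
    proof (rule has_sum_le_bound)
      show "((\<lambda>k. \<Sum>j\<in>J. (cmod (wcoeff a b \<psi> f (j, k)))\<^sup>2) has_sum
        (\<Sum>j\<in>J. (1 / b) * (L2_norm (scale_prod a f \<psi> j))\<^sup>2)) UNIV"
        by (rule has_sum_finite_sum[OF J hs])
      fix F :: "int set" assume "finite F"
      then have "(\<Sum>i\<in>J \<times> F. (cmod (wcoeff a b \<psi> f i))\<^sup>2) \<le> B * (L2_norm f)\<^sup>2"
        using J by (intro bessel_boundD(3)[OF bb f(1)]) auto
      then show "(\<Sum>k\<in>F. \<Sum>j\<in>J. (cmod (wcoeff a b \<psi> f (j, k)))\<^sup>2) \<le> B * (L2_norm f)\<^sup>2"
        by (subst sum.swap) (simp add: sum.cartesian_product)
    qed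
    then have le: "(\<Sum>j\<in>J. (L2_norm (scale_prod a f \<psi> j))\<^sup>2) \<le> b * B * measure lborel E"
      using b unfolding nf sum_distrib_left[symmetric] by (simp add: field_simps)
    have Dx: "indicator E x * D x = (\<Sum>j\<in>J. indicator E x * energy a \<psi> j x)
        - b * B * indicator E x" for x
      by (simp add: D_def right_diff_distrib sum_distrib_left mult.commute)
    have iE: "integrable lborel (\<lambda>x. b * B * indicator E x)" using fin by simp
    have "AE x in lborel. x \<notin> E"
    proof (rule pos_set_null[OF E])
      show "integrable lborel (\<lambda>x. indicator E x * D x)"
        unfolding Dx using sp(3) iE by (intro Bochner_Integration.integrable_diff Bochner_Integration.integrable_sum) auto
      have "(LINT x|lborel. indicator E x * D x)
          = (\<Sum>j\<in>J. (L2_norm (scale_prod a f \<psi> j))\<^sup>2) - b * B * measure lborel E"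
        unfolding Dx sp(2) using sp(3) iE
        by (subst Bochner_Integration.integral_diff) (auto simp: Bochner_Integration.integral_sum)
      then show "(LINT x|lborel. indicator E x * D x) \<le> 0" using le by simp
    qed (simp add: E_def)
    then show ?thesis unfolding E_def .
  qed
  then have "AE \<gamma> in lborel. \<forall>m::int. \<gamma> \<notin> {\<gamma> \<in> {of_int m * \<delta>..<of_int m * \<delta> + \<delta>}. D \<gamma> > 0}"
    unfolding AE_all_countable by blast
  then show ?thesis
  proof (rule AE_mp, intro AE_I2 impI)
    fix \<gamma> assume *: "\<forall>m::int. \<gamma> \<notin> {\<gamma> \<in> {of_int m * \<delta>..<of_int m * \<delta> + \<delta>}. D \<gamma> > 0}"
    have "of_int \<lfloor>\<gamma> / \<delta>\<rfloor> \<le> \<gamma> / \<delta>" "\<gamma> / \<delta> < of_int \<lfloor>\<gamma> / \<delta>\<rfloor> + 1" by linarith+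
    then have "\<gamma> \<in> {of_int \<lfloor>\<gamma> / \<delta>\<rfloor> * \<delta>..<of_int \<lfloor>\<gamma> / \<delta>\<rfloor> * \<delta> + \<delta>}"
      unfolding pos_le_divide_eq[OF \<delta>] pos_divide_less_eq[OF \<delta>] by (simp add: distrib_right)
    then have "\<not> D \<gamma> > 0" using * by blast
    then show "(\<Sum>j\<in>J. energy a \<psi> j \<gamma>) \<le> b * B"
      unfolding D_def by linarith
  qed
qed

lemma calderon_upper:
  assumes a: "a > 0" and b: "b > 0" and \<psi>: "\<psi> \<in> L2" and bb: "bessel_bound (wavelet_system a b \<psi>) B"
  shows "AE \<gamma> in lborel. calderon_le a (\<F> \<psi>) (b * B) \<gamma>"
proof -
  have "countable {J :: int set. finite J}" by (rule countable_Collect_finite)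
  then have "AE \<gamma> in lborel. \<forall>J\<in>{J :: int set. finite J}.
      (\<Sum>j\<in>J. (cmod (\<F> \<psi> (a powi j * \<gamma>)))\<^sup>2) \<le> b * B"
  proof (rule AE_ball_countable[THEN iffD2], intro ballI)
    fix J :: "int set" assume "J \<in> {J. finite J}"
    then have J: "finite (uminus ` J)" by simp
    have "uminus ` uminus ` J = J" by (simp add: image_image)
    then show "AE \<gamma> in lborel. (\<Sum>j\<in>J. (cmod (\<F> \<psi> (a powi j * \<gamma>)))\<^sup>2) \<le> b * B"
      using calderon_upper_finite[OF a b \<psi> bb J]
      unfolding sum_scales_uminus[of "\<lambda>y. (cmod (\<F> \<psi> y))\<^sup>2"] by simp
  qed
  then show ?thesis by simp
qed

section \<open>Bessel bounds in the frequency domain\<close>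

text \<open>
  Domination by a power tail replaces band-limitation: \<open>M\<close> bounds the periodization at each scale
  and \<open>Q\<close> the sum over the scales.
\<close>

lemma bessel_tail:
  assumes a: "a > 1" and b: "b > 0" and \<phi>: "\<phi> \<in> L2" and R: "R > 0" and \<sigma>: "\<sigma> > 0" and C: "C \<ge> 0"
    and le: "AE \<gamma> in lborel. cmod (\<F> \<phi> \<gamma>) \<le> power_tail C (1 + \<sigma>) R \<gamma>"
  defines "M \<equiv> 2 * C * (R powr (- (1 + \<sigma>)) + R powr (- \<sigma>) / (\<sigma> * (1 / b)))"
    and "Q \<equiv> C * R powr (- (1 + \<sigma>)) * (a powr (1 + \<sigma>) / (a powr (1 + \<sigma>) - 1))"
  shows "bessel_bound (wavelet_system a b \<phi>) (M * Q / b)"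
proof -
  define w where "w = power_tail C (1 + \<sigma>) R"
  have w: "0 \<le> w x" for x unfolding w_def by (rule power_tail_nonneg[OF C])
  have [measurable]: "w \<in> borel_measurable borel" unfolding w_def by measurable
  have M: "(\<Sum>l\<in>F. w (x + of_int l * (1 / b))) \<le> M" if "finite F" for x and F :: "int set"
    unfolding w_def M_def using b by (intro power_tail_lattice_sum R \<sigma> C that) auto
  have Q: "(\<Sum>j\<in>J. w (a powi (- j) * x)) \<le> Q" if "finite J" for J :: "int set" and x
    unfolding sum_scales_uminus unfolding w_def Q_def using \<sigma> that
    by (intro power_tail_dilation_sum a R C) auto
  have M0: "M \<ge> 0" using M[of "{}"] by simp
  have Q0: "Q \<ge> 0" using Q[of "{}"] by simp
  have a0: "a > 0" using a by simp
  have wQ: "w (a powi (- j) * x) \<le> Q" for j x using Q[of "{j}"] by simp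
  have main: "(\<Sum>i\<in>F. (cmod (wcoeff a b \<phi> f i))\<^sup>2) \<le> M * Q / b * (L2_norm f)\<^sup>2"
    if f: "f \<in> L2" and F: "finite F" for f F
  proof -
    note [measurable] = L2_measurable[OF fourier_L2_L2[OF f]]
    have int2: "integrable lborel (\<lambda>x. (cmod (\<F> f x))\<^sup>2 * Q)"
      using L2_integrable[OF fourier_L2_L2[OF f]] by simp
    have int: "integrable lborel (\<lambda>x. (cmod (\<F> f x))\<^sup>2 * w (a powi (- j) * x))" for j
      by (rule Bochner_Integration.integrable_bound[OF int2])
         (auto intro!: AE_I2 mult_left_mono simp: abs_mult w wQ Q0)
    have "(\<Sum>i\<in>F. (cmod (wcoeff a b \<phi> f i))\<^sup>2)
        \<le> (\<Sum>j\<in>fst ` F. \<Sum>k\<in>snd ` F. (cmod (wcoeff a b \<phi> f (j, k)))\<^sup>2)"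
      by (rule sum_le_product[OF F]) simp
    also have "\<dots> \<le> (\<Sum>j\<in>fst ` F. M / b * (LINT x|lborel. (cmod (\<F> f x))\<^sup>2 * w (a powi (- j) * x)))"
    proof (intro sum_mono scale_bound[OF a0 b f \<phi> _ w _ M])
      fix j
      have "AE x in lborel. cmod (\<F> \<phi> (a powi (- j) * x)) \<le> w (a powi (- j) * x)"
        unfolding w_def using le a0 by (intro AE_scale) auto
      then show "AE x in lborel. cmod (scale_prod a f \<phi> j x) \<le> cmod (\<F> f x) * w (a powi (- j) * x)"
        by (rule AE_mp) (auto intro!: AE_I2 mult_left_mono simp: scale_prod_def norm_mult)
    qed (use F in auto)
    also have "\<dots> = M / b * (LINT x|lborel. (cmod (\<F> f x))\<^sup>2 * (\<Sum>j\<in>fst ` F. w (a powi (- j) * x)))"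
      unfolding sum_distrib_left using int by (subst Bochner_Integration.integral_sum) (auto simp: sum_distrib_left)
    also have "\<dots> \<le> M / b * (LINT x|lborel. (cmod (\<F> f x))\<^sup>2 * Q)"
    proof (rule mult_left_mono[OF integral_mono])
      show "integrable lborel (\<lambda>x. (cmod (\<F> f x))\<^sup>2 * (\<Sum>j\<in>fst ` F. w (a powi (- j) * x)))"
        unfolding sum_distrib_left using int by (intro Bochner_Integration.integrable_sum)
      show "(cmod (\<F> f x))\<^sup>2 * (\<Sum>j\<in>fst ` F. w (a powi (- j) * x)) \<le> (cmod (\<F> f x))\<^sup>2 * Q" for x
        using F by (intro mult_left_mono Q) auto
    qed (use int2 M0 b in auto)
    also have "\<dots> = M * Q / b * (L2_norm f)\<^sup>2"
      by (simp add: L2_norm_sq[symmetric] fourier_L2_norm[OF f])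
    finally show ?thesis .
  qed
  show ?thesis unfolding bessel_bound_def
    using main M0 Q0 b wavelet_system_L2[OF a0 \<phi>] by auto
qed

lemma scale_prod_bandlimited:
  assumes a: "a > 0" and b: "b > 0" and f: "f \<in> L2" and \<phi>: "\<phi> \<in> L2" and K: "2 * K < 1 / b" "K \<ge> 0"
    and supp: "AE \<gamma> in lborel. \<gamma> \<notin> {- K..K} \<longrightarrow> \<F> \<phi> \<gamma> = 0"
    and bd: "AE \<gamma> in lborel. (cmod (\<F> \<phi> \<gamma>))\<^sup>2 \<le> Q"
  shows "scale_prod a f \<phi> j \<in> L2"
    "AE x in lborel. x \<notin> {- (K * a powi j)..< - (K * a powi j) + a powi j / b} \<longrightarrow> scale_prod a f \<phi> j x = 0"
proof -
  note [measurable] = L2_measurable[OF fourier_L2_L2[OF \<phi>]]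
  define \<alpha> where "\<alpha> = a powi j"
  have \<alpha>: "\<alpha> > 0" using a by (simp add: \<alpha>_def)
  have e: "a powi (- j) * x = x / \<alpha>" for x
    by (simp add: \<alpha>_def power_int_minus field_simps)
  have "AE x in lborel. energy a \<phi> j x \<le> Q"
    using bd a by (intro AE_scale) auto
  then have "AE x in lborel. cmod (cnj (\<F> \<phi> (a powi (- j) * x))) \<le> sqrt Q"
    by (rule AE_mp) (auto intro!: AE_I2 real_le_rsqrt)
  then show "scale_prod a f \<phi> j \<in> L2"
    unfolding scale_prod_def[abs_def] by (intro L2_mult_bounded[OF fourier_L2_L2[OF f]]) measurable
  have "AE x in lborel. a powi (- j) * x \<notin> {- K..K} \<longrightarrow> \<F> \<phi> (a powi (- j) * x) = 0"
    using supp a by (intro AE_scale) auto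
  then show "AE x in lborel. x \<notin> {- (K * a powi j)..< - (K * a powi j) + a powi j / b} \<longrightarrow> scale_prod a f \<phi> j x = 0"
  proof (rule AE_mp, intro AE_I2 impI)
    fix x assume 1: "a powi (- j) * x \<notin> {- K..K} \<longrightarrow> \<F> \<phi> (a powi (- j) * x) = 0"
      and x: "x \<notin> {- (K * a powi j)..< - (K * a powi j) + a powi j / b}"
    have "\<alpha> * (2 * K) < \<alpha> * (1 / b)" using K \<alpha> by (intro mult_strict_left_mono) auto
    then have "\<alpha> * K < - (K * \<alpha>) + \<alpha> / b" by (simp add: algebra_simps)
    then have "x / \<alpha> \<notin> {- K..K}"
      using x \<alpha> unfolding \<alpha>_def[symmetric] by (auto simp: field_simps)
    then have "\<F> \<phi> (a powi (- j) * x) = 0" using 1 unfolding e by blast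
    then show "scale_prod a f \<phi> j x = 0" by (simp add: scale_prod_def)
  qed
qed

text \<open>
  The transform of the generator is supported in an interval shorter than \<open>1 / b\<close>, so Parseval's
  identity holds at every scale and only the Calderon sum remains.
\<close>

lemma bessel_bandlimited:
  assumes a: "a > 0" and b: "b > 0" and \<phi>: "\<phi> \<in> L2" and K: "2 * K < 1 / b" "K \<ge> 0"
    and supp: "AE \<gamma> in lborel. \<gamma> \<notin> {- K..K} \<longrightarrow> \<F> \<phi> \<gamma> = 0"
    and bd: "AE \<gamma> in lborel. calderon_le a (\<F> \<phi>) Q \<gamma>"
    and Q: "Q \<ge> 0"
  shows "bessel_bound (wavelet_system a b \<phi>) (Q / b)"
proof -
  note [measurable] = L2_measurable[OF fourier_L2_L2[OF \<phi>]]
  have bd1: "AE \<gamma> in lborel. (cmod (\<F> \<phi> \<gamma>))\<^sup>2 \<le> Q"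
    by (rule AE_single_scale[OF bd])
  have main: "(\<Sum>i\<in>F. (cmod (wcoeff a b \<phi> f i))\<^sup>2) \<le> Q / b * (L2_norm f)\<^sup>2"
    if f: "f \<in> L2" and F: "finite F" for f F
  proof -
    note [measurable] = L2_measurable[OF fourier_L2_L2[OF f]]
    note sp = scale_prod_bandlimited[OF a b f \<phi> K supp bd1]
    have "(\<Sum>i\<in>F. (cmod (wcoeff a b \<phi> f i))\<^sup>2)
        \<le> (\<Sum>j\<in>fst ` F. \<Sum>k\<in>snd ` F. (cmod (wcoeff a b \<phi> f (j, k)))\<^sup>2)"
      by (rule sum_le_product[OF F]) simp
    also have "\<dots> \<le> (\<Sum>j\<in>fst ` F. (1 / b) * (L2_norm (scale_prod a f \<phi> j))\<^sup>2)"
    proof (rule sum_mono)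
      fix j
      have hs: "((\<lambda>k. (cmod (wcoeff a b \<phi> f (j, k)))\<^sup>2)
          has_sum (1 / b) * (L2_norm (scale_prod a f \<phi> j))\<^sup>2) UNIV"
        by (rule scale_parseval_norm[OF a b f \<phi> sp])
      have "(\<Sum>k\<in>snd ` F. (cmod (wcoeff a b \<phi> f (j, k)))\<^sup>2)
          \<le> (\<Sum>\<^sub>\<infinity>k. (cmod (wcoeff a b \<phi> f (j, k)))\<^sup>2)"
        using F has_sum_imp_summable[OF hs] by (intro finite_sum_le_infsum) auto
      then show "(\<Sum>k\<in>snd ` F. (cmod (wcoeff a b \<phi> f (j, k)))\<^sup>2)
          \<le> (1 / b) * (L2_norm (scale_prod a f \<phi> j))\<^sup>2"
        unfolding infsumI[OF hs] .
    qed
    also have "\<dots> = (1 / b) * (LINT x|lborel. (\<Sum>j\<in>fst ` F. (cmod (scale_prod a f \<phi> j x))\<^sup>2))"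
      using L2_integrable[OF sp(1)] by (simp add: sum_distrib_left L2_norm_sq Bochner_Integration.integral_sum)
    also have "\<dots> \<le> (1 / b) * (LINT x|lborel. (cmod (\<F> f x))\<^sup>2 * Q)"
    proof (rule mult_left_mono[OF integral_mono_AE])
      show "integrable lborel (\<lambda>x. \<Sum>j\<in>fst ` F. (cmod (scale_prod a f \<phi> j x))\<^sup>2)"
        by (intro Bochner_Integration.integrable_sum L2_integrable sp(1))
      show "integrable lborel (\<lambda>x. (cmod (\<F> f x))\<^sup>2 * Q)"
        using L2_integrable[OF fourier_L2_L2[OF f]] by simp
      show "AE x in lborel. (\<Sum>j\<in>fst ` F. (cmod (scale_prod a f \<phi> j x))\<^sup>2) \<le> (cmod (\<F> f x))\<^sup>2 * Q"
        using bd
      proof (rule AE_mp, intro AE_I2 impI)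
        fix x assume B: "calderon_le a (\<F> \<phi>) Q x"
        have "(\<Sum>j\<in>fst ` F. (cmod (scale_prod a f \<phi> j x))\<^sup>2)
            = (cmod (\<F> f x))\<^sup>2 * (\<Sum>j\<in>fst ` F. energy a \<phi> j x)"
          by (simp add: scale_prod_def norm_mult power_mult_distrib sum_distrib_left)
        also have "\<dots> \<le> (cmod (\<F> f x))\<^sup>2 * Q"
          unfolding sum_scales_uminus[of "\<lambda>y. (cmod (\<F> \<phi> y))\<^sup>2"]
          using B F by (intro mult_left_mono) auto
        finally show "(\<Sum>j\<in>fst ` F. (cmod (scale_prod a f \<phi> j x))\<^sup>2) \<le> (cmod (\<F> f x))\<^sup>2 * Q" .
      qed
    qed (use b in auto)
    also have "\<dots> = Q / b * (L2_norm f)\<^sup>2"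
      by (simp add: L2_norm_sq[symmetric] fourier_L2_norm[OF f])
    finally show ?thesis .
  qed
  show ?thesis unfolding bessel_bound_def
    using main Q b wavelet_system_L2[OF a \<phi>] by auto
qed

section \<open>The lower bound of the Calderon sum\<close>

text \<open>
  Let the transform of \<open>f\<close> be the indicator of a subset \<open>E\<close> of a short interval at distance at
  least \<open>c\<close> from the origin. At scales whose period \<open>a\<^sup>j / b\<close> is at least the length \<open>\<delta>\<close>, Parseval's
  identity is exact. At the other scales \<open>a\<^sup>-\<^sup>j |x| > c / (b \<delta>)\<close> on \<open>E\<close>, so that only the tail of the transform
  of the generator beyond \<open>c / (b \<delta>)\<close> is seen and the decay hypothesis bounds these scales
  together. The lower frame inequality for \<open>f\<close> then bounds the Calderon sum from below on average
  over \<open>E\<close>, up to the contribution of the tail.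
\<close>

lemma calderon_lower_local:
  assumes a: "a > 1" and b: "b > 0" and \<psi>: "\<psi> \<in> L2" and bb: "bessel_bound (wavelet_system a b \<psi>) B"
    and lower: "\<And>f. f \<in> L2 \<Longrightarrow> A * (L2_norm f)\<^sup>2 \<le> (\<Sum>\<^sub>\<infinity>i. (cmod (wcoeff a b \<psi> f i))\<^sup>2)"
    and C: "C \<ge> 0" and \<sigma>: "\<sigma> > 0"
    and decay: "AE \<gamma> in lborel. cmod (\<F> \<psi> \<gamma>) \<le> C / (1 + \<bar>\<gamma>\<bar> powr (1 + \<sigma>))"
    and c: "c > 0" and \<delta>: "\<delta> > 0" and R1: "c / (b * \<delta>) \<ge> 1"
    and far: "\<And>x. x \<in> {u..<u+\<delta>} \<Longrightarrow> c \<le> \<bar>x\<bar>"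
  shows "AE \<gamma> in lborel. \<gamma> \<in> {u..<u+\<delta>} \<longrightarrow> b * A \<le> calderon a (\<F> \<psi>) \<gamma> +
    2 * C * (1 + b / \<sigma>) * (C * (c / (b * \<delta>)) powr (- (1 + \<sigma>)) * (a powr (1 + \<sigma>) / (a powr (1 + \<sigma>) - 1)))"
proof -
  note [measurable] = L2_measurable[OF fourier_L2_L2[OF \<psi>]]
  define S where "S = calderon a (\<F> \<psi>)"
  have [measurable]: "S \<in> borel_measurable borel" unfolding S_def by measurable
  define R where "R = c / (b * \<delta>)"
  have R: "R > 0" "R \<ge> 1" using R1 by (auto simp: R_def)
  have a0: "a > 0" using a by simp
  define w where "w = power_tail C (1 + \<sigma>) R"
  have w: "0 \<le> w x" for x unfolding w_def by (rule power_tail_nonneg[OF C])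
  have [measurable]: "w \<in> borel_measurable borel" unfolding w_def by measurable
  define M where "M = 2 * C * (1 + b / \<sigma>)"
  define Q where "Q = C * R powr (- (1 + \<sigma>)) * (a powr (1 + \<sigma>) / (a powr (1 + \<sigma>) - 1))"
  have M0: "M \<ge> 0" unfolding M_def using C b \<sigma> by simp
  have wM: "(\<Sum>l\<in>F. w (x + of_int l * (1 / b))) \<le> M" if "finite F" for x and F :: "int set"
  proof -
    have "(\<Sum>l\<in>F. w (x + of_int l * (1 / b))) \<le> 2 * C * (R powr (- (1 + \<sigma>)) + R powr (- \<sigma>) / (\<sigma> * (1 / b)))"
      unfolding w_def using b by (intro power_tail_lattice_sum R \<sigma> C that) auto
    also have "\<dots> \<le> 2 * C * (1 powr (- (1 + \<sigma>)) + 1 powr (- \<sigma>) / (\<sigma> * (1 / b)))"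
      using C b \<sigma> R by (intro mult_left_mono add_mono divide_right_mono powr_mono2') auto
    also have "\<dots> = M" by (simp add: M_def)
    finally show ?thesis .
  qed
  have wQ: "(\<Sum>j\<in>J. w (a powi (- j) * x)) \<le> Q" if "finite J" for J :: "int set" and x
    unfolding sum_scales_uminus unfolding w_def Q_def using \<sigma> that
    by (intro power_tail_dilation_sum a R C) auto
  have w1: "w (a powi (- j) * x) \<le> Q" for j x using wQ[of "{j}"] by simp
  have Q0: "Q \<ge> 0" using wQ[of "{}"] by simp
  define D where "D \<gamma> = b * A - (S \<gamma> + M * Q)" for \<gamma>
  have [measurable]: "D \<in> borel_measurable borel" unfolding D_def by measurable
  define E where "E = {\<gamma> \<in> {u..<u+\<delta>}. D \<gamma> > 0}"
  have E [measurable]: "E \<in> sets borel" unfolding E_def by measurable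
  obtain f where f: "f \<in> L2" "AE x in lborel. \<F> f x = indicator E x"
    and nf: "(L2_norm f)\<^sup>2 = measure lborel E" and fin: "emeasure lborel E < \<infinity>"
    by (rule indicator_transform[OF E, of u "u + \<delta>"]) (auto simp: E_def)
  note sp = scale_prod_indicator[OF a0 f \<psi> E]
  note [measurable] = L2_measurable[OF fourier_L2_L2[OF f(1)]]
  have iE: "integrable lborel (\<lambda>x. r * indicator E x)" for r :: real using fin by simp
  have up: "AE \<gamma> in lborel. calderon_le a (\<F> \<psi>) (b * B) \<gamma>"
    by (rule calderon_upper[OF a0 b \<psi> bb])
  have iS: "integrable lborel (\<lambda>x. indicator E x * S x)"
  proof (rule Bochner_Integration.integrable_bound[OF iE[of "b * B"]])
    show "AE x in lborel. norm (indicator E x * S x) \<le> norm (b * B * indicator E x)"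
      using up
    proof (rule AE_mp, intro AE_I2 impI)
      fix x assume "calderon_le a (\<F> \<psi>) (b * B) x"
      then have "S x \<le> b * B" unfolding S_def by (intro calderon_bounds(2)) auto
      moreover have "0 \<le> S x" unfolding S_def by (rule calderon_nonneg)
      ultimately show "norm (indicator E x * S x) \<le> norm (b * B * indicator E x)"
        by (auto simp: indicator_def)
    qed
  qed measurable
  have iw: "integrable lborel (\<lambda>x. indicator E x * w (a powi (- j) * x))" for j
    by (rule Bochner_Integration.integrable_bound[OF iE[of Q]])
       (auto intro!: AE_I2 simp: abs_mult indicator_def w w1 Q0)
  have scale: "(\<Sum>k\<in>F. (cmod (wcoeff a b \<psi> f (j, k)))\<^sup>2)
      \<le> (1 / b) * ((LINT x|lborel. indicator E x * energy a \<psi> j x)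
        + M * (LINT x|lborel. indicator E x * w (a powi (- j) * x)))" if F: "finite F" for j F
  proof (cases "\<delta> \<le> a powi j / b")
    case True
    have hs: "((\<lambda>k. (cmod (wcoeff a b \<psi> f (j, k)))\<^sup>2)
      has_sum (1 / b) * (L2_norm (scale_prod a f \<psi> j))\<^sup>2) UNIV"
    proof (rule scale_parseval_norm[OF a0 b f(1) \<psi> sp(1)])
      show "AE x in lborel. x \<notin> {u..<u + a powi j / b} \<longrightarrow> scale_prod a f \<psi> j x = 0"
        by (rule AE_mp[OF sp(4)]) (use True in \<open>auto intro!: AE_I2 simp: E_def\<close>)
    qed
    have "(\<Sum>k\<in>F. (cmod (wcoeff a b \<psi> f (j, k)))\<^sup>2)
        \<le> (\<Sum>\<^sub>\<infinity>k. (cmod (wcoeff a b \<psi> f (j, k)))\<^sup>2)"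
      using F has_sum_imp_summable[OF hs] by (intro finite_sum_le_infsum) auto
    also have "\<dots> = (1 / b) * (LINT x|lborel. indicator E x * energy a \<psi> j x)"
      unfolding infsumI[OF hs] sp(2) ..
    also have "\<dots> \<le> (1 / b) * ((LINT x|lborel. indicator E x * energy a \<psi> j x)
        + M * (LINT x|lborel. indicator E x * w (a powi (- j) * x)))"
    proof -
      have "0 \<le> (LINT x|lborel. indicator E x * w (a powi (- j) * x))"
        by (intro Bochner_Integration.integral_nonneg mult_nonneg_nonneg w) simp
      then show ?thesis using b M0 by (intro mult_left_mono) auto
    qed
    finally show ?thesis .
  next
    case False
    define \<alpha> where "\<alpha> = a powi j"
    have \<alpha>: "\<alpha> > 0" "\<alpha> < b * \<delta>" using a0 b False by (auto simp: \<alpha>_def field_simps)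
    have e: "a powi (- j) * x = x / \<alpha>" for x
      by (simp add: \<alpha>_def power_int_minus field_simps)
    have "AE x in lborel. cmod (\<F> \<psi> (a powi (- j) * x)) \<le> C / (1 + \<bar>a powi (- j) * x\<bar> powr (1 + \<sigma>))"
      by (rule AE_scale[OF decay]) (use a0 in auto)
    then have "AE x in lborel. cmod (scale_prod a f \<psi> j x) \<le> cmod (\<F> f x) * w (a powi (- j) * x)"
      using f(2)
    proof eventually_elim
      case (elim x)
      note le = elim(1) and fx = elim(2)
      show ?case
      proof (cases "x \<in> E")
        case True
        define y where "y = a powi (- j) * x"
        have "c \<le> \<bar>x\<bar>" using far[of x] True by (simp add: E_def)
        have "R < c / \<alpha>" unfolding R_def using \<alpha> c b \<delta> by (intro divide_strict_left_mono) auto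
        also have "\<dots> \<le> \<bar>y\<bar>" unfolding y_def e using \<open>c \<le> \<bar>x\<bar>\<close> \<alpha> by (simp add: divide_right_mono)
        finally have y: "R < \<bar>y\<bar>" .
        have "cmod (\<F> \<psi> y) \<le> C / (1 + \<bar>y\<bar> powr (1 + \<sigma>))" using le by (simp add: y_def)
        also have "\<dots> \<le> C / (\<bar>y\<bar> powr (1 + \<sigma>))"
          using y R C by (intro divide_left_mono) (auto intro!: mult_pos_pos add_pos_pos)
        also have "\<dots> = w y" unfolding w_def power_tail_def using y
          by (simp add: powr_minus divide_inverse del: minus_add_distrib)
        finally show ?thesis using True fx by (simp add: scale_prod_def norm_mult y_def)
      next
        case False
        then show ?thesis using fx by (simp add: scale_prod_def)
      qed
    qed
    then have "(\<Sum>k\<in>F. (cmod (wcoeff a b \<psi> f (j, k)))\<^sup>2)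
        \<le> M / b * (LINT x|lborel. (cmod (\<F> f x))\<^sup>2 * w (a powi (- j) * x))"
      by (intro scale_bound[OF a0 b f(1) \<psi> _ w _ wM F]) auto
    also have "(LINT x|lborel. (cmod (\<F> f x))\<^sup>2 * w (a powi (- j) * x))
        = (LINT x|lborel. indicator E x * w (a powi (- j) * x))"
      by (rule integral_cong_AE, measurable, rule AE_mp[OF f(2)]) (auto intro!: AE_I2 simp: indicator_def)
    also have "M / b * (LINT x|lborel. indicator E x * w (a powi (- j) * x))
      \<le> (1 / b) * ((LINT x|lborel. indicator E x * energy a \<psi> j x)
        + M * (LINT x|lborel. indicator E x * w (a powi (- j) * x)))"
    proof -
      have "0 \<le> (LINT x|lborel. indicator E x * energy a \<psi> j x)"
        by (intro Bochner_Integration.integral_nonneg mult_nonneg_nonneg) auto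
      then show ?thesis using b by (simp add: field_simps)
    qed
    finally show ?thesis .
  qed
  define V where "V = (LINT x|lborel. indicator E x * S x + (M * Q) * indicator E x)"
  have fsum: "(\<Sum>i\<in>F. (cmod (wcoeff a b \<psi> f i))\<^sup>2) \<le> (1 / b) * V" if F: "finite F" for F
  proof -
    define J where "J = fst ` F"
    have J: "finite J" using F by (simp add: J_def)
    have "(\<Sum>i\<in>F. (cmod (wcoeff a b \<psi> f i))\<^sup>2)
        \<le> (\<Sum>j\<in>J. \<Sum>k\<in>snd ` F. (cmod (wcoeff a b \<psi> f (j, k)))\<^sup>2)"
      unfolding J_def by (rule sum_le_product[OF F]) simp
    also have "\<dots> \<le> (\<Sum>j\<in>J. (1 / b) * ((LINT x|lborel. indicator E x * energy a \<psi> j x)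
        + M * (LINT x|lborel. indicator E x * w (a powi (- j) * x))))"
      using F by (intro sum_mono scale) auto
    also have "\<dots> = (1 / b) * (LINT x|lborel. (\<Sum>j\<in>J. indicator E x * energy a \<psi> j x
        + M * (indicator E x * w (a powi (- j) * x))))"
      using sp(3) iw by (simp add: sum_distrib_left Bochner_Integration.integral_sum)
    also have "\<dots> \<le> (1 / b) * V"
      unfolding V_def
    proof (rule mult_left_mono[OF integral_mono_AE])
      show "integrable lborel (\<lambda>x. \<Sum>j\<in>J. indicator E x * energy a \<psi> j x
        + M * (indicator E x * w (a powi (- j) * x)))"
        using sp(3) iw by simp
      show "integrable lborel (\<lambda>x. indicator E x * S x + (M * Q) * indicator E x)"
        using iS iE[of "M * Q"] by simp
      show "AE x in lborel. (\<Sum>j\<in>J. indicator E x * energy a \<psi> j x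
        + M * (indicator E x * w (a powi (- j) * x))) \<le> indicator E x * S x + (M * Q) * indicator E x"
        using up
      proof (rule AE_mp, intro AE_I2 impI)
        fix x assume bd: "calderon_le a (\<F> \<psi>) (b * B) x"
        have 1: "(\<Sum>j\<in>J. energy a \<psi> j x) \<le> S x"
          unfolding S_def sum_scales_uminus[of "\<lambda>y. (cmod (\<F> \<psi> y))\<^sup>2"]
          using J bd by (intro calderon_bounds(3)[where Q = "b * B"]) auto
        have "(\<Sum>j\<in>J. indicator E x * energy a \<psi> j x
            + M * (indicator E x * w (a powi (- j) * x)))
          = indicator E x * ((\<Sum>j\<in>J. energy a \<psi> j x) + M * (\<Sum>j\<in>J. w (a powi (- j) * x)))"
          by (simp add: sum.distrib sum_distrib_left distrib_left mult.left_commute)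
        also have "\<dots> \<le> indicator E x * (S x + M * Q)"
          using M0 by (intro mult_left_mono add_mono 1 wQ[OF J]) auto
        finally show "(\<Sum>j\<in>J. indicator E x * energy a \<psi> j x
            + M * (indicator E x * w (a powi (- j) * x))) \<le> indicator E x * S x + (M * Q) * indicator E x"
          by (simp add: algebra_simps)
      qed
    qed (use b in auto)
    finally show ?thesis .
  qed
  have "A * (L2_norm f)\<^sup>2 \<le> (1 / b) * V"
    using lower[OF f(1)] infsum_le_finite_sums[OF bessel_summable[OF bb f(1)] fsum] by linarith
  then have le: "b * A * measure lborel E \<le> V" using b unfolding nf by (simp add: field_simps)
  have Dx: "indicator E x * D x = b * A * indicator E x - (indicator E x * S x + (M * Q) * indicator E x)" for x
    by (simp add: D_def algebra_simps)
  have "AE x in lborel. x \<notin> E"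
  proof (rule pos_set_null[OF E])
    show "integrable lborel (\<lambda>x. indicator E x * D x)"
      unfolding Dx using iS iE by (intro Bochner_Integration.integrable_diff Bochner_Integration.integrable_add) auto
    have "(LINT x|lborel. indicator E x * D x) = b * A * measure lborel E - V"
      unfolding Dx V_def using iS iE
      by (subst Bochner_Integration.integral_diff) (auto intro!: Bochner_Integration.integrable_add)
    then show "(LINT x|lborel. indicator E x * D x) \<le> 0" using le by simp
  qed (simp add: E_def)
  then show ?thesis
    by (rule AE_mp) (auto intro!: AE_I2 simp: E_def D_def S_def M_def Q_def R_def not_less)
qed

text \<open>
  Shrinking the intervals makes the error in the local estimate tend to \<open>0\<close> at each point other
  than the origin. Countably many distances, lengths and positions suffice, so that the
  exceptional null sets can be collected into one.
\<close>

lemma calderon_lower: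
  assumes a: "a > 1" and b: "b > 0" and \<psi>: "\<psi> \<in> L2" and bb: "bessel_bound (wavelet_system a b \<psi>) B"
    and lower: "\<And>f. f \<in> L2 \<Longrightarrow> A * (L2_norm f)\<^sup>2 \<le> (\<Sum>\<^sub>\<infinity>i. (cmod (wcoeff a b \<psi> f i))\<^sup>2)"
    and C: "C \<ge> 0" and \<sigma>: "\<sigma> > 0"
    and decay: "AE \<gamma> in lborel. cmod (\<F> \<psi> \<gamma>) \<le> C / (1 + \<bar>\<gamma>\<bar> powr (1 + \<sigma>))"
  shows "AE \<gamma> in lborel. b * A \<le> calderon a (\<F> \<psi>) \<gamma>"
proof -
  define K1 where "K1 = 2 * C * (1 + b / \<sigma>) * C"
  define K2 where "K2 = a powr (1 + \<sigma>) / (a powr (1 + \<sigma>) - 1)"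
  define I where "I n m = {of_int m / real (Suc n)..<of_int m / real (Suc n) + 1 / real (Suc n)}" for n :: nat and m :: int
  define r where "r i n = (1 / real (Suc i)) / (b * (1 / real (Suc n)))" for i n
  have "AE \<gamma> in lborel. r i n \<ge> 1 \<longrightarrow> (\<forall>x\<in>I n m. 1 / real (Suc i) \<le> \<bar>x\<bar>) \<longrightarrow> \<gamma> \<in> I n m \<longrightarrow>
      b * A \<le> calderon a (\<F> \<psi>) \<gamma> + K1 * r i n powr (- (1 + \<sigma>)) * K2" for i n m
  proof (cases "r i n \<ge> 1 \<and> (\<forall>x\<in>I n m. 1 / real (Suc i) \<le> \<bar>x\<bar>)")
    case True
    then show ?thesis
      using calderon_lower_local[OF a b \<psi> bb lower C \<sigma> decay, of "1 / real (Suc i)" "1 / real (Suc n)" "of_int m / real (Suc n)"]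
      unfolding I_def r_def K1_def K2_def by (simp only: mult.assoc) simp
  qed auto
  then have "AE \<gamma> in lborel. \<forall>i n m. r i n \<ge> 1 \<longrightarrow> (\<forall>x\<in>I n m. 1 / real (Suc i) \<le> \<bar>x\<bar>) \<longrightarrow> \<gamma> \<in> I n m \<longrightarrow>
      b * A \<le> calderon a (\<F> \<psi>) \<gamma> + K1 * r i n powr (- (1 + \<sigma>)) * K2"
    unfolding AE_all_countable by blast
  then show ?thesis
    using AE_lborel_singleton[of 0]
  proof eventually_elim
    case (elim \<gamma>)
    note all = elim(1) and g0 = elim(2)
    obtain i where i: "1 / real (Suc i) < \<bar>\<gamma>\<bar> / 2"
      using reals_Archimedean[of "\<bar>\<gamma>\<bar> / 2"] g0 by (auto simp: inverse_eq_divide)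
    have r: "r i n = real (Suc n) * (1 / (b * real (Suc i)))" for n
      unfolding r_def by (simp add: field_simps)
    have pos: "1 / (b * real (Suc i)) > 0" using b by simp
    have lim: "filterlim (\<lambda>n. r i n) at_top sequentially"
      unfolding r
      by (rule filterlim_at_top_mult_tendsto_pos[OF tendsto_const pos])
         (rule filterlim_compose[OF filterlim_real_sequentially filterlim_Suc])
    have "(\<lambda>n. r i n powr (- (1 + \<sigma>))) \<longlonglongrightarrow> 0"
      by (rule tendsto_neg_powr[OF _ lim]) (use \<sigma> in simp)
    then have "(\<lambda>n. calderon a (\<F> \<psi>) \<gamma> + K1 * r i n powr (- (1 + \<sigma>)) * K2)
        \<longlonglongrightarrow> calderon a (\<F> \<psi>) \<gamma> + K1 * 0 * K2"
      by (intro tendsto_add tendsto_mult tendsto_const)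
    then have lim2: "(\<lambda>n. calderon a (\<F> \<psi>) \<gamma> + K1 * r i n powr (- (1 + \<sigma>)) * K2)
        \<longlonglongrightarrow> calderon a (\<F> \<psi>) \<gamma>" by simp
    have ev1: "eventually (\<lambda>n. r i n \<ge> 1) sequentially"
      using lim unfolding filterlim_at_top by blast
    have ev2: "eventually (\<lambda>n. n \<ge> i) sequentially" by (rule eventually_ge_at_top)
    have "eventually (\<lambda>n. b * A \<le> calderon a (\<F> \<psi>) \<gamma> + K1 * r i n powr (- (1 + \<sigma>)) * K2) sequentially"
      using ev1 ev2
    proof eventually_elim
      case (elim n)
      define m where "m = \<lfloor>\<gamma> * real (Suc n)\<rfloor>"
      have s: "real (Suc n) > 0" by simp
      have "of_int m \<le> \<gamma> * real (Suc n)" "\<gamma> * real (Suc n) < of_int m + 1"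
        unfolding m_def by linarith+
      then have "of_int m / real (Suc n) \<le> \<gamma>" "\<gamma> < (of_int m + 1) / real (Suc n)"
        unfolding pos_divide_le_eq[OF s] pos_less_divide_eq[OF s] .
      then have gI: "\<gamma> \<in> I n m" unfolding I_def by (simp add: add_divide_distrib)
      have d: "1 / real (Suc n) \<le> 1 / real (Suc i)" using elim(2) by (simp add: frac_le)
      have "1 / real (Suc i) \<le> \<bar>x\<bar>" if "x \<in> I n m" for x
      proof -
        have "\<bar>x - \<gamma>\<bar> \<le> 1 / real (Suc n)" using that gI unfolding I_def by auto
        then show ?thesis using d i by linarith
      qed
      then show ?case using all elim(1) gI by blast
    qed
    then show ?case
      by (intro tendsto_lowerbound[OF lim2]) auto
  qed
qed

section \<open>The exact dual of a band-limited generator\<close>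

text \<open>
  At each scale the polarized Parseval identity gives \<open>1 / b\<close> times the integral of the product of
  the transform of \<open>f\<close>, the conjugate transform of \<open>h\<close> and \<open>b |\<F> \<phi> (a\<^sup>-\<^sup>j x)|\<^sup>2\<close> over the Calderon
  sum of \<open>\<phi>\<close> at \<open>x\<close>. Over all scales these quotients sum to \<open>b\<close>, and dominated convergence allows the
  summation under the integral.
\<close>

lemma reconstruction:
  assumes a: "a > 0" and b: "b > 0" and \<phi>: "\<phi> \<in> L2" and \<phi>': "\<phi>' \<in> L2" and K: "2 * K < 1 / b" "K \<ge> 0"
    and supp: "AE \<gamma> in lborel. \<gamma> \<notin> {- K..K} \<longrightarrow> \<F> \<phi> \<gamma> = 0"
    and supp': "AE \<gamma> in lborel. \<gamma> \<notin> {- K..K} \<longrightarrow> \<F> \<phi>' \<gamma> = 0"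
    and bd: "AE \<gamma> in lborel. calderon_le a (\<F> \<phi>) Q \<gamma>"
    and bd': "AE \<gamma> in lborel. calderon_le a (\<F> \<phi>') Q' \<gamma>"
    and Q: "Q \<ge> 0" "Q' \<ge> 0"
    and dual: "AE \<gamma> in lborel. \<F> \<phi>' \<gamma> = of_real (b / calderon a (\<F> \<phi>) \<gamma>) * \<F> \<phi> \<gamma>"
    and pos: "AE \<gamma> in lborel. calderon a (\<F> \<phi>) \<gamma> > 0"
    and f: "f \<in> L2" and h: "h \<in> L2"
  shows "(\<Sum>\<^sub>\<infinity>i. wcoeff a b \<phi>' f i * cnj (wcoeff a b \<phi> h i)) = L2_inner f h"
proof -
  note [measurable] = L2_measurable[OF fourier_L2_L2[OF \<phi>]] L2_measurable[OF fourier_L2_L2[OF \<phi>']]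
    L2_measurable[OF fourier_L2_L2[OF f]] L2_measurable[OF fourier_L2_L2[OF h]]
  define S where "S = calderon a (\<F> \<phi>)"
  have [measurable]: "S \<in> borel_measurable borel" unfolding S_def by measurable
  have bd1: "AE \<gamma> in lborel. (cmod (\<F> \<phi> \<gamma>))\<^sup>2 \<le> Q"
    by (rule AE_single_scale[OF bd])
  have bd1': "AE \<gamma> in lborel. (cmod (\<F> \<phi>' \<gamma>))\<^sup>2 \<le> Q'"
    by (rule AE_single_scale[OF bd'])
  note sp = scale_prod_bandlimited[OF a b h \<phi> K supp bd1]
  note sp' = scale_prod_bandlimited[OF a b f \<phi>' K supp' bd1']
  note B = bessel_bandlimited[OF a b \<phi> K supp bd Q(1)]
  note B' = bessel_bandlimited[OF a b \<phi>' K supp' bd' Q(2)]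
  define P where "P i = wcoeff a b \<phi>' f i * cnj (wcoeff a b \<phi> h i)" for i
  have "(\<lambda>i. norm (P i)) summable_on UNIV"
    unfolding P_def by (intro ell2_product_summable analysis_ell2[OF B h] analysis_ell2[OF B' f])
  then have "P summable_on UNIV" by (rule abs_summable_summable)
  then have "(P has_sum infsum P UNIV) (Sigma UNIV (\<lambda>_. UNIV))" by simp
  then have outer: "((\<lambda>j. of_real (1 / b) * L2_inner (scale_prod a f \<phi>' j) (scale_prod a h \<phi> j)) has_sum infsum P UNIV) UNIV"
  proof (rule has_sum_SigmaD)
    show "((\<lambda>k. P (j, k)) has_sum of_real (1 / b) * L2_inner (scale_prod a f \<phi>' j) (scale_prod a h \<phi> j)) UNIV" for j
      unfolding P_def by (rule scale_parseval[OF a b f h \<phi>' \<phi> sp'(1) sp(1) sp'(2) sp(2)])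
  qed
  define F where "F x = \<F> f x * cnj (\<F> h x)" for x
  have F: "integrable lborel F"
    unfolding F_def by (rule integrable_mult_cnj_L2[OF fourier_L2_L2[OF f] fourier_L2_L2[OF h]])
  have [measurable]: "F \<in> borel_measurable borel" unfolding F_def by measurable
  define e where "e j x = energy a \<phi> j x" for j :: int and x
  have [measurable]: "e j \<in> borel_measurable borel" for j unfolding e_def by measurable
  have prod: "AE x in lborel. scale_prod a f \<phi>' j x * cnj (scale_prod a h \<phi> j x) = F x * of_real (b * e j x / S x)" for j
  proof -
    have "AE x in lborel. \<F> \<phi>' (a powi (- j) * x) =
        of_real (b / calderon a (\<F> \<phi>) (a powi (- j) * x)) * \<F> \<phi> (a powi (- j) * x)"
      by (rule AE_scale[OF dual]) (use a in auto)
    then show ?thesis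
    proof (rule AE_mp, intro AE_I2 impI)
      fix x assume d: "\<F> \<phi>' (a powi (- j) * x) =
        of_real (b / calderon a (\<F> \<phi>) (a powi (- j) * x)) * \<F> \<phi> (a powi (- j) * x)"
      have c: "calderon a (\<F> \<phi>) (a powi (- j) * x) = S x"
        unfolding S_def by (rule calderon_shift) (use a in simp)
      have "of_real (e j x) = cnj (\<F> \<phi> (a powi (- j) * x)) * \<F> \<phi> (a powi (- j) * x)"
        unfolding e_def complex_norm_square by (rule mult.commute)
      then show "scale_prod a f \<phi>' j x * cnj (scale_prod a h \<phi> j x) = F x * of_real (b * e j x / S x)"
        unfolding scale_prod_def d c F_def by (simp add: mult_ac)
    qed
  qed
  have part: "(\<Sum>i<n. of_real (1 / b) * L2_inner (scale_prod a f \<phi>' (int_decode i)) (scale_prod a h \<phi> (int_decode i)))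
      = (LINT x|lborel. F x * of_real ((\<Sum>i<n. e (int_decode i) x) / S x))" for n
  proof -
    have int: "integrable lborel (\<lambda>x. F x * of_real (b * e j x / S x))" for j
    proof (rule integrable_cong_AE_imp)
      show "integrable lborel (\<lambda>x. scale_prod a f \<phi>' j x * cnj (scale_prod a h \<phi> j x))"
        by (rule integrable_mult_cnj_L2[OF sp'(1) sp(1)])
      show "AE x in lborel. scale_prod a f \<phi>' j x * cnj (scale_prod a h \<phi> j x) = F x * of_real (b * e j x / S x)"
        by (rule prod)
    qed measurable
    have eqI: "L2_inner (scale_prod a f \<phi>' j) (scale_prod a h \<phi> j) = (LINT x|lborel. F x * of_real (b * e j x / S x))" for j
      unfolding L2_inner_def
      using int borel_measurable_integrable[OF integrable_mult_cnj_L2[OF sp'(1) sp(1)]]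
      by (intro integral_cong_AE prod) auto
    have "(\<Sum>i<n. of_real (1 / b) * L2_inner (scale_prod a f \<phi>' (int_decode i)) (scale_prod a h \<phi> (int_decode i)))
        = (\<Sum>i<n. LINT x|lborel. of_real (1 / b) * (F x * of_real (b * e (int_decode i) x / S x)))"
      by (simp only: eqI Bochner_Integration.integral_mult_right_zero)
    also have "\<dots> = (LINT x|lborel. (\<Sum>i<n. of_real (1 / b) * (F x * of_real (b * e (int_decode i) x / S x))))"
      by (rule Bochner_Integration.integral_sum[symmetric]) (rule Bochner_Integration.integrable_mult_right, rule int)
    also have "(\<lambda>x. \<Sum>i<n. of_real (1 / b) * (F x * of_real (b * e (int_decode i) x / S x)))
        = (\<lambda>x. F x * of_real ((\<Sum>i<n. e (int_decode i) x) / S x))"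
      using b by (simp add: sum_distrib_left sum_divide_distrib field_simps)
    finally show ?thesis .
  qed
  have "(\<lambda>n. \<Sum>i<n. of_real (1 / b) * L2_inner (scale_prod a f \<phi>' (int_decode i)) (scale_prod a h \<phi> (int_decode i)))
      \<longlonglongrightarrow> infsum P UNIV"
  proof -
    have "((\<lambda>i. of_real (1 / b) * L2_inner (scale_prod a f \<phi>' (int_decode i)) (scale_prod a h \<phi> (int_decode i))) has_sum infsum P UNIV) UNIV"
      using outer by (subst has_sum_reindex_bij_betw[OF bij_int_decode,
          where f = "\<lambda>j. of_real (1 / b) * L2_inner (scale_prod a f \<phi>' j) (scale_prod a h \<phi> j)"])
    then show ?thesis using has_sum_imp_sums unfolding sums_def by blast
  qed
  moreover have "(\<lambda>n. LINT x|lborel. F x * of_real ((\<Sum>i<n. e (int_decode i) x) / S x)) \<longlonglongrightarrow> (LINT x|lborel. F x)"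
  proof (rule integral_dominated_convergence)
    show "integrable lborel (\<lambda>x. cmod (F x))" using F by simp
    have good: "AE x in lborel. S x > 0 \<and> (calderon_le a (\<F> \<phi>) Q x)"
      using pos bd unfolding S_def by simp
    have eS: "(\<Sum>i<n. e (int_decode i) x) \<le> S x"
      if "calderon_le a (\<F> \<phi>) Q x" for n x
    proof -
      have "inj_on int_decode {..<n}" using bij_int_decode by (meson bij_is_inj inj_on_subset subset_UNIV)
      then have "(\<Sum>i<n. e (int_decode i) x) = (\<Sum>j\<in>int_decode ` {..<n}. e j x)"
        by (simp add: sum.reindex)
      also have "\<dots> \<le> S x"
        unfolding e_def S_def sum_scales_uminus[of "\<lambda>y. (cmod (\<F> \<phi> y))\<^sup>2"]
        using that by (intro calderon_bounds(3)[where Q = Q]) auto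
      finally show ?thesis .
    qed
    show "AE x in lborel. norm (F x * of_real ((\<Sum>i<n. e (int_decode i) x) / S x)) \<le> cmod (F x)" for n
      using good
    proof (rule AE_mp, intro AE_I2 impI)
      fix x assume g: "S x > 0 \<and> (calderon_le a (\<F> \<phi>) Q x)"
      have "0 \<le> (\<Sum>i<n. e (int_decode i) x)" unfolding e_def by (intro sum_nonneg) auto
      then have "\<bar>(\<Sum>i<n. e (int_decode i) x) / S x\<bar> \<le> 1"
        using g eS[of x n] by (simp add: divide_le_eq)
      then show "norm (F x * of_real ((\<Sum>i<n. e (int_decode i) x) / S x)) \<le> cmod (F x)"
        unfolding norm_mult norm_of_real by (intro mult_left_le) auto
    qed
    show "AE x in lborel. (\<lambda>n. F x * of_real ((\<Sum>i<n. e (int_decode i) x) / S x)) \<longlonglongrightarrow> F x"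
      using good
    proof (rule AE_mp, intro AE_I2 impI)
      fix x assume g: "S x > 0 \<and> (calderon_le a (\<F> \<phi>) Q x)"
      have sm: "(\<lambda>k::int. (cmod (\<F> \<phi> (a powi k * x)))\<^sup>2) summable_on UNIV"
        using g by (intro calderon_bounds(1)[where Q = Q]) auto
      have "bij (\<lambda>n. - int_decode n)"
        using bij_comp[OF bij_int_decode bij_uminus] by (simp add: comp_def)
      then have "((\<lambda>n. (cmod (\<F> \<phi> (a powi (- int_decode n) * x)))\<^sup>2) has_sum S x) UNIV"
        using sm unfolding S_def calderon_def
        by (subst has_sum_reindex_bij_betw[where f = "\<lambda>k. (cmod (\<F> \<phi> (a powi k * x)))\<^sup>2"]) auto
      then have "(\<lambda>n. \<Sum>i<n. e (int_decode i) x) \<longlonglongrightarrow> S x"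
        using has_sum_imp_sums unfolding sums_def e_def by blast
      then have "(\<lambda>n. F x * of_real ((\<Sum>i<n. e (int_decode i) x) / S x)) \<longlonglongrightarrow> F x * of_real (S x / S x)"
        using g by (intro tendsto_mult tendsto_const tendsto_of_real tendsto_divide) auto
      then show "(\<lambda>n. F x * of_real ((\<Sum>i<n. e (int_decode i) x) / S x)) \<longlonglongrightarrow> F x"
        using g by simp
    qed
  qed measurable
  ultimately have "infsum P UNIV = (LINT x|lborel. F x)"
    unfolding part by (rule LIMSEQ_unique)
  also have "\<dots> = L2_inner (\<F> f) (\<F> h)"
    by (simp add: L2_inner_def F_def)
  also have "\<dots> = L2_inner f h"
    by (rule fourier_L2_inner[OF f h])
  finally show ?thesis unfolding P_def .
qed

section \<open>Approximate duals and the size of the tail\<close>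

lemma eps_K_nonneg: "C > 0 \<Longrightarrow> a > 1 \<Longrightarrow> b > 0 \<Longrightarrow> \<sigma> > 0 \<Longrightarrow> 0 \<le> eps_K a b C \<sigma> K"
  unfolding eps_K_def by (intro mult_nonneg_nonneg real_sqrt_ge_zero) (auto simp: gr_one_powr less_imp_le)

lemma eps_K_sq:
  assumes "a > 1" "b > 0" "\<sigma> > 0"
  shows "(eps_K a b C \<sigma> K)\<^sup>2 = (real K + 1 / b) / real K powr (3 + 2 * \<sigma>) * (2 * C)\<^sup>2 *
     ((1 + 1 / (2 * \<sigma>)) * (a powr (1 + \<sigma>) / (a powr (1 + \<sigma>) - 1)))"
proof -
  have q: "a powr (1 + \<sigma>) > 1" using assms by (simp add: gr_one_powr)
  then have q': "0 \<le> a powr (1 + \<sigma>) - 1" by linarith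
  have "0 \<le> (real K + 1 / b) / real K powr (3 + 2 * \<sigma>)" using assms by simp
  moreover have "0 \<le> (1 + 1 / (2 * \<sigma>)) * (a powr (1 + \<sigma>) / (a powr (1 + \<sigma>) - 1))"
    by (intro mult_nonneg_nonneg divide_nonneg_nonneg q') (use assms in auto)
  ultimately show ?thesis unfolding eps_K_def power_mult_distrib by (simp only: real_sqrt_pow2)
qed

lemma eps_K_tendsto_0:
  assumes "b > 0" "\<sigma> > 0"
  shows "(\<lambda>K. eps_K a b C \<sigma> K) \<longlonglongrightarrow> 0"
proof -
  have "(\<lambda>K. (real K + 1 / b) / real K powr (3 + 2 * \<sigma>)) \<longlonglongrightarrow> 0"
  proof (rule Lim_null_comparison)
    show "\<forall>\<^sub>F K in sequentially. norm ((real K + 1 / b) / real K powr (3 + 2 * \<sigma>)) \<le> (1 + 1 / b) / real K"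
      using eventually_ge_at_top[of 1]
    proof eventually_elim
      case (elim K)
      have K: "real K \<ge> 1" using elim by simp
      have "real K powr 2 \<le> real K powr (3 + 2 * \<sigma>)"
        using K assms by (intro powr_mono) auto
      then have K2: "real K * real K \<le> real K powr (3 + 2 * \<sigma>)"
        using K by (simp add: power2_eq_square)
      have "(real K + 1 / b) / real K powr (3 + 2 * \<sigma>) \<le> (real K + 1 / b) / (real K * real K)"
        using K2 K assms by (intro divide_left_mono) (auto intro!: mult_pos_pos add_pos_pos)
      also have "\<dots> \<le> ((1 + 1 / b) * real K) / (real K * real K)"
        using K assms by (intro divide_right_mono) (auto simp: field_simps)
      also have "\<dots> = (1 + 1 / b) / real K" using K by simp
      finally show ?case using assms by simp
    qed
    show "(\<lambda>K. (1 + 1 / b) / real K) \<longlonglongrightarrow> 0"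
      by (rule lim_const_over_n)
  qed
  then have "(\<lambda>K. sqrt ((real K + 1 / b) / real K powr (3 + 2 * \<sigma>))) \<longlonglongrightarrow> sqrt 0"
    by (rule tendsto_real_sqrt)
  then have "(\<lambda>K. eps_K a b C \<sigma> K) \<longlonglongrightarrow> sqrt 0 * (2 * C) *
     sqrt ((1 + 1 / (2 * \<sigma>)) * (a powr (1 + \<sigma>) / (a powr (1 + \<sigma>) - 1)))"
    unfolding eps_K_def by (intro tendsto_mult tendsto_const)
  then show ?thesis by simp
qed

text \<open>
  As \<^const>\<open>eps_K\<close> tends to \<open>0\<close>, it is eventually below \<open>x \<epsilon> / (1 + \<epsilon>)\<close> with \<open>x = sqrt (2 b A)\<close>. This single
  bound gives both conditions.
\<close>

lemma eps_K_exists: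
  assumes "a > 1" "b > 0" "\<sigma> > 0" "C > 0" "A > 0" "\<epsilon> > 0"
  shows "\<exists>K\<ge>1. eps_K a b C \<sigma> K < sqrt (2 * b * A) \<and>
            eps_K a b C \<sigma> K / (sqrt (2 * b * A) - eps_K a b C \<sigma> K) \<le> \<epsilon>"
proof -
  define x where "x = sqrt (2 * b * A)"
  have x: "x > 0" unfolding x_def using assms by simp
  have "x * \<epsilon> / (1 + \<epsilon>) > 0" using x assms by simp
  then have "\<forall>\<^sub>F K in sequentially. eps_K a b C \<sigma> K < x * \<epsilon> / (1 + \<epsilon>)"
    using order_tendstoD(2)[OF eps_K_tendsto_0[OF assms(2,3)]] by blast
  moreover have "\<forall>\<^sub>F K in sequentially. (1::nat) \<le> K" by (rule eventually_ge_at_top)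
  ultimately have "\<forall>\<^sub>F K in sequentially. eps_K a b C \<sigma> K < x * \<epsilon> / (1 + \<epsilon>) \<and> 1 \<le> K"
    by (rule eventually_conj)
  then obtain K where K: "eps_K a b C \<sigma> K < x * \<epsilon> / (1 + \<epsilon>)" "1 \<le> K"
    using eventually_happens'[OF sequentially_bot] by blast
  have e: "eps_K a b C \<sigma> K * (1 + \<epsilon>) < x * \<epsilon>"
    using K(1) assms by (simp add: pos_less_divide_eq)
  have "eps_K a b C \<sigma> K * (1 + \<epsilon>) < x * (1 + \<epsilon>)" using e x assms by (simp add: distrib_left)
  then have lt: "eps_K a b C \<sigma> K < x" using assms by (simp add: mult_less_cancel_right)
  then have "eps_K a b C \<sigma> K / (x - eps_K a b C \<sigma> K) \<le> \<epsilon>"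
    using e by (simp add: pos_divide_le_eq algebra_simps)
  then show ?thesis using lt K(2) unfolding x_def by blast
qed

text \<open>
  If \<open>V\<close> is an exact dual of \<open>F\<close> and \<open>F\<close> is perturbed to \<open>G = F + H\<close>, then the error \<open>u\<close> of the
  reconstruction of \<open>f\<close> satisfies \<open>\<langle>u, h\<rangle> = - \<Sum>i. \<langle>f, V i\<rangle> \<langle>H i, h\<rangle>\<close>, which is bounded by the Bessel bounds
  of \<open>V\<close> and \<open>H\<close> alone. Take \<open>h = u\<close>.
\<close>

lemma approximate_dual_bound:
  fixes F G H V :: "'i::countable \<Rightarrow> real \<Rightarrow> complex"
  assumes H: "bessel_bound H B1" and V: "bessel_bound V B2" and F: "bessel_bound F B3"
    and G: "\<And>i. G i = (\<lambda>x. F i x + H i x)"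
    and rec: "\<And>f h. f \<in> L2 \<Longrightarrow> h \<in> L2 \<Longrightarrow>
      (\<Sum>\<^sub>\<infinity>i. L2_inner f (V i) * cnj (L2_inner h (F i))) = L2_inner f h"
  shows "L2_opnorm (\<lambda>f x. f x - synthesis G (L2_adjoint (synthesis V) f) x) \<le> ereal (sqrt (B2 * B1))"
  unfolding L2_opnorm_def
proof (rule SUP_least)
  fix f assume "f \<in> {f \<in> L2. L2_norm f \<le> 1}"
  then have f: "f \<in> L2" and f1: "L2_norm f \<le> 1" by auto
  have GB: "bessel_bound G (2 * B3 + 2 * B1)" by (rule bessel_bound_add[OF F H G])
  define c where "c i = L2_inner f (V i)" for i
  have c: "c \<in> ell2" unfolding c_def[abs_def] by (rule analysis_ell2[OF V f])
  have adj: "L2_adjoint (synthesis V) f = c"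
    unfolding c_def[abs_def] by (rule adjoint_synthesis[OF V f])
  define u where "u = (\<lambda>x. f x - synthesis G c x)"
  have s: "synthesis G c \<in> L2" by (rule synthesis_L2(1)[OF GB c])
  have u: "u \<in> L2" unfolding u_def by (rule L2_diff[OF f s])
  have inner: "L2_inner u h = - (\<Sum>\<^sub>\<infinity>i. c i * cnj (L2_inner h (H i)))" if h: "h \<in> L2" for h
  proof -
    have sF: "(\<lambda>i. c i * cnj (L2_inner h (F i))) summable_on UNIV"
      by (rule abs_summable_summable[OF ell2_product_summable[OF c analysis_ell2[OF F h]]])
    have sH: "(\<lambda>i. c i * cnj (L2_inner h (H i))) summable_on UNIV"
      by (rule abs_summable_summable[OF ell2_product_summable[OF c analysis_ell2[OF H h]]])
    have "L2_inner (synthesis G c) h = (\<Sum>\<^sub>\<infinity>i. c i * cnj (L2_inner h (G i)))"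
      using infsumI[OF synthesis_L2(2)[OF GB c h]] by simp
    also have "\<dots> = (\<Sum>\<^sub>\<infinity>i. c i * cnj (L2_inner h (F i)) + c i * cnj (L2_inner h (H i)))"
      unfolding G L2_inner_add_right[OF bessel_boundD(2)[OF F] bessel_boundD(2)[OF H] h]
      by (simp add: distrib_left)
    also have "\<dots> = L2_inner f h + (\<Sum>\<^sub>\<infinity>i. c i * cnj (L2_inner h (H i)))"
      unfolding infsum_add[OF sF sH] using rec[OF f h] by (simp add: c_def)
    finally show ?thesis unfolding u_def by (simp add: L2_inner_diff_left f s h)
  qed
  have "(L2_norm u)\<^sup>2 = cmod (L2_inner u u)"
    by (simp add: L2_inner_self del: of_real_power)
  also have "\<dots> \<le> sqrt (B2 * B1) * L2_norm f * L2_norm u"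
    unfolding inner[OF u] norm_minus_cancel c_def by (rule bessel_product_infsum_le[OF V H f u])
  also have "\<dots> \<le> sqrt (B2 * B1) * 1 * L2_norm u"
    using f1 bessel_boundD(1)[OF V] bessel_boundD(1)[OF H]
    by (intro mult_right_mono mult_left_mono) auto
  finally have "L2_norm u * L2_norm u \<le> sqrt (B2 * B1) * L2_norm u" by (simp add: power2_eq_square)
  then have "L2_norm u \<le> sqrt (B2 * B1)"
    using L2_norm_nonneg[of u] bessel_boundD(1)[OF V] bessel_boundD(1)[OF H]
    by (cases "L2_norm u = 0") (auto simp: mult_le_cancel_right)
  then show "ereal (L2_norm (\<lambda>x. f x - synthesis G (L2_adjoint (synthesis V) f) x)) \<le> ereal (sqrt (B2 * B1))"
    unfolding adj u_def by simp
qed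

text \<open>
  The constants of the tail lemma for translation step \<open>1 / L\<close>. The condition \<open>2 K \<le> L\<close> turns the
  integral part of the lattice sum into the factor \<open>1 + 1 / (2 \<sigma>)\<close> of \<^const>\<open>eps_K\<close>. The factor \<open>K + 1 / b\<close>
  in \<^const>\<open>eps_K\<close> is larger than the \<open>K\<close> that the estimate produces.
\<close>

lemma tail_constants_le:
  assumes a: "a > 1" and b: "b > 0" and \<sigma>: "\<sigma> > 0" and C: "C > 0" and K: "K \<ge> 1" and L: "2 * real K \<le> L"
  shows "2 * C * (real K powr (- (1 + \<sigma>)) + real K powr (- \<sigma>) / (\<sigma> * L)) *
      (C * real K powr (- (1 + \<sigma>)) * (a powr (1 + \<sigma>) / (a powr (1 + \<sigma>) - 1)))
    \<le> (eps_K a b C \<sigma> K)\<^sup>2 / 2"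
proof -
  define k where "k = real K"
  have k: "k \<ge> 1" "k > 0" using K by (auto simp: k_def)
  define q where "q = a powr (1 + \<sigma>) / (a powr (1 + \<sigma>) - 1)"
  have q: "q > 0"
    unfolding q_def using gr_one_powr[OF a, of "1 + \<sigma>"] \<sigma> by (intro divide_pos_pos) auto
  have "k powr (- \<sigma>) / (\<sigma> * L) \<le> k powr (- \<sigma>) / (\<sigma> * (2 * k))"
    using L k \<sigma> unfolding k_def[symmetric] by (intro divide_left_mono mult_left_mono) (auto intro!: mult_pos_pos)
  also have "\<dots> = k powr (- (1 + \<sigma>)) * (1 / (2 * \<sigma>))"
  proof -
    have "k powr (- \<sigma>) = k powr (- (1 + \<sigma>)) * k"
      using k powr_add[of k "- (1 + \<sigma>)" 1] by simp
    then show ?thesis using k \<sigma> by simp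
  qed
  finally have "2 * C * (k powr (- (1 + \<sigma>)) + k powr (- \<sigma>) / (\<sigma> * L))
      \<le> 2 * C * (k powr (- (1 + \<sigma>)) * (1 + 1 / (2 * \<sigma>)))"
    using C by (intro mult_left_mono) (auto simp: distrib_left)
  then have "2 * C * (k powr (- (1 + \<sigma>)) + k powr (- \<sigma>) / (\<sigma> * L)) * (C * k powr (- (1 + \<sigma>)) * q)
      \<le> 2 * C * (k powr (- (1 + \<sigma>)) * (1 + 1 / (2 * \<sigma>))) * (C * k powr (- (1 + \<sigma>)) * q)"
    by (rule mult_right_mono) (use C q in auto)
  also have "\<dots> = (k powr (- (1 + \<sigma>)) * k powr (- (1 + \<sigma>))) * (2 * C\<^sup>2 * ((1 + 1 / (2 * \<sigma>)) * q))"
    unfolding power2_eq_square by (simp only: mult_ac)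
  also have "\<dots> \<le> ((k + 1 / b) / k powr (3 + 2 * \<sigma>)) * (2 * C\<^sup>2 * ((1 + 1 / (2 * \<sigma>)) * q))"
  proof (rule mult_right_mono)
    have "k powr (- (1 + \<sigma>)) * k powr (- (1 + \<sigma>)) = k powr (1 - (3 + 2 * \<sigma>))"
      by (simp add: powr_add[symmetric])
    also have "\<dots> = k / k powr (3 + 2 * \<sigma>)" using k unfolding powr_diff by simp
    also have "\<dots> \<le> (k + 1 / b) / k powr (3 + 2 * \<sigma>)" using b by (intro divide_right_mono) auto
    finally show "k powr (- (1 + \<sigma>)) * k powr (- (1 + \<sigma>)) \<le> (k + 1 / b) / k powr (3 + 2 * \<sigma>)" .
    show "0 \<le> 2 * C\<^sup>2 * ((1 + 1 / (2 * \<sigma>)) * q)"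
      using q \<sigma> by (intro mult_nonneg_nonneg) auto
  qed
  also have "\<dots> = (eps_K a b C \<sigma> K)\<^sup>2 / 2"
  proof -
    have "p * (2 * C\<^sup>2 * r) = p * (2 * C)\<^sup>2 * r / 2" for p r :: real
      by (simp add: power2_eq_square)
    then show ?thesis unfolding eps_K_sq[OF a b \<sigma>] k_def q_def .
  qed
  finally show ?thesis unfolding k_def q_def .
qed

text \<open>
  Since \<open>(x\<^sup>2 - y\<^sup>2) / 2 \<ge> (x - y)\<^sup>2 / 2\<close> for \<open>0 \<le> y < x\<close>.
\<close>

lemma perturbation_ratio:
  fixes x y t :: real
  assumes "0 \<le> y" "y < x" "t \<le> y\<^sup>2 / 2"
  shows "sqrt (t / ((x\<^sup>2 - y\<^sup>2) / 2)) \<le> y / (x - y)"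
proof -
  have S: "(x\<^sup>2 - y\<^sup>2) / 2 = (x - y) * (x + y) / 2"
    by (simp add: power2_eq_square algebra_simps)
  have pos: "(x - y) * (x + y) / 2 > 0" using assms by simp
  have "t / ((x - y) * (x + y) / 2) \<le> (y\<^sup>2 / 2) / ((x - y) * (x + y) / 2)"
    using assms(3) pos by (intro divide_right_mono) auto
  also have "\<dots> \<le> (y\<^sup>2 / 2) / ((x - y) * (x - y) / 2)"
    using assms by (intro divide_left_mono divide_right_mono mult_left_mono mult_pos_pos divide_pos_pos) auto
  also have "\<dots> = (y / (x - y))\<^sup>2"
    by (simp add: power2_eq_square)
  finally have "sqrt (t / ((x\<^sup>2 - y\<^sup>2) / 2)) \<le> sqrt ((y / (x - y))\<^sup>2)"
    unfolding S by (rule real_sqrt_le_mono)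
  also have "\<dots> = y / (x - y)" using assms by simp
  finally show ?thesis .
qed

theorem corollary3p4:
  fixes a b A B C \<sigma> \<epsilon> :: real and \<psi> :: "real \<Rightarrow> complex"
  assumes "a > 1" and "b > 0" and "\<psi> \<in> L2"
    and "A > 0" and "frame_with_bounds (wavelet_system a b \<psi>) A B"
    and "C > 0" and "\<sigma> > 0"
    and "AE \<gamma> in lborel. cmod (fourier_L2 \<psi> \<gamma>) \<le> C / (1 + \<bar>\<gamma>\<bar> powr (1 + \<sigma>))"
    and "\<epsilon> > 0"
  shows "(\<exists>K\<ge>1. eps_K a b C \<sigma> K < sqrt (2 * b * A) \<and>
            eps_K a b C \<sigma> K / (sqrt (2 * b * A) - eps_K a b C \<sigma> K) \<le> \<epsilon>) \<and>
    (\<forall>(K::nat) (N::int).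
       K \<ge> 1 \<longrightarrow>
       eps_K a b C \<sigma> K < sqrt (2 * b * A) \<longrightarrow>
       eps_K a b C \<sigma> K / (sqrt (2 * b * A) - eps_K a b C \<sigma> K) \<le> \<epsilon> \<longrightarrow>
       odd N \<longrightarrow> of_int N - 2 \<le> 2 * b * real K \<longrightarrow> 2 * b * real K < of_int N \<longrightarrow>
       (\<exists>\<psi>K. is_truncation K \<psi> \<psi>K) \<and>
       (\<forall>\<psi>K. is_truncation K \<psi> \<psi>K \<longrightarrow>
          (\<exists>\<psi>t. is_tilde a b N \<psi>K \<psi>t) \<and>
          (\<forall>\<psi>t. is_tilde a b N \<psi>K \<psi>t \<longrightarrow>
             Bessel_seq (wavelet_system a (b / of_int N) \<psi>) \<and>
             Bessel_seq (wavelet_system a (b / of_int N) \<psi>t) \<and>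
             (let U = synthesis (wavelet_system a (b / of_int N) \<psi>);
                  W = synthesis (wavelet_system a (b / of_int N) \<psi>t)
              in L2_opnorm (\<lambda>f x. f x - U (L2_adjoint W f) x) \<le> ereal \<epsilon>))))"
    (is "?ex \<and> (\<forall>K N. _ \<longrightarrow> _ \<longrightarrow> _ \<longrightarrow> _ \<longrightarrow> _ \<longrightarrow> _ \<longrightarrow> ?concl K N)")
proof
  note a = assms(1) and b = assms(2) and \<psi> = assms(3) and A = assms(4) and C = assms(6) and \<sigma> = assms(7)
  note decay = assms(8)
  have a0: "a > 0" using a by simp
  show ?ex by (rule eps_K_exists[OF a b \<sigma> C A assms(9)])
  note fr = assms(5)[unfolded frame_with_bounds_def]
  have bb: "bessel_bound (wavelet_system a b \<psi>) B"
    unfolding bessel_bound_def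
  proof (intro conjI ballI allI impI)
    show "0 \<le> B" using fr by simp
    show "wavelet_system a b \<psi> i \<in> L2" for i using fr by blast
    fix f and S :: "(int \<times> int) set" assume f: "f \<in> L2" and S: "finite S"
    have "(\<Sum>i\<in>S. (cmod (wcoeff a b \<psi> f i))\<^sup>2)
        \<le> (\<Sum>\<^sub>\<infinity>i. (cmod (wcoeff a b \<psi> f i))\<^sup>2)"
      using fr f S by (intro finite_sum_le_infsum) auto
    then show "(\<Sum>i\<in>S. (cmod (wcoeff a b \<psi> f i))\<^sup>2) \<le> B * (L2_norm f)\<^sup>2"
      using fr f by fastforce
  qed
  have B0: "B \<ge> 0" using fr by simp
  have lowb: "AE \<gamma> in lborel. b * A \<le> calderon a (\<F> \<psi>) \<gamma>"
    by (rule calderon_lower[OF a b \<psi> bb _ less_imp_le[OF C] \<sigma> decay]) (use fr in blast)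
  have upb: "AE \<gamma> in lborel. calderon_le a (\<F> \<psi>) (b * B) \<gamma>"
    by (rule calderon_upper[OF a0 b \<psi> bb])
  show "\<forall>(K::nat) (N::int). K \<ge> 1 \<longrightarrow> eps_K a b C \<sigma> K < sqrt (2 * b * A) \<longrightarrow>
       eps_K a b C \<sigma> K / (sqrt (2 * b * A) - eps_K a b C \<sigma> K) \<le> \<epsilon> \<longrightarrow>
       odd N \<longrightarrow> of_int N - 2 \<le> 2 * b * real K \<longrightarrow> 2 * b * real K < of_int N \<longrightarrow> ?concl K N"
  proof (intro allI impI)
    fix K :: nat and N :: int
    assume K1: "K \<ge> 1" and eps1: "eps_K a b C \<sigma> K < sqrt (2 * b * A)"
      and eps2: "eps_K a b C \<sigma> K / (sqrt (2 * b * A) - eps_K a b C \<sigma> K) \<le> \<epsilon>"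
      and N2: "2 * b * real K < of_int N"
    define k where "k = real K"
    have k: "k \<ge> 1" "k > 0" using K1 by (auto simp: k_def)
    have N0: "real_of_int N > 0"
    proof -
      have "0 < 2 * b * real K" using b K1 by simp
      then show ?thesis using N2 by linarith
    qed
    define b' where "b' = b / of_int N"
    have b': "b' > 0" using b N0 by (simp add: b'_def)
    have K2: "2 * k < 1 / b'" using N2 b N0 by (simp add: b'_def k_def field_simps)
    define e where "e = (eps_K a b C \<sigma> K)\<^sup>2 / 2"
    have e0: "e \<ge> 0" by (simp add: e_def)
    define Q where "Q = C * k powr (- (1 + \<sigma>)) * (a powr (1 + \<sigma>) / (a powr (1 + \<sigma>) - 1))"
    define M where "M = 2 * C * (k powr (- (1 + \<sigma>)) + k powr (- \<sigma>) / (\<sigma> * (1 / b')))"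
    have q: "a powr (1 + \<sigma>) / (a powr (1 + \<sigma>) - 1) > 0"
      using gr_one_powr[OF a, of "1 + \<sigma>"] \<sigma> by (intro divide_pos_pos) auto
    have Q0: "Q > 0" unfolding Q_def using C k q by (intro mult_pos_pos) auto
    \<comment> \<open>the lattice spacing N / b is at least 2 K because 2 b K < N\<close>
    have MQ: "M * Q \<le> e"
      using tail_constants_le[OF a b \<sigma> C K1, of "1 / b'"] K2 unfolding M_def Q_def e_def k_def by simp
    define S0 where "S0 = b * A - e"
    define x where "x = sqrt (2 * b * A)"
    define y where "y = eps_K a b C \<sigma> K"
    have y0: "0 \<le> y" unfolding y_def by (rule eps_K_nonneg[OF C a b \<sigma>])
    have xy: "y < x" "y / (x - y) \<le> \<epsilon>" using eps1 eps2 by (auto simp: x_def y_def)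
    have x2: "x\<^sup>2 = 2 * b * A" unfolding x_def using b A by simp
    have S0: "S0 = (x\<^sup>2 - y\<^sup>2) / 2"
      unfolding S0_def e_def y_def[symmetric] x2 by simp
    have S0pos: "S0 > 0"
      unfolding S0 using power_strict_mono[OF xy(1) y0, of 2] by simp
    have ratio: "sqrt ((b' / S0) * (M * Q / b')) \<le> \<epsilon>"
    proof -
      have "sqrt (M * Q / S0) \<le> y / (x - y)"
        unfolding S0 by (rule perturbation_ratio[OF y0 xy(1)]) (use MQ in \<open>simp add: e_def y_def\<close>)
      then show ?thesis using xy(2) b' by simp
    qed
    show "?concl K N"
    proof (intro conjI allI impI)
      show "\<exists>\<psi>K. is_truncation K \<psi> \<psi>K"
        unfolding is_truncation_def
        using fourier_L2_surj[OF L2_mult_indicator[OF fourier_L2_L2[OF \<psi>], of "{- real K..real K}"]] by auto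
    next
      fix \<psi>K assume tr: "is_truncation K \<psi> \<psi>K"
      then have \<psi>K: "\<psi>K \<in> L2"
        and trunc: "AE \<gamma> in lborel. \<F> \<psi>K \<gamma> = \<F> \<psi> \<gamma> * indicator {- k..k} \<gamma>"
        by (auto simp: is_truncation_def k_def)
      note [measurable] = L2_measurable[OF fourier_L2_L2[OF \<psi>K]]
      define S where "S = calderon a (\<F> \<psi>K)"
      have [measurable]: "S \<in> borel_measurable borel" unfolding S_def by measurable
      define \<phi> where "\<phi> = (\<lambda>x. \<psi> x - \<psi>K x)"
      have \<phi>: "\<phi> \<in> L2" unfolding \<phi>_def by (rule L2_diff[OF \<psi> \<psi>K])
      have \<phi>hat: "AE \<gamma> in lborel. \<F> \<phi> \<gamma> = \<F> \<psi> \<gamma> - \<F> \<psi>K \<gamma>"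
        using fourier_L2_AE[OF is_FT_linear[OF is_FT_fourier_L2[OF \<psi>] is_FT_fourier_L2[OF \<psi>K], of "-1"]]
        by (simp add: \<phi>_def)
      \<comment> \<open>outside the band one factor of the square is at most C K powr -(1 + \<sigma>), so that Q also bounds the loss in the Calderon sum\<close>
      have split: "AE \<gamma> in lborel. cmod (\<F> \<phi> \<gamma>) \<le> power_tail C (1 + \<sigma>) k \<gamma> \<and>
          cmod (\<F> \<psi>K \<gamma>) \<le> cmod (\<F> \<psi> \<gamma>) \<and>
          (\<gamma> \<notin> {- k..k} \<longrightarrow> \<F> \<psi>K \<gamma> = 0) \<and>
          (cmod (\<F> \<psi> \<gamma>))\<^sup>2 \<le> (cmod (\<F> \<psi>K \<gamma>))\<^sup>2 + C * k powr (- (1 + \<sigma>)) * power_tail C (1 + \<sigma>) k \<gamma>"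
        using trunc \<phi>hat decay
      proof eventually_elim
        case h: (elim \<gamma>)
        show ?case
        proof (cases "\<gamma> \<in> {- k..k}")
          case True
          then show ?thesis using h C by (simp add: power_tail_nonneg)
        next
          case False
          then have g: "k < \<bar>\<gamma>\<bar>" by auto
          have 0: "\<F> \<psi>K \<gamma> = 0" using h False by simp
          have "cmod (\<F> \<psi> \<gamma>) \<le> C / (1 + \<bar>\<gamma>\<bar> powr (1 + \<sigma>))" using h by simp
          also have "\<dots> \<le> C / (\<bar>\<gamma>\<bar> powr (1 + \<sigma>))"
            using g k C by (intro divide_left_mono) (auto intro!: mult_pos_pos add_pos_pos)
          also have "\<dots> = C * \<bar>\<gamma>\<bar> powr (- (1 + \<sigma>))"
            by (simp add: powr_minus divide_inverse del: minus_add_distrib)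
          finally have le: "cmod (\<F> \<psi> \<gamma>) \<le> C * \<bar>\<gamma>\<bar> powr (- (1 + \<sigma>))" .
          also have "\<dots> \<le> C * k powr (- (1 + \<sigma>))"
            using g k C \<sigma> by (intro mult_left_mono powr_mono2') auto
          finally have le2: "cmod (\<F> \<psi> \<gamma>) \<le> C * k powr (- (1 + \<sigma>))" .
          have t: "power_tail C (1 + \<sigma>) k \<gamma> = C * \<bar>\<gamma>\<bar> powr (- (1 + \<sigma>))" using g by (simp add: power_tail_def)
          have "(cmod (\<F> \<psi> \<gamma>))\<^sup>2 \<le> C * k powr (- (1 + \<sigma>)) * power_tail C (1 + \<sigma>) k \<gamma>"
            unfolding power2_eq_square using le le2 C unfolding t by (intro mult_mono) auto
          then show ?thesis using h 0 le t by simp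
        qed
      qed
      have supp: "AE \<gamma> in lborel. \<gamma> \<notin> {- k..k} \<longrightarrow> \<F> \<psi>K \<gamma> = 0"
        using split by (rule AE_mp) (auto intro!: AE_I2)
      have tail: "AE \<gamma> in lborel. cmod (\<F> \<phi> \<gamma>) \<le> power_tail C (1 + \<sigma>) k \<gamma>"
        using split by (rule AE_mp) (auto intro!: AE_I2)
      define good where "good \<gamma> \<longleftrightarrow> (calderon_le a (\<F> \<psi>K) (b * B) \<gamma>) \<and> S0 \<le> S \<gamma>" for \<gamma>
      have good: "AE \<gamma> in lborel. good \<gamma>"
        using AE_scales[OF split a0] upb lowb
      proof eventually_elim
        case h: (elim \<gamma>)
        have bdK: "(\<Sum>j\<in>J. (cmod (\<F> \<psi>K (a powi j * \<gamma>)))\<^sup>2) \<le> b * B" if "finite J" for J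
        proof -
          have "(\<Sum>j\<in>J. (cmod (\<F> \<psi>K (a powi j * \<gamma>)))\<^sup>2) \<le> (\<Sum>j\<in>J. (cmod (\<F> \<psi> (a powi j * \<gamma>)))\<^sup>2)"
            using h by (intro sum_mono power_mono) auto
          also have "\<dots> \<le> b * B" using h that by blast
          finally show ?thesis .
        qed
        have "calderon a (\<F> \<psi>) \<gamma> \<le> S \<gamma> + C * k powr (- (1 + \<sigma>)) * Q"
        proof (rule calderon_bounds(2))
          fix J :: "int set" assume J: "finite J"
          have "(\<Sum>j\<in>J. (cmod (\<F> \<psi> (a powi j * \<gamma>)))\<^sup>2) \<le>
              (\<Sum>j\<in>J. (cmod (\<F> \<psi>K (a powi j * \<gamma>)))\<^sup>2 + C * k powr (- (1 + \<sigma>)) * power_tail C (1 + \<sigma>) k (a powi j * \<gamma>))"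
            using h by (intro sum_mono) blast
          also have "\<dots> = (\<Sum>j\<in>J. (cmod (\<F> \<psi>K (a powi j * \<gamma>)))\<^sup>2)
              + C * k powr (- (1 + \<sigma>)) * (\<Sum>j\<in>J. power_tail C (1 + \<sigma>) k (a powi j * \<gamma>))"
            by (simp add: sum.distrib sum_distrib_left)
          also have "\<dots> \<le> S \<gamma> + C * k powr (- (1 + \<sigma>)) * Q"
          proof (intro add_mono mult_left_mono)
            show "(\<Sum>j\<in>J. (cmod (\<F> \<psi>K (a powi j * \<gamma>)))\<^sup>2) \<le> S \<gamma>"
              unfolding S_def by (rule calderon_bounds(3)[OF bdK J])
            show "(\<Sum>j\<in>J. power_tail C (1 + \<sigma>) k (a powi j * \<gamma>)) \<le> Q"
              unfolding Q_def by (rule power_tail_dilation_sum[OF a k(2) _ less_imp_le[OF C] J]) (use \<sigma> in simp)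
          qed (use C in auto)
          finally show "(\<Sum>j\<in>J. (cmod (\<F> \<psi> (a powi j * \<gamma>)))\<^sup>2) \<le> S \<gamma> + C * k powr (- (1 + \<sigma>)) * Q" .
        qed
        moreover have "C * k powr (- (1 + \<sigma>)) * Q \<le> M * Q"
        proof (rule mult_right_mono)
          have "C * k powr (- (1 + \<sigma>)) \<le> 2 * C * k powr (- (1 + \<sigma>))"
            using C by simp
          also have "\<dots> \<le> M" unfolding M_def using C \<sigma> b' by (simp add: distrib_left)
          finally show "C * k powr (- (1 + \<sigma>)) \<le> M" .
        qed (use Q0 in simp)
        ultimately have "S0 \<le> S \<gamma>" using MQ h unfolding S0_def by linarith
        then show ?case unfolding good_def using bdK by blast
      qed
      have bdK: "AE \<gamma> in lborel. calderon_le a (\<F> \<psi>K) (b * B) \<gamma>"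
        using good by (rule AE_mp) (auto intro!: AE_I2 simp: good_def)
      have SposAE: "AE \<gamma> in lborel. S \<gamma> > 0"
        using good by (rule AE_mp) (use S0pos in \<open>auto intro!: AE_I2 simp: good_def\<close>)
      have tilde_eq: "of_real b * \<F> \<psi>K \<gamma> / of_real (of_int N * (\<Sum>\<^sub>\<infinity>k::int. (cmod (\<F> \<psi>K (a powi k * \<gamma>)))\<^sup>2))
          = of_real (b' / S \<gamma>) * \<F> \<psi>K \<gamma>" for \<gamma>
        unfolding S_def calderon_def b'_def by simp
      show "\<exists>\<psi>t. is_tilde a b N \<psi>K \<psi>t"
      proof -
        have "(\<lambda>\<gamma>. of_real (b' / S \<gamma>) * \<F> \<psi>K \<gamma>) \<in> L2"
        proof (rule L2_bound[OF fourier_L2_L2[OF \<psi>K], where M = "b' / S0"])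
          show "AE \<gamma> in lborel. cmod (of_real (b' / S \<gamma>) * \<F> \<psi>K \<gamma>) \<le> b' / S0 * cmod (\<F> \<psi>K \<gamma>)"
            using good
          proof (rule AE_mp, intro AE_I2 impI)
            fix \<gamma> assume "good \<gamma>"
            then have S: "S0 \<le> S \<gamma>" by (simp add: good_def)
            then have "\<bar>b' / S \<gamma>\<bar> \<le> b' / S0"
              using S0pos b' by (simp add: frac_le)
            then show "cmod (of_real (b' / S \<gamma>) * \<F> \<psi>K \<gamma>) \<le> b' / S0 * cmod (\<F> \<psi>K \<gamma>)"
              unfolding norm_mult norm_of_real by (rule mult_right_mono) simp
          qed
        qed measurable
        from fourier_L2_surj[OF this] show ?thesis
          unfolding is_tilde_def tilde_eq by blast
      qed
      fix \<psi>t assume ti: "is_tilde a b N \<psi>K \<psi>t"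
      then have \<psi>t: "\<psi>t \<in> L2"
        and psit_hat: "AE \<gamma> in lborel. \<F> \<psi>t \<gamma> = of_real (b' / S \<gamma>) * \<F> \<psi>K \<gamma>"
        unfolding is_tilde_def tilde_eq by auto
      have suppt: "AE \<gamma> in lborel. \<gamma> \<notin> {- k..k} \<longrightarrow> \<F> \<psi>t \<gamma> = 0"
        using AE_conjI[OF supp psit_hat] by (rule AE_mp) (auto intro!: AE_I2)
      have bdt: "AE \<gamma> in lborel. calderon_le a (\<F> \<psi>t) (b'\<^sup>2 / S0) \<gamma>"
        using AE_scales[OF psit_hat a0] good
      proof (eventually_elim, intro allI impI)
        fix \<gamma> and J :: "int set"
        assume h: "\<forall>j::int. \<F> \<psi>t (a powi j * \<gamma>) = of_real (b' / S (a powi j * \<gamma>)) * \<F> \<psi>K (a powi j * \<gamma>)"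
          "good \<gamma>" and J: "finite J"
        have S: "S0 \<le> S \<gamma>" and bdK: "\<And>J. finite J \<Longrightarrow> (\<Sum>j\<in>J. (cmod (\<F> \<psi>K (a powi j * \<gamma>)))\<^sup>2) \<le> b * B"
          using h by (auto simp: good_def)
        have Sp: "S \<gamma> > 0" using S S0pos by simp
        have sh: "S (a powi j * \<gamma>) = S \<gamma>" for j :: int
          unfolding S_def by (rule calderon_shift) (use a0 in simp)
        have ht: "\<F> \<psi>t (a powi j * \<gamma>) = of_real (b' / S \<gamma>) * \<F> \<psi>K (a powi j * \<gamma>)" for j :: int
          using h unfolding sh by blast
        have "(\<Sum>j\<in>J. (cmod (\<F> \<psi>t (a powi j * \<gamma>)))\<^sup>2) = (b' / S \<gamma>)\<^sup>2 * (\<Sum>j\<in>J. (cmod (\<F> \<psi>K (a powi j * \<gamma>)))\<^sup>2)"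
          unfolding ht norm_mult norm_of_real power_mult_distrib power2_abs sum_distrib_left ..
        also have "\<dots> \<le> (b' / S \<gamma>)\<^sup>2 * S \<gamma>"
          using calderon_bounds(3)[OF bdK J] unfolding S_def by (intro mult_left_mono) auto
        also have "\<dots> = b'\<^sup>2 / S \<gamma>" using Sp by (simp add: power2_eq_square)
        also have "\<dots> \<le> b'\<^sup>2 / S0" using S S0pos by (intro divide_left_mono) auto
        finally show "(\<Sum>j\<in>J. (cmod (\<F> \<psi>t (a powi j * \<gamma>)))\<^sup>2) \<le> b'\<^sup>2 / S0" .
      qed
      have k0: "k \<ge> 0" using k by simp
      have bB: "0 \<le> b * B" using b B0 by simp
      have bS: "0 \<le> b'\<^sup>2 / S0" using S0pos by simp
      have BK: "bessel_bound (wavelet_system a b' \<psi>K) (b * B / b')"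
        by (rule bessel_bandlimited[OF a0 b' \<psi>K K2 k0 supp bdK bB])
      have "bessel_bound (wavelet_system a b' \<psi>t) (b'\<^sup>2 / S0 / b')"
        by (rule bessel_bandlimited[OF a0 b' \<psi>t K2 k0 suppt bdt bS])
      then have Bt: "bessel_bound (wavelet_system a b' \<psi>t) (b' / S0)"
        using b' by (simp add: power2_eq_square)
      have B\<phi>: "bessel_bound (wavelet_system a b' \<phi>) (M * Q / b')"
        unfolding M_def Q_def by (rule bessel_tail[OF a b' \<phi> k(2) \<sigma> less_imp_le[OF C] tail])
      have sum: "wavelet_system a b' \<psi> i = (\<lambda>x. wavelet_system a b' \<psi>K i x + wavelet_system a b' \<phi> i x)" for i
        using wavelet_system_add[of a b' \<psi>K \<phi> i] by (simp add: \<phi>_def)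
      have rec: "(\<Sum>\<^sub>\<infinity>i. wcoeff a b' \<psi>t f i * cnj (wcoeff a b' \<psi>K h i)) = L2_inner f h"
        if "f \<in> L2" "h \<in> L2" for f h
        by (rule reconstruction[OF a0 b' \<psi>K \<psi>t K2 k0 supp suppt bdK bdt bB bS
              psit_hat[unfolded S_def] SposAE[unfolded S_def] \<open>f \<in> L2\<close> \<open>h \<in> L2\<close>])
      show "Bessel_seq (wavelet_system a (b / of_int N) \<psi>)"
        unfolding b'_def[symmetric] by (rule Bessel_seq_if_bessel_bound[OF bessel_bound_add[OF BK B\<phi> sum]])
      show "Bessel_seq (wavelet_system a (b / of_int N) \<psi>t)"
        unfolding b'_def[symmetric] by (rule Bessel_seq_if_bessel_bound[OF Bt])
      have "L2_opnorm (\<lambda>f x. f x - synthesis (wavelet_system a b' \<psi>) (L2_adjoint (synthesis (wavelet_system a b' \<psi>t)) f) x)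
          \<le> ereal (sqrt ((b' / S0) * (M * Q / b')))"
        by (rule approximate_dual_bound[OF B\<phi> Bt BK sum rec])
      also have "\<dots> \<le> ereal \<epsilon>" using ratio by simp
      finally show "let U = synthesis (wavelet_system a (b / of_int N) \<psi>);
                  W = synthesis (wavelet_system a (b / of_int N) \<psi>t)
              in L2_opnorm (\<lambda>f x. f x - U (L2_adjoint W f) x) \<le> ereal \<epsilon>"
        unfolding b'_def[symmetric] Let_def .
    qed
  qed
qed

end
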